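(* Let $(\mathcal X,\Gamma)$ be a topological local diffusion space, and let $\mu$ be a probability measure on $(\Upsilon,\Sigma_{\mathrm v})$, concentrated on configurations with infinitely many points, which is marginally absolutely continuous and satisfies the closability assumption. Let $\mathfrak l$ be a fixed labeling map, let $K_n$ ($n\in\mathbb N\cup\{\infty\}$) be the Hilbert spaces defined in the context, let $K=\mathscr D(\mathcal E^{\Upsilon,\mu})$ with the norm $(\mathcal E^{\Upsilon,\mu}(u)+\|u\|_{L^2(\mu)}^2)^{1/2}$, let $\mathfrak D=\mathrm{Cyl}_\mu(\mathcal D)$ and $\Psi_n:\mathfrak D\to K_n$, $\Psi_n(u)=(\mathfrak L^*u)\circ\mathrm{tr}^n$. Then, as $n\to\infty$, the Hilbert spaces $K_n$ converge to the Hilbert subspace $\mathfrak L^*K$ of $K_\infty$ in the sense of Kuwae--Shioya w.r.t. the pair $(\Psi_n\circ(\mathfrak L^* )^{-1},\mathfrak L^*(\mathfrak D))$.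
   Context: A topological local structure $\mathcal X=(X,\tau,\Sigma,\mathsf m,\mathscr E)$ consists of a non-empty completely regular Hausdorff Luzin space $(X,\tau)$ (a continuous bijective image of a Polish space), a $\sigma$-algebra $\Sigma$ with $\mathscr B_\tau\subset\Sigma\subset\mathscr B_\tau^{\mathsf m}$ (Borel $\sigma$-algebra and its $\mathsf m$-completion) that contains all singletons and is, up to $\mathsf m$-null sets, countably generated, a $\sigma$-finite atomless Radon measure $\mathsf m$ on $\Sigma$ with full $\tau$-support, and a localizing ring $\mathscr E$: a family $\mathscr E\subset\{A\in\Sigma:\mathsf mA<\infty\}$ closed under finite unions and intersections, with $A\cap E\in\mathscr E$ for $A\in\Sigma$, $E\in\mathscr E$, such that $\mathscr E=\bigcup_h\{A\cap E_h:A\in\Sigma\}$ for some sequence $E_h\uparrow X$ in $\Sigma$ with $\mathsf mE_h<\infty$, and such that every $x\in X$ has a $\tau$-neighbourhood in $\mathscr E$. $\mathcal C_0(\mathscr E)$ (resp. $\Sigma_b(\mathscr E)$) is the space of bounded $\tau$-continuous (resp. bounded $\Sigma$-measurable) real functions vanishing outside some $E\in\mathscr E$. $\mathcal C_b^\infty(\mathbb R^k)$ is the space of bounded smooth functions with bounded derivatives of all orders. A topological local diffusion space $(\mathcal X,\Gamma)$ is a topological local structure with a square field operator $(\Gamma,\mathcal D)$: $\mathcal D\subset\mathcal C_0(\mathscr E)$ is an algebra generating $\tau$ (functions identified with their $\mathsf m$-classes) with $\varphi\circ\mathbf f-\varphi(0)\in\mathcal D$ for $\mathbf f\in\mathcal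 D^k$, $\varphi\in\mathcal C_b^\infty(\mathbb R^k)$; $\Gamma:\mathcal D\times\mathcal D\to L^\infty(\mathsf m)$ is symmetric, bilinear, non-negative definite, takes values in $\mathsf m$-classes of functions in $\Sigma_b(\mathscr E)$, and satisfies $\Gamma(\varphi\circ\mathbf f-\varphi(0),\psi\circ\mathbf g-\psi(0))=\sum_{i,j}(\partial_i\varphi)(\mathbf f)(\partial_j\psi)(\mathbf g)\Gamma(f_i,g_j)$ $\mathsf m$-a.e.; the form $\int\Gamma(f,g)\,d\mathsf m$ on $\mathcal D$ is closable and densely defined in $L^2(\mathsf m)$, and its closure $\mathcal E^{X,\mathsf m}$ is a quasi-regular Dirichlet form, with square field operator $\Gamma^{X,\mathsf m}$ extending $\Gamma$ (also extended to bounded functions in the extended Dirichlet space). A strong lifting $\ell:L^\infty(\mathsf m)\to\mathcal L^\infty(\mathsf m)$ (bounded $\Sigma$-measurable functions) is a linear, multiplicative, order preserving map with $\ell(1)=1$, $[\ell(f)]_{\mathsf m}=f$, $\ell(\varphi)=\varphi$ for $\varphi\in\mathcal C_b(X)$; one is fixed. $\Upsilon$ is the set of all $\gamma=\sum_{i\le N}\delta_{x_i}$, $N\in\mathbb N_0\cup\{\infty\}$, $x_i\in X$ (repetitions allowed), with $\gamma E<\infty$ for all $E\in\mathscr E$; $\Sigma_{\mathrm v}$ is generated by $\gamma\mapsto\gamma E$, $E\in\mathscr E$. Put $f^\star\gamma=\int f\,d\gamma$. $\mathrm{Cyl}(\mathcal D)$ is the space of functions $u=F(f_1^\star,\dots,f_k^\star)$,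 $F\in\mathcal C_b^\infty(\mathbb R^k)$, $f_i\in\mathcal D$, and $\mathrm{Cyl}_\mu(\mathcal D)$ the space of their $\mu$-classes. For $u=F(f_1^\star,\dots,f_k^\star)$, $v=G(g_1^\star,\dots,g_m^\star)$, $\Gamma^\Upsilon(u,v)(\gamma)=\sum_{i,j}\partial_iF(f_1^\star\gamma,\dots)\,\partial_jG(g_1^\star\gamma,\dots)\int\ell(\Gamma(f_i,g_j))\,d\gamma$. Closability assumption on $\mu$: $\int\gamma E\,d\mu<\infty$ for all $E\in\mathscr E$, and the pre-Dirichlet form $\mathcal E^{\Upsilon,\mu}(u,v)=\int\Gamma^\Upsilon(u,v)\,d\mu$ on $\mathrm{Cyl}_\mu(\mathcal D)$ is closable on $L^2(\mu)$; its closure is $(\mathcal E^{\Upsilon,\mu},\mathscr D(\mathcal E^{\Upsilon,\mu}))$. $\mathbf X_{\mathrm{lcf}}$ is the set of finite or infinite sequences $\mathbf x=(x_i)_{i\le N}$ in $X$ (including the empty one) with $\#\{i:x_i\in E\}<\infty$ for all $E\in\mathscr E$, and $\mathbf X^{[\infty]}_{\mathrm{lcf}}$ its subset of infinite sequences; $\mathfrak L(\mathbf x)=\sum_i\delta_{x_i}$, $\mathfrak L^*u=u\circ\mathfrak L$. A labeling map is a $\Sigma_{\mathrm v}^\mu$/Borel-measurable right inverse $\mathfrak l:\Upsilon\to\mathbf X_{\mathrm{lcf}}$ of $\mathfrak L$ ($\Sigma_{\mathrm v}^\mu$ the $\mu$-completion). $\mathrm{tr}^n$ maps a sequence to its first $n$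 entries. $\mu$ is marginally absolutely continuous if for every labeling map $\mathfrak l$ and every $n\in\mathbb N$, $(\mathrm{tr}^n\circ\mathfrak l)_\#(\mu|_{\{\gamma X\ge n\}})\ll\mathsf m^{\otimes n}$. Set $\mu^{[\infty]}=\mathfrak l_\#\mu$. For $U:\mathbf X^{[\infty]}_{\mathrm{lcf}}\to\mathbb R$ bounded, measurable w.r.t. $\bigcap_{\mathfrak l}$ (completion of the Borel $\sigma$-algebra of $X^\infty$ w.r.t. $\mathfrak l_\#\mu$), let $U_{\mathbf x,p}(z)=U(x_1,\dots,x_{p-1},z,x_{p+1},\dots)$ and, for $N\in\mathbb N\cup\{\infty\}$, $\Gamma^{[N]}(U)(\mathbf x)=\sum_{p\le N}\ell(\Gamma^{X,\mathsf m}(U_{\mathbf x,p}))(x_p)$, whenever this makes sense, with bilinear version by polarization. $U$ is pre-Sobolev if $\|\,|U|+\Gamma^{[\infty]}(U)^{1/2}\|_{L^2(\mathfrak l_\#\mu)}\le M$ for some $M$ and all labeling maps $\mathfrak l$. On $\mu^{[\infty]}$-classes of pre-Sobolev functions set $\mathcal E^{[N]}(U,V)=\int\Gamma^{[N]}(U,V)\,d\mu^{[\infty]}$ (well defined on classes); $K_N$ is the abstract Hilbert completion of this space w.r.t. $(\mathcal E^{[N]}(U)+\|U\|^2_{L^2(\mu^{[\infty]})})^{1/2}$. For cylinder $u$, both $\mathfrak L^*u$ and $(\mathfrak L^*u)\circ\mathrm{tr}^n$ are pre-Sobolev; $\mathfrak L^*:K\to K_\infty$ is the isometric continuous extension from cylinder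 functions, and $\mathfrak L^*K$ is its image with the norm of $K_\infty$. Kuwae--Shioya convergence: a net of Hilbert spaces $(H_\alpha)$ converges to a Hilbert space $H$ w.r.t. the pair $(\Phi_\alpha,\mathfrak C)$ if $\mathfrak C\subset H$ is a dense linear subspace and $\Phi_\alpha:\mathfrak C\to H_\alpha$ are linear maps with $\limsup_\alpha\|\Phi_\alpha u\|_{H_\alpha}=\|u\|_H$ for all $u\in\mathfrak C$.
   Formalization: Ψ_n depends on the representative of a μ-class, so it is defined through an arbitrary linear choice of cylinder representatives; also Γ^{X,m} is extended by Γ(u+c)=Γ(u) for constants c, as needed for cylinder functions to be pre-Sobolev. *)

theory Defs
  imports "HOL-Probability.Probability"
begin

section \<open>Smooth functions of finitely many variables\<close>

text \<open>
  A function on \<open>\<real>\<^sup>k\<close> is encoded as a function on \<open>nat \<Rightarrow> real\<close> which depends on the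
  coordinates \<open>0, \<dots>, k - 1\<close> only; a tuple \<open>(f\<^sub>1, \<dots>, f\<^sub>k)\<close> is a family \<open>f i\<close>, \<open>i < k\<close>.
\<close>

definition partial_deriv :: "nat \<Rightarrow> ((nat \<Rightarrow> real) \<Rightarrow> real) \<Rightarrow> (nat \<Rightarrow> real) \<Rightarrow> real" where
  "partial_deriv i F y = deriv (\<lambda>t. F (y(i := t))) (y i)"

definition Cb_smooth :: "nat \<Rightarrow> ((nat \<Rightarrow> real) \<Rightarrow> real) set" where
  "Cb_smooth k = {F. (\<forall>y z. (\<forall>i<k. y i = z i) \<longrightarrow> F y = F z) \<and>
     (\<forall>is. set is \<subseteq> {..<k} \<longrightarrow>
        continuous_on UNIV (foldr partial_deriv is F) \<and>
        bounded (range (foldr partial_deriv is F)) \<and>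
        (\<forall>i<k. \<forall>y. (\<lambda>t. foldr partial_deriv is F (y(i := t))) differentiable (at (y i))))}"


section \<open>Quadratic forms on \<open>L\<^sup>2\<close> and Dirichlet forms\<close>

text \<open>
  Elements of \<open>L\<^sup>2(M)\<close>, \<open>L\<^sup>\<infinity>(M)\<close> are represented by functions; sets of classes are represented
  by sets of functions, and operations on classes by operations on functions which respect
  equality almost everywhere.
\<close>

definition L2_fun :: "'a measure \<Rightarrow> ('a \<Rightarrow> real) set" where
  "L2_fun M = {f \<in> borel_measurable M. integrable M (\<lambda>x. (f x)\<^sup>2)}"

definition L2_norm :: "'a measure \<Rightarrow> ('a \<Rightarrow> real) \<Rightarrow> real" where
  "L2_norm M f = sqrt (\<integral>x. (f x)\<^sup>2 \<partial>M)"

definition Linf_fun :: "'a measure \<Rightarrow> ('a \<Rightarrow> real) set" where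
  "Linf_fun M = {f \<in> borel_measurable M. \<exists>C. AE x in M. \<bar>f x\<bar> \<le> C}"

type_synonym 'a form = "('a \<Rightarrow> real) \<Rightarrow> ('a \<Rightarrow> real) \<Rightarrow> real"

definition form_cauchy :: "'a form \<Rightarrow> (nat \<Rightarrow> 'a \<Rightarrow> real) \<Rightarrow> bool" where
  "form_cauchy Q u \<longleftrightarrow>
     (\<forall>e>0. \<exists>n. \<forall>i\<ge>n. \<forall>j\<ge>n. Q (\<lambda>x. u i x - u j x) (\<lambda>x. u i x - u j x) < e)"

definition form_approx ::
  "'a measure \<Rightarrow> 'a form \<Rightarrow> ('a \<Rightarrow> real) set \<Rightarrow> (nat \<Rightarrow> 'a \<Rightarrow> real) \<Rightarrow> ('a \<Rightarrow> real) \<Rightarrow> bool" where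
  "form_approx M Q D u f \<longleftrightarrow>
     (\<forall>n. u n \<in> D) \<and> form_cauchy Q u \<and> (\<lambda>n. L2_norm M (\<lambda>x. u n x - f x)) \<longlonglongrightarrow> 0"

text \<open>The constant sequences in this definition show that a closable form is well defined on
  \<open>M\<close>-classes.\<close>

definition closable :: "'a measure \<Rightarrow> 'a form \<Rightarrow> ('a \<Rightarrow> real) set \<Rightarrow> bool" where
  "closable M Q D \<longleftrightarrow> (\<forall>u. form_approx M Q D u (\<lambda>x. 0) \<longrightarrow> (\<lambda>n. Q (u n) (u n)) \<longlonglongrightarrow> 0)"

definition closure_dom :: "'a measure \<Rightarrow> 'a form \<Rightarrow> ('a \<Rightarrow> real) set \<Rightarrow> ('a \<Rightarrow> real) set" where
  "closure_dom M Q D = {f \<in> L2_fun M. \<exists>u. form_approx M Q D u f}"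

definition closure_form :: "'a measure \<Rightarrow> 'a form \<Rightarrow> ('a \<Rightarrow> real) set \<Rightarrow> 'a form" where
  "closure_form M Q D f g =
     (THE q. \<exists>u v. form_approx M Q D u f \<and> form_approx M Q D v g \<and> (\<lambda>n. Q (u n) (v n)) \<longlonglongrightarrow> q)"

definition L2_dense :: "'a measure \<Rightarrow> ('a \<Rightarrow> real) set \<Rightarrow> bool" where
  "L2_dense M D \<longleftrightarrow>
     D \<subseteq> L2_fun M \<and> (\<forall>f\<in>L2_fun M. \<forall>e>0. \<exists>g\<in>D. L2_norm M (\<lambda>x. f x - g x) < e)"

definition fun_subspace :: "('a \<Rightarrow> real) set \<Rightarrow> bool" where
  "fun_subspace D \<longleftrightarrow> D \<noteq> {} \<and> (\<forall>f\<in>D. \<forall>g\<in>D. \<forall>a b. (\<lambda>x. a * f x + b * g x) \<in> D)"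

definition dirichlet_form :: "'a measure \<Rightarrow> 'a form \<Rightarrow> ('a \<Rightarrow> real) set \<Rightarrow> bool" where
  "dirichlet_form M Q F \<longleftrightarrow>
     fun_subspace F \<and> L2_dense M F \<and>
     (\<forall>f\<in>F. \<forall>g\<in>F. Q f g = Q g f) \<and>
     (\<forall>f\<in>F. \<forall>g\<in>F. \<forall>h\<in>F. \<forall>a b. Q (\<lambda>x. a * f x + b * g x) h = a * Q f h + b * Q g h) \<and>
     (\<forall>f\<in>F. 0 \<le> Q f f) \<and>
     (\<forall>u. \<forall>f\<in>L2_fun M. form_approx M Q F u f \<longrightarrow>
        f \<in> F \<and> (\<lambda>n. Q (\<lambda>x. u n x - f x) (\<lambda>x. u n x - f x)) \<longlonglongrightarrow> 0) \<and>
     (\<forall>f\<in>F. (\<lambda>x. min (max (f x) 0) 1) \<in> F \<and>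
        Q (\<lambda>x. min (max (f x) 0) 1) (\<lambda>x. min (max (f x) 0) 1) \<le> Q f f)"

definition form_dense :: "'a measure \<Rightarrow> 'a form \<Rightarrow> ('a \<Rightarrow> real) set \<Rightarrow> ('a \<Rightarrow> real) set \<Rightarrow> bool" where
  "form_dense M Q F G \<longleftrightarrow> (\<forall>u\<in>F. \<forall>e>0. \<exists>v\<in>G.
     Q (\<lambda>x. u x - v x) (\<lambda>x. u x - v x) + (L2_norm M (\<lambda>x. u x - v x))\<^sup>2 < e)"

definition form_nest ::
  "'a::topological_space measure \<Rightarrow> 'a form \<Rightarrow> ('a \<Rightarrow> real) set \<Rightarrow> (nat \<Rightarrow> 'a set) \<Rightarrow> bool" where
  "form_nest M Q F A \<longleftrightarrow> (\<forall>n. closed (A n)) \<and> incseq A \<and>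
     form_dense M Q F (\<Union>n. {u \<in> F. AE x in M. x \<notin> A n \<longrightarrow> u x = 0})"

definition form_exceptional ::
  "'a::topological_space measure \<Rightarrow> 'a form \<Rightarrow> ('a \<Rightarrow> real) set \<Rightarrow> 'a set \<Rightarrow> bool" where
  "form_exceptional M Q F N \<longleftrightarrow> (\<exists>A. form_nest M Q F A \<and> N \<subseteq> (\<Inter>n. - A n))"

definition quasi_continuous ::
  "'a::topological_space measure \<Rightarrow> 'a form \<Rightarrow> ('a \<Rightarrow> real) set \<Rightarrow> ('a \<Rightarrow> real) \<Rightarrow> bool" where
  "quasi_continuous M Q F f \<longleftrightarrow> (\<exists>A. form_nest M Q F A \<and> (\<forall>n. continuous_on (A n) f))"

definition quasi_regular ::
  "'a::topological_space measure \<Rightarrow> 'a form \<Rightarrow> ('a \<Rightarrow> real) set \<Rightarrow> bool" where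
  "quasi_regular M Q F \<longleftrightarrow>
     (\<exists>A. form_nest M Q F A \<and> (\<forall>n. compact (A n))) \<and>
     (\<exists>G\<subseteq>F. form_dense M Q F G \<and>
        (\<forall>u\<in>G. \<exists>v. (AE x in M. u x = v x) \<and> quasi_continuous M Q F v)) \<and>
     (\<exists>u v N. (\<forall>n::nat. u n \<in> F \<and> (AE x in M. u n x = v n x) \<and> quasi_continuous M Q F (v n)) \<and>
        form_exceptional M Q F N \<and>
        (\<forall>x y. x \<notin> N \<longrightarrow> y \<notin> N \<longrightarrow> x \<noteq> y \<longrightarrow> (\<exists>n. v n x \<noteq> v n y)))"

definition extended_dom :: "'a measure \<Rightarrow> 'a form \<Rightarrow> ('a \<Rightarrow> real) set \<Rightarrow> ('a \<Rightarrow> real) set" where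
  "extended_dom M Q F = {u \<in> borel_measurable M. \<exists>f. (\<forall>n::nat. f n \<in> F) \<and> form_cauchy Q f \<and>
     (AE x in M. (\<lambda>n. f n x) \<longlonglongrightarrow> u x)}"


section \<open>Topological local diffusion spaces\<close>

text \<open>
  The \<open>\<sigma>\<close>-algebra \<open>\<Sigma>\<close> is \<open>sets (meas X)\<close>. The values of \<open>sqf X\<close> (the operator \<open>\<Gamma>\<close>) and the
  arguments of \<open>lift X\<close> (the lifting \<open>\<ell>\<close>) are representatives of classes in \<open>L\<^sup>\<infinity>\<close>.
\<close>

record 'x local_space =
  meas :: "'x measure"
  lring :: "'x set set"
  core :: "('x \<Rightarrow> real) set"
  sqf :: "('x \<Rightarrow> real) \<Rightarrow> ('x \<Rightarrow> real) \<Rightarrow> 'x \<Rightarrow> real"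
  lift :: "('x \<Rightarrow> real) \<Rightarrow> 'x \<Rightarrow> real"

text \<open>A Polish space mapped bijectively onto \<open>'x\<close> may be taken to have its points in \<open>'x\<close>.\<close>

definition luzin_space :: "'x::topological_space itself \<Rightarrow> bool" where
  "luzin_space _ \<longleftrightarrow> (\<exists>(P :: 'x topology) (f :: 'x \<Rightarrow> 'x).
     completely_metrizable_space P \<and> second_countable P \<and>
     continuous_map P euclidean f \<and> bij_betw f (topspace P) UNIV)"

definition atomless :: "'x measure \<Rightarrow> bool" where
  "atomless M \<longleftrightarrow> (\<forall>A\<in>sets M. 0 < emeasure M A \<longrightarrow>
     (\<exists>B\<in>sets M. B \<subseteq> A \<and> 0 < emeasure M B \<and> emeasure M B < emeasure M A))"

definition radon :: "'x::topological_space measure \<Rightarrow> bool" where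
  "radon M \<longleftrightarrow>
     (\<forall>x. \<exists>U. open U \<and> x \<in> U \<and> emeasure M U < \<infinity>) \<and>
     (\<forall>A\<in>sets M. emeasure M A = (SUP C\<in>{C. compact C \<and> C \<subseteq> A}. emeasure M C))"

definition ess_countably_generated :: "'x measure \<Rightarrow> bool" where
  "ess_countably_generated M \<longleftrightarrow> (\<exists>C. countable C \<and> C \<subseteq> sets M \<and>
     (\<forall>A\<in>sets M. \<exists>B\<in>sigma_sets (space M) C. emeasure M ((A - B) \<union> (B - A)) = 0))"

definition localizing_ring :: "'x::topological_space measure \<Rightarrow> 'x set set \<Rightarrow> bool" where
  "localizing_ring M R \<longleftrightarrow>
     R \<subseteq> {A \<in> sets M. emeasure M A < \<infinity>} \<and>
     (\<forall>A\<in>R. \<forall>B\<in>R. A \<union> B \<in> R \<and> A \<inter> B \<in> R) \<and>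
     (\<forall>A\<in>sets M. \<forall>E\<in>R. A \<inter> E \<in> R) \<and>
     (\<exists>E::nat \<Rightarrow> 'x set. incseq E \<and> (\<Union>h. E h) = UNIV \<and>
        (\<forall>h. E h \<in> sets M \<and> emeasure M (E h) < \<infinity>) \<and>
        R = (\<Union>h. {A \<inter> E h |A. A \<in> sets M})) \<and>
     (\<forall>x. \<exists>E\<in>R. \<exists>U. open U \<and> x \<in> U \<and> U \<subseteq> E)"

definition topological_local_structure :: "('x::t2_space) local_space \<Rightarrow> bool" where
  "topological_local_structure X \<longleftrightarrow>
     completely_regular_space (euclidean :: 'x topology) \<and> luzin_space TYPE('x) \<and>
     space (meas X) = UNIV \<and>
     sets borel \<subseteq> sets (meas X) \<and>
     sets (meas X) \<subseteq> sets (completion (restr_to_subalg (meas X) borel)) \<and>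
     (\<forall>x. {x} \<in> sets (meas X)) \<and> ess_countably_generated (meas X) \<and>
     sigma_finite_measure (meas X) \<and> atomless (meas X) \<and> radon (meas X) \<and>
     (\<forall>U. open U \<longrightarrow> U \<noteq> {} \<longrightarrow> 0 < emeasure (meas X) U) \<and>
     localizing_ring (meas X) (lring X)"

definition C0_fun :: "('x::topological_space) local_space \<Rightarrow> ('x \<Rightarrow> real) set" where
  "C0_fun X = {f. continuous_on UNIV f \<and> bounded (range f) \<and>
     (\<exists>E\<in>lring X. \<forall>x. x \<notin> E \<longrightarrow> f x = 0)}"

definition Sb_fun :: "'x local_space \<Rightarrow> ('x \<Rightarrow> real) set" where
  "Sb_fun X = {f \<in> borel_measurable (meas X). bounded (range f) \<and>
     (\<exists>E\<in>lring X. \<forall>x. x \<notin> E \<longrightarrow> f x = 0)}"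

definition square_field_operator :: "('x::topological_space) local_space \<Rightarrow> bool" where
  "square_field_operator X \<longleftrightarrow>
     fun_subspace (core X) \<and> core X \<subseteq> C0_fun X \<and>
     (\<forall>f\<in>core X. \<forall>g\<in>core X. (\<lambda>x. f x * g x) \<in> core X) \<and>
     (euclidean :: 'x topology) = topology_generated_by {f -` V |f V. f \<in> core X \<and> open V} \<and>
     (\<forall>k. \<forall>\<phi>\<in>Cb_smooth k. \<forall>f. (\<forall>i<k. f i \<in> core X) \<longrightarrow>
        (\<lambda>x. \<phi> (\<lambda>i. f i x) - \<phi> (\<lambda>i. 0)) \<in> core X) \<and>
     (\<forall>f\<in>core X. \<forall>g\<in>core X. sqf X f g \<in> borel_measurable (meas X) \<and>
        (\<exists>h\<in>Sb_fun X. AE x in meas X. sqf X f g x = h x)) \<and>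
     (\<forall>f\<in>core X. \<forall>g\<in>core X. AE x in meas X. sqf X f g x = sqf X g f x) \<and>
     (\<forall>f\<in>core X. \<forall>g\<in>core X. \<forall>h\<in>core X. \<forall>a b. AE x in meas X.
        sqf X (\<lambda>y. a * f y + b * g y) h x = a * sqf X f h x + b * sqf X g h x) \<and>
     (\<forall>f\<in>core X. AE x in meas X. 0 \<le> sqf X f f x) \<and>
     (\<forall>k m. \<forall>\<phi>\<in>Cb_smooth k. \<forall>\<psi>\<in>Cb_smooth m. \<forall>f g.
        (\<forall>i<k. f i \<in> core X) \<longrightarrow> (\<forall>j<m. g j \<in> core X) \<longrightarrow>
        (AE x in meas X.
           sqf X (\<lambda>y. \<phi> (\<lambda>i. f i y) - \<phi> (\<lambda>i. 0)) (\<lambda>y. \<psi> (\<lambda>j. g j y) - \<psi> (\<lambda>j. 0)) x =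
           (\<Sum>i<k. \<Sum>j<m. partial_deriv i \<phi> (\<lambda>i. f i x) * partial_deriv j \<psi> (\<lambda>j. g j x) *
              sqf X (f i) (g j) x)))"

definition pre_form :: "'x local_space \<Rightarrow> 'x form" where
  "pre_form X f g = (\<integral>x. sqf X f g x \<partial>meas X)"

definition base_dom :: "'x local_space \<Rightarrow> ('x \<Rightarrow> real) set" where
  "base_dom X = closure_dom (meas X) (pre_form X) (core X)"

definition base_form :: "'x local_space \<Rightarrow> 'x form" where
  "base_form X = closure_form (meas X) (pre_form X) (core X)"

definition topological_local_diffusion_space :: "('x::t2_space) local_space \<Rightarrow> bool" where
  "topological_local_diffusion_space X \<longleftrightarrow>
     topological_local_structure X \<and> square_field_operator X \<and>
     L2_dense (meas X) (core X) \<and> closable (meas X) (pre_form X) (core X) \<and>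
     dirichlet_form (meas X) (base_form X) (base_dom X) \<and>
     quasi_regular (meas X) (base_form X) (base_dom X)"

definition strong_lifting :: "('x::topological_space) local_space \<Rightarrow> bool" where
  "strong_lifting X \<longleftrightarrow>
     (\<forall>f\<in>Linf_fun (meas X). lift X f \<in> borel_measurable (meas X) \<and> bounded (range (lift X f)) \<and>
        (AE x in meas X. lift X f x = f x)) \<and>
     (\<forall>f\<in>Linf_fun (meas X). \<forall>g\<in>Linf_fun (meas X).
        ((AE x in meas X. f x = g x) \<longrightarrow> lift X f = lift X g) \<and>
        ((AE x in meas X. f x \<le> g x) \<longrightarrow> (\<forall>x. lift X f x \<le> lift X g x)) \<and>
        (\<forall>a b x. lift X (\<lambda>y. a * f y + b * g y) x = a * lift X f x + b * lift X g x) \<and>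
        (\<forall>x. lift X (\<lambda>y. f y * g y) x = lift X f x * lift X g x)) \<and>
     (\<forall>x. lift X (\<lambda>y. 1) x = 1) \<and>
     (\<forall>\<phi>. continuous_on UNIV \<phi> \<longrightarrow> bounded (range \<phi>) \<longrightarrow> lift X \<phi> = \<phi>)"

text \<open>
  The quadratic form \<open>u \<mapsto> \<Gamma>\<^sup>X\<^sup>,\<^sup>m(u)\<close>, first on the domain of the closure, then on the
  extended Dirichlet space, both times as a limit in \<open>L\<^sup>1\<close>, then on functions which differ from an
  element of the latter by a constant. Constants cannot be left out: the sections of a cylinder
  function are sums of a constant and an element of \<open>core X\<close>, and the extended Dirichlet space of
  a transient form contains no constant but \<open>0\<close>. By the diffusion property a constant has energy
  density \<open>0\<close>, so the choices of the constant below are immaterial.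
\<close>

definition sqf_closure :: "'x local_space \<Rightarrow> ('x \<Rightarrow> real) \<Rightarrow> 'x \<Rightarrow> real" where
  "sqf_closure X u = (SOME g. integrable (meas X) g \<and>
     (\<exists>f. form_approx (meas X) (pre_form X) (core X) f u \<and>
        (\<lambda>n. \<integral>x. \<bar>sqf X (f n) (f n) x - g x\<bar> \<partial>meas X) \<longlonglongrightarrow> 0))"

definition base_extended_dom :: "'x local_space \<Rightarrow> ('x \<Rightarrow> real) set" where
  "base_extended_dom X = extended_dom (meas X) (base_form X) (base_dom X)"

definition sqf_extended :: "'x local_space \<Rightarrow> ('x \<Rightarrow> real) \<Rightarrow> 'x \<Rightarrow> real" where
  "sqf_extended X u = (if u \<in> base_dom X then sqf_closure X u else
     (SOME g. integrable (meas X) g \<and>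
        (\<exists>f. (\<forall>n::nat. f n \<in> base_dom X) \<and> form_cauchy (base_form X) f \<and>
           (AE x in meas X. (\<lambda>n. f n x) \<longlonglongrightarrow> u x) \<and>
           (\<lambda>n. \<integral>x. \<bar>sqf_closure X (f n) x - g x\<bar> \<partial>meas X) \<longlonglongrightarrow> 0)))"

definition sqf_dom :: "'x local_space \<Rightarrow> ('x \<Rightarrow> real) set" where
  "sqf_dom X = {u. bounded (range u) \<and> (\<exists>c. (\<lambda>x. u x - c) \<in> base_extended_dom X)}"

definition sqfX :: "'x local_space \<Rightarrow> ('x \<Rightarrow> real) \<Rightarrow> 'x \<Rightarrow> real" where
  "sqfX X u =
     (if \<exists>c. (\<lambda>x. u x - c) \<in> base_dom X
      then sqf_extended X (\<lambda>x. u x - (SOME c. (\<lambda>x. u x - c) \<in> base_dom X))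
      else sqf_extended X (\<lambda>x. u x - (SOME c. (\<lambda>x. u x - c) \<in> base_extended_dom X)))"


section \<open>Sequences, configurations and labeling maps\<close>

text \<open>
  A sequence of length \<open>N \<le> \<infinity>\<close> is a pair \<open>(N, x)\<close>; its entries are \<open>x 0, x 1, \<dots>\<close>, and \<open>x i\<close> is
  \<open>undefined\<close> for \<open>i \<ge> N\<close>.
\<close>

type_synonym 'x cseq = "enat \<times> (nat \<Rightarrow> 'x)"

definition idx :: "enat \<Rightarrow> nat set" where
  "idx N = {i. enat i < N}"

definition pow_borel :: "enat \<Rightarrow> (nat \<Rightarrow> 'x::topological_space) measure" where
  "pow_borel N = sigma (extensional (idx N)) {V. openin (product_topology (\<lambda>_. euclidean) (idx N)) V}"

text \<open>The Borel \<open>\<sigma>\<close>-algebra of the topological sum of the powers of \<open>'x\<close>.\<close>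

definition cseq_borel :: "('x::topological_space) cseq measure" where
  "cseq_borel = sigma (SIGMA N:UNIV. extensional (idx N))
     {{N} \<times> V |N V. openin (product_topology (\<lambda>_. euclidean) (idx N)) V}"

definition tr :: "nat \<Rightarrow> 'x cseq \<Rightarrow> 'x cseq" where
  "tr n \<xi> = (min (enat n) (fst \<xi>), restrict (snd \<xi>) (idx (min (enat n) (fst \<xi>))))"

definition X_lcf :: "'x local_space \<Rightarrow> 'x cseq set" where
  "X_lcf X = {(N, x). x \<in> extensional (idx N) \<and> (\<forall>E\<in>lring X. finite {i \<in> idx N. x i \<in> E})}"

definition X_lcf_inf :: "'x local_space \<Rightarrow> 'x cseq set" where
  "X_lcf_inf X = {\<xi> \<in> X_lcf X. fst \<xi> = \<infinity>}"

text \<open>The measure \<open>\<Sum>\<^sub>i \<delta>\<^bsub>x i\<^esub>\<close> on \<open>\<Sigma>\<close> is the image of the counting measure on the indices.\<close>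

definition lab :: "'x local_space \<Rightarrow> 'x cseq \<Rightarrow> 'x measure" where
  "lab X \<xi> = distr (count_space (idx (fst \<xi>))) (meas X) (snd \<xi>)"

definition conf :: "'x local_space \<Rightarrow> 'x measure set" where
  "conf X = {lab X (N, x) |N x. x \<in> extensional (idx N) \<and>
     (\<forall>E\<in>lring X. emeasure (lab X (N, x)) E < \<infinity>)}"

definition conf_algebra :: "'x local_space \<Rightarrow> 'x measure measure" where
  "conf_algebra X = sigma (conf X)
     {(\<lambda>\<gamma>. emeasure \<gamma> E) -` B \<inter> conf X |E B. E \<in> lring X \<and> B \<in> sets borel}"

definition labeling :: "('x::topological_space) local_space \<Rightarrow> 'x measure measure \<Rightarrow>
    ('x measure \<Rightarrow> 'x cseq) \<Rightarrow> bool" where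
  "labeling X \<mu> l \<longleftrightarrow> l \<in> completion \<mu> \<rightarrow>\<^sub>M cseq_borel \<and>
     (\<forall>\<gamma>\<in>conf X. l \<gamma> \<in> X_lcf X \<and> lab X (l \<gamma>) = \<gamma>)"

text \<open>The law of the first \<open>n\<close> labelled points is tested on Borel sets of the \<open>n\<close>-th power.\<close>

definition marginally_ac :: "('x::topological_space) local_space \<Rightarrow> 'x measure measure \<Rightarrow> bool" where
  "marginally_ac X \<mu> \<longleftrightarrow> (\<forall>l n. labeling X \<mu> l \<longrightarrow> 0 < n \<longrightarrow>
     (\<forall>A\<in>sets (pow_borel (enat n)). A \<in> null_sets (PiM (idx (enat n)) (\<lambda>_. meas X)) \<longrightarrow>
        {\<gamma> \<in> space \<mu>. of_nat n \<le> emeasure \<gamma> UNIV \<and> snd (tr n (l \<gamma>)) \<in> A}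
          \<in> null_sets (completion \<mu>)))"

text \<open>
  \<open>labelled_law X \<mu> l\<close> is the completion of the image measure of \<open>\<mu>\<close> under \<open>l\<close>. When \<open>\<mu>\<close> is
  concentrated on infinite configurations and marginally absolutely continuous, the complement of
  \<open>X_lcf_inf X\<close> is a null set for it; functions on \<open>X_lcf_inf X\<close> are represented by total functions
  whose other values play no role.
\<close>

definition labelled_law ::
  "'x measure measure \<Rightarrow> ('x measure \<Rightarrow> ('x::topological_space) cseq) \<Rightarrow> 'x cseq measure" where
  "labelled_law \<mu> l = completion (distr (completion \<mu>) cseq_borel l)"


section \<open>Cylinder functions and the form on the configuration space\<close>

definition cyl_rep :: "'x local_space \<Rightarrow> ('x measure \<Rightarrow> real) \<Rightarrow>
    nat \<times> ((nat \<Rightarrow> real) \<Rightarrow> real) \<times> (nat \<Rightarrow> 'x \<Rightarrow> real) \<Rightarrow> bool" where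
  "cyl_rep X u = (\<lambda>(k, F, f). F \<in> Cb_smooth k \<and> (\<forall>i<k. f i \<in> core X) \<and>
     (\<forall>\<gamma>\<in>conf X. u \<gamma> = F (\<lambda>i. \<integral>x. f i x \<partial>\<gamma>)))"

definition cyl :: "'x local_space \<Rightarrow> ('x measure \<Rightarrow> real) set" where
  "cyl X = {u. \<exists>r. cyl_rep X u r}"

text \<open>
  The value does not depend on the representations chosen by \<open>SOME\<close> at those \<open>\<gamma>\<close> for which the
  integrals exist, hence almost everywhere under marginal absolute continuity (the lifting may
  move the support of \<open>sqf X (f i) (g j)\<close> by a null set out of the localizing ring).
\<close>

definition conf_sqf :: "'x local_space \<Rightarrow> ('x measure \<Rightarrow> real) \<Rightarrow> ('x measure \<Rightarrow> real) \<Rightarrow>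
    'x measure \<Rightarrow> real" where
  "conf_sqf X u v \<gamma> =
     (case SOME r. cyl_rep X u r of (k, F, f) \<Rightarrow>
      case SOME r. cyl_rep X v r of (m, G, g) \<Rightarrow>
        (\<Sum>i<k. \<Sum>j<m. partial_deriv i F (\<lambda>i. \<integral>x. f i x \<partial>\<gamma>) * partial_deriv j G (\<lambda>j. \<integral>x. g j x \<partial>\<gamma>) *
           (\<integral>x. lift X (sqf X (f i) (g j)) x \<partial>\<gamma>)))"

definition conf_pre_form :: "'x local_space \<Rightarrow> 'x measure measure \<Rightarrow> 'x measure form" where
  "conf_pre_form X \<mu> u v = (\<integral>\<gamma>. conf_sqf X u v \<gamma> \<partial>\<mu>)"

definition closability_assumption :: "'x local_space \<Rightarrow> 'x measure measure \<Rightarrow> bool" where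
  "closability_assumption X \<mu> \<longleftrightarrow>
     (\<forall>E\<in>lring X. (\<integral>\<^sup>+\<gamma>. emeasure \<gamma> E \<partial>\<mu>) < \<infinity>) \<and> closable \<mu> (conf_pre_form X \<mu>) (cyl X)"

definition conf_dom :: "'x local_space \<Rightarrow> 'x measure measure \<Rightarrow> ('x measure \<Rightarrow> real) set" where
  "conf_dom X \<mu> = closure_dom \<mu> (conf_pre_form X \<mu>) (cyl X)"


section \<open>Pre-Sobolev functions of labelled points\<close>

definition coord_section :: "('x cseq \<Rightarrow> real) \<Rightarrow> 'x cseq \<Rightarrow> nat \<Rightarrow> 'x \<Rightarrow> real" where
  "coord_section U \<xi> p z = U (fst \<xi>, (snd \<xi>)(p := z))"

definition seq_sqf_term :: "'x local_space \<Rightarrow> ('x cseq \<Rightarrow> real) \<Rightarrow> 'x cseq \<Rightarrow> nat \<Rightarrow> real" where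
  "seq_sqf_term X U \<xi> p = lift X (sqfX X (coord_section U \<xi> p)) (snd \<xi> p)"

definition seq_sqf :: "'x local_space \<Rightarrow> enat \<Rightarrow> ('x cseq \<Rightarrow> real) \<Rightarrow> 'x cseq \<Rightarrow> real" where
  "seq_sqf X N U \<xi> = (\<Sum>p. if enat p < N then seq_sqf_term X U \<xi> p else 0)"

definition seq_sqf_exists :: "'x local_space \<Rightarrow> ('x cseq \<Rightarrow> real) \<Rightarrow> 'x cseq \<Rightarrow> bool" where
  "seq_sqf_exists X U \<xi> \<longleftrightarrow> \<xi> \<in> X_lcf_inf X \<and>
     (\<forall>p. coord_section U \<xi> p \<in> sqf_dom X \<and> sqfX X (coord_section U \<xi> p) \<in> Linf_fun (meas X)) \<and>
     summable (seq_sqf_term X U \<xi>)"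

definition seq_sqf_bilinear :: "'x local_space \<Rightarrow> enat \<Rightarrow> ('x cseq \<Rightarrow> real) \<Rightarrow> ('x cseq \<Rightarrow> real) \<Rightarrow>
    'x cseq \<Rightarrow> real" where
  "seq_sqf_bilinear X N U V \<xi> =
     (seq_sqf X N (\<lambda>\<zeta>. U \<zeta> + V \<zeta>) \<xi> - seq_sqf X N (\<lambda>\<zeta>. U \<zeta> - V \<zeta>) \<xi>) / 4"

definition pre_sobolev ::
  "('x::topological_space) local_space \<Rightarrow> 'x measure measure \<Rightarrow> ('x cseq \<Rightarrow> real) set" where
  "pre_sobolev X \<mu> = {U. bounded (U ` X_lcf_inf X) \<and>
     (\<forall>l. labeling X \<mu> l \<longrightarrow> U \<in> borel_measurable (labelled_law \<mu> l)) \<and>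
     (\<exists>M. \<forall>l. labeling X \<mu> l \<longrightarrow>
        (AE \<xi> in labelled_law \<mu> l. seq_sqf_exists X U \<xi>) \<and>
        (\<lambda>\<xi>. \<bar>U \<xi>\<bar> + sqrt (seq_sqf X \<infinity> U \<xi>)) \<in> L2_fun (labelled_law \<mu> l) \<and>
        L2_norm (labelled_law \<mu> l) (\<lambda>\<xi>. \<bar>U \<xi>\<bar> + sqrt (seq_sqf X \<infinity> U \<xi>)) \<le> M)}"

definition seq_form :: "('x::topological_space) local_space \<Rightarrow> 'x measure measure \<Rightarrow>
    ('x measure \<Rightarrow> 'x cseq) \<Rightarrow> enat \<Rightarrow> 'x cseq form" where
  "seq_form X \<mu> l N U V = (\<integral>\<xi>. seq_sqf_bilinear X N U V \<xi> \<partial>labelled_law \<mu> l)"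

definition seq_form1 :: "('x::topological_space) local_space \<Rightarrow> 'x measure measure \<Rightarrow>
    ('x measure \<Rightarrow> 'x cseq) \<Rightarrow> enat \<Rightarrow> 'x cseq form" where
  "seq_form1 X \<mu> l N U V = seq_form X \<mu> l N U V + (\<integral>\<xi>. U \<xi> * V \<xi> \<partial>labelled_law \<mu> l)"


section \<open>Hilbert spaces\<close>

text \<open>
  Hilbert spaces are closed subspaces of an ambient complete inner product space. When \<open>S\<close> is a
  linear space of functions and \<open>B\<close> a semi-inner product on it, the following says that \<open>H\<close>
  together with \<open>\<iota>\<close> is the abstract Hilbert completion of \<open>S\<close>: preservation of inner products makes
  \<open>\<iota>\<close> linear with kernel \<open>{U. B U U = 0}\<close>, so that \<open>\<iota>\<close> factors through the space of classes if
  \<open>B\<close> is well defined and definite there, and \<open>span\<close> is redundant.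
\<close>

definition hilbert_completion :: "'a set \<Rightarrow> ('a \<Rightarrow> 'a \<Rightarrow> real) \<Rightarrow>
    ('a \<Rightarrow> 'k::{real_inner, complete_space}) \<Rightarrow> 'k set \<Rightarrow> bool" where
  "hilbert_completion S B \<iota> H \<longleftrightarrow>
     (\<forall>U\<in>S. \<forall>V\<in>S. \<iota> U \<bullet> \<iota> V = B U V) \<and> H = closure (span (\<iota> ` S))"

text \<open>The isometric extension of \<open>u \<mapsto> \<iota> (u \<circ> lab X)\<close> from cylinder functions to \<open>conf_dom X \<mu>\<close>,
  where \<open>\<iota>\<close> is the embedding of the pre-Sobolev functions into their completion.\<close>

definition lab_star :: "'x local_space \<Rightarrow> 'x measure measure \<Rightarrow> (('x cseq \<Rightarrow> real) \<Rightarrow> 'k) \<Rightarrow>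
    ('x measure \<Rightarrow> real) \<Rightarrow> 'k::{real_inner, complete_space}" where
  "lab_star X \<mu> \<iota> u = (THE k. \<exists>v. form_approx \<mu> (conf_pre_form X \<mu>) (cyl X) v u \<and>
     (\<lambda>n. \<iota> (v n \<circ> lab X)) \<longlonglongrightarrow> k)"

text \<open>
  The function \<open>(u \<circ> lab X) \<circ> tr n\<close> depends on the cylinder function \<open>u\<close> and in general not only
  on its \<open>\<mu>\<close>-class, as truncated configurations need not be charged by \<open>\<mu>\<close>. To have linear maps on
  the space of \<open>\<mu>\<close>-classes of cylinder functions, representatives are chosen linearly.
\<close>

definition cyl_choice :: "'x local_space \<Rightarrow> 'x measure measure \<Rightarrow>
    (('x measure \<Rightarrow> real) \<Rightarrow> 'x measure \<Rightarrow> real) \<Rightarrow> bool" where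
  "cyl_choice X \<mu> r \<longleftrightarrow>
     (\<forall>u\<in>cyl X. r u \<in> cyl X \<and> (AE \<gamma> in \<mu>. r u \<gamma> = u \<gamma>)) \<and>
     (\<forall>u\<in>cyl X. \<forall>v\<in>cyl X. (AE \<gamma> in \<mu>. u \<gamma> = v \<gamma>) \<longrightarrow> r u = r v) \<and>
     (\<forall>u\<in>cyl X. \<forall>v\<in>cyl X. \<forall>a b. r (\<lambda>\<gamma>. a * u \<gamma> + b * v \<gamma>) = (\<lambda>\<gamma>. a * r u \<gamma> + b * r v \<gamma>))"

definition trunc_map :: "'x local_space \<Rightarrow> (('x measure \<Rightarrow> real) \<Rightarrow> 'x measure \<Rightarrow> real) \<Rightarrow>
    (enat \<Rightarrow> ('x cseq \<Rightarrow> real) \<Rightarrow> 'k) \<Rightarrow> nat \<Rightarrow> ('x measure \<Rightarrow> real) \<Rightarrow> 'k" where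
  "trunc_map X r \<iota> n u = \<iota> (enat n) ((r u \<circ> lab X) \<circ> tr n)"

definition kuwae_shioya :: "'i filter \<Rightarrow> ('i \<Rightarrow> 'k::{real_inner, complete_space} set) \<Rightarrow>
    'h::{real_inner, complete_space} set \<Rightarrow> ('i \<Rightarrow> 'h \<Rightarrow> 'k) \<Rightarrow> 'h set \<Rightarrow> bool" where
  "kuwae_shioya \<F> Hs H \<Phi> C \<longleftrightarrow>
     (\<forall>\<alpha>. subspace (Hs \<alpha>) \<and> closed (Hs \<alpha>)) \<and> subspace H \<and> closed H \<and>
     subspace C \<and> C \<subseteq> H \<and> H \<subseteq> closure C \<and>
     (\<forall>\<alpha>. \<Phi> \<alpha> ` C \<subseteq> Hs \<alpha> \<and>
        (\<forall>u\<in>C. \<forall>v\<in>C. \<forall>a b. \<Phi> \<alpha> (a *\<^sub>R u + b *\<^sub>R v) = a *\<^sub>R \<Phi> \<alpha> u + b *\<^sub>R \<Phi> \<alpha> v)) \<and>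
     (\<forall>u\<in>C. Limsup \<F> (\<lambda>\<alpha>. ereal (norm (\<Phi> \<alpha> u))) = ereal (norm u))"

end

theory Submission
  imports Defs
begin

text \<open>
  For a cylinder function \<open>u = F(f\<^sub>1\<^sup>\<star>, \<dots>, f\<^sub>k\<^sup>\<star>)\<close> and a locally finite sequence \<open>x\<close>, fixing all points but
  one and applying the chain rule expresses the energy density of the truncated function
  \<open>(u \<circ> lab X) \<circ> tr n\<close> at \<open>x\<close> as
  \<open>\<Sum>\<^sub>i\<^sub>j \<partial>\<^sub>iF(S\<^sub>n) \<partial>\<^sub>jF(S\<^sub>n) \<Sum>\<^sub>p\<^sub><\<^sub>n \<ell>(\<Gamma>(f\<^sub>i, f\<^sub>j))(x\<^sub>p)\<close>, where \<open>S\<^sub>n = (\<Sum>\<^sub>p\<^sub><\<^sub>n f\<^sub>i(x\<^sub>p))\<^sub>i\<close>. Up to null sets of the base space,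
  which no labelled point meets by marginal absolute continuity, all functions of \<open>x\<^sub>p\<close> here are
  supported in a set \<open>E\<close> of the localizing ring. Hence the sums over \<open>p < n\<close> are eventually constant in \<open>n\<close>,
  the densities are bounded by a multiple of the number of points in \<open>E\<close>, which is integrable since
  the intensity of \<open>\<mu>\<close> is finite, and dominated convergence gives convergence of the squared norms of
  \<open>(u \<circ> lab X) \<circ> tr n\<close> in \<open>K n\<close> to that of \<open>u \<circ> lab X\<close> in \<open>K \<infinity>\<close> (\<open>seq_form1_tendsto\<close>). The same formula
  with \<open>n = \<infinity>\<close> is the energy density on the configuration space, so \<open>u \<mapsto> u \<circ> lab X\<close> is isometric
  (\<open>conf_pre_form_eq\<close>).

  The energy density in the definition of pre-Sobolev functions is that of the closure of the base
  form, for functions determined up to a constant. Sections of cylinder functions differ from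
  elements of the core by constants, and one has to know that on such functions the density is given
  by \<open>\<Gamma>\<close> on the core. This is strong locality: a sequence in the core which converges to a constant in
  \<open>L\<^sup>2\<close> and is Cauchy for the form has energy tending to \<open>0\<close> (\<open>energy_tendsto_0_of_const_limit\<close>). The
  lifting, being linear, multiplicative and the identity on continuous functions, then turns the
  chain rule into an identity at every point (\<open>density_chain\<close>), and makes the form on truncated
  cylinder functions bilinear, so that the embeddings into \<open>K n\<close> are linear on them.

  Closability of the form on the configuration space makes the extension of the isometry to the
  domain of the closure well defined, and completeness of \<open>L\<^sup>2(\<mu>)\<close> shows that its image is the closure
  of the image of the cylinder functions (\<open>lab_star_conf_dom\<close>). The isometry is injective on
  \<open>\<mu>\<close>-classes, so the chosen representatives of classes of cylinder functions give linear maps on its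
  image.
\<close>

section \<open>Smooth functions of finitely many variables\<close>

text \<open>\<open>F\<close> is a function of the coordinates \<open>0, \<dots>, k - 1\<close>.\<close>

definition depends_on :: "nat \<Rightarrow> ((nat \<Rightarrow> real) \<Rightarrow> real) \<Rightarrow> bool" where
  "depends_on k F \<longleftrightarrow> (\<forall>y z. (\<forall>i<k. y i = z i) \<longrightarrow> F y = F z)"

lemma depends_onD: "depends_on k F \<Longrightarrow> (\<And>i. i < k \<Longrightarrow> y i = z i) \<Longrightarrow> F y = F z"
  unfolding depends_on_def by blast

lemma partial_deriv_zero [simp]: "partial_deriv i (\<lambda>y. 0) = (\<lambda>y. 0)"
  by (simp add: partial_deriv_def fun_eq_iff)

lemma foldr_partial_deriv_zero [simp]: "foldr partial_deriv is (\<lambda>y. 0) = (\<lambda>y. 0)"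
  by (induction "is") auto

lemma partial_deriv_beyond:
  assumes "depends_on k F" "k \<le> i"
  shows "partial_deriv i F = (\<lambda>y. 0)"
proof
  fix y
  have "(\<lambda>t. F (y(i := t))) = (\<lambda>t. F y)"
    using assms by (auto intro!: depends_onD[of k F])
  then show "partial_deriv i F y = 0"
    by (simp add: partial_deriv_def)
qed

lemma depends_on_partial_deriv:
  assumes "depends_on k F"
  shows "depends_on k (partial_deriv i F)"
proof (cases "i < k")
  case True
  show ?thesis
    unfolding depends_on_def
  proof (intro allI impI)
    fix y z :: "nat \<Rightarrow> real"
    assume yz: "\<forall>i<k. y i = z i"
    have "(\<lambda>t. F (y(i := t))) = (\<lambda>t. F (z(i := t)))"
      using yz by (auto intro!: depends_onD[OF assms])
    then show "partial_deriv i F y = partial_deriv i F z"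
      using yz True by (simp add: partial_deriv_def)
  qed
next
  case False
  then show ?thesis
    using partial_deriv_beyond[OF assms] by (simp add: depends_on_def)
qed

lemma depends_on_foldr_partial_deriv:
  "depends_on k F \<Longrightarrow> depends_on k (foldr partial_deriv is F)"
  by (induction "is") (auto intro: depends_on_partial_deriv)

lemma Cb_smoothD:
  assumes "F \<in> Cb_smooth k"
  shows "depends_on k F"
    and "set is \<subseteq> {..<k} \<Longrightarrow> continuous_on UNIV (foldr partial_deriv is F)"
    and "set is \<subseteq> {..<k} \<Longrightarrow> bounded (range (foldr partial_deriv is F))"
    and "set is \<subseteq> {..<k} \<Longrightarrow> i < k \<Longrightarrow>
      (\<lambda>t. foldr partial_deriv is F (y(i := t))) differentiable (at (y i))"
  using assms unfolding Cb_smooth_def depends_on_def by blast+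

lemma Cb_smoothI:
  assumes "depends_on k F"
    and "\<And>is. set is \<subseteq> {..<k} \<Longrightarrow> continuous_on UNIV (foldr partial_deriv is F)"
    and "\<And>is. set is \<subseteq> {..<k} \<Longrightarrow> bounded (range (foldr partial_deriv is F))"
    and "\<And>is i y. set is \<subseteq> {..<k} \<Longrightarrow> i < k \<Longrightarrow>
      (\<lambda>t. foldr partial_deriv is F (y(i := t))) differentiable (at (y i))"
  shows "F \<in> Cb_smooth k"
  using assms unfolding Cb_smooth_def depends_on_def by blast

lemma Cb_smooth_bounded:
  assumes "F \<in> Cb_smooth k"
  obtains C where "0 \<le> C" "\<And>y. \<bar>F y\<bar> \<le> C" "\<And>i y. i < k \<Longrightarrow> \<bar>partial_deriv i F y\<bar> \<le> C"
proof -
  obtain C0 where C0: "\<bar>F y\<bar> \<le> C0" for y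
    using Cb_smoothD(3)[OF assms, of "[]"] by (auto simp: bounded_iff)
  have "\<exists>C. \<forall>y. \<bar>partial_deriv i F y\<bar> \<le> C" if "i < k" for i
    using Cb_smoothD(3)[OF assms, of "[i]"] that by (auto simp: bounded_iff)
  then obtain C where C: "\<bar>partial_deriv i F y\<bar> \<le> C i" if "i < k" for i y
    by metis
  define D where "D = \<bar>C0\<bar> + (\<Sum>i<k. \<bar>C i\<bar>)"
  show thesis
  proof
    show "0 \<le> D" by (auto simp: D_def intro!: add_nonneg_nonneg sum_nonneg)
    have "0 \<le> (\<Sum>i<k. \<bar>C i\<bar>)" by (simp add: sum_nonneg)
    then show "\<bar>F y\<bar> \<le> D" for y using C0[of y] unfolding D_def by (smt (verit, best))
    show "\<bar>partial_deriv i F y\<bar> \<le> D" if "i < k" for i y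
    proof -
      have "\<bar>C i\<bar> \<le> (\<Sum>i<k. \<bar>C i\<bar>)" using that by (intro member_le_sum) auto
      with C[OF that, of y] show ?thesis unfolding D_def by linarith
    qed
  qed
qed

lemma Cb_smooth_continuous:
  assumes "F \<in> Cb_smooth k"
  shows "continuous_on UNIV F" "i < k \<Longrightarrow> continuous_on UNIV (partial_deriv i F)"
  using Cb_smoothD(2)[OF assms, of "[]"] Cb_smoothD(2)[OF assms, of "[i]"] by auto

lemma foldr_partial_deriv_lincomb:
  assumes F: "F \<in> Cb_smooth k" and G: "G \<in> Cb_smooth k" and "set is \<subseteq> {..<k}"
  shows "foldr partial_deriv is (\<lambda>y. a * F y + b * G y) =
    (\<lambda>y. a * foldr partial_deriv is F y + b * foldr partial_deriv is G y)"
  using assms(3)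
proof (induction "is")
  case (Cons i "is")
  then have i: "i < k" "set is \<subseteq> {..<k}" by auto
  show ?case
  proof
    fix y
    let ?f = "\<lambda>t. foldr partial_deriv is F (y(i := t))"
    let ?g = "\<lambda>t. foldr partial_deriv is G (y(i := t))"
    have "(?f has_field_derivative deriv ?f (y i)) (at (y i))"
      "(?g has_field_derivative deriv ?g (y i)) (at (y i))"
      using Cb_smoothD(4)[OF F i(2,1), of y] Cb_smoothD(4)[OF G i(2,1), of y]
      by (auto simp: DERIV_deriv_iff_real_differentiable)
    then have "((\<lambda>t. a * ?f t + b * ?g t) has_field_derivative
        (a * deriv ?f (y i) + b * deriv ?g (y i))) (at (y i))"
      by (auto intro!: derivative_eq_intros)
    then show "foldr partial_deriv (i # is) (\<lambda>y. a * F y + b * G y) y =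
        a * foldr partial_deriv (i # is) F y + b * foldr partial_deriv (i # is) G y"
      by (simp add: Cons.IH[OF i(2)] partial_deriv_def[of i] DERIV_imp_deriv)
  qed
qed simp

lemma Cb_smooth_lincomb:
  assumes F: "F \<in> Cb_smooth k" and G: "G \<in> Cb_smooth k"
  shows "(\<lambda>y. a * F y + b * G y) \<in> Cb_smooth k"
proof (rule Cb_smoothI)
  show "depends_on k (\<lambda>y. a * F y + b * G y)"
    unfolding depends_on_def
    using depends_onD[OF Cb_smoothD(1)[OF F]] depends_onD[OF Cb_smoothD(1)[OF G]] by metis
  fix "is" assume s: "set is \<subseteq> {..<k}"
  note eq = foldr_partial_deriv_lincomb[OF F G s, of a b]
  show "continuous_on UNIV (foldr partial_deriv is (\<lambda>y. a * F y + b * G y))"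
    unfolding eq by (intro continuous_intros Cb_smoothD(2)[OF F s] Cb_smoothD(2)[OF G s])
  obtain A B where A: "\<And>y. \<bar>foldr partial_deriv is F y\<bar> \<le> A"
    and B: "\<And>y. \<bar>foldr partial_deriv is G y\<bar> \<le> B"
    using Cb_smoothD(3)[OF F s] Cb_smoothD(3)[OF G s] by (auto simp: bounded_iff)
  have "\<bar>a * foldr partial_deriv is F y + b * foldr partial_deriv is G y\<bar> \<le> \<bar>a\<bar> * A + \<bar>b\<bar> * B" for y
    by (rule order_trans[OF abs_triangle_ineq])
      (auto simp: abs_mult intro!: add_mono mult_left_mono A B)
  then show "bounded (range (foldr partial_deriv is (\<lambda>y. a * F y + b * G y)))"
    unfolding eq bounded_iff by auto
  show "(\<lambda>t. foldr partial_deriv is (\<lambda>y. a * F y + b * G y) (y(i := t))) differentiable (at (y i))"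
    if "i < k" for i y
    unfolding eq
    by (intro derivative_intros Cb_smoothD(4)[OF F s that] Cb_smoothD(4)[OF G s that])
qed

text \<open>
  Translations occur when all points of a configuration but one are fixed: the fixed points
  add a constant to each argument of a cylinder function.
\<close>

lemma deriv_shift_real: "deriv (\<lambda>t. f (a + t)) x = deriv f (a + x :: real)"
  unfolding deriv_def by (simp add: DERIV_shift add.commute[of a])

lemma foldr_partial_deriv_translate:
  "foldr partial_deriv is (\<lambda>y. F (\<lambda>i. c i + y i)) = (\<lambda>y. foldr partial_deriv is F (\<lambda>i. c i + y i))"
proof (induction "is")
  case (Cons i "is")
  have "partial_deriv i (\<lambda>y. G (\<lambda>i. c i + y i)) y = partial_deriv i G (\<lambda>i. c i + y i)" for G y
  proof -
    have "(\<lambda>j. c j + (y(i := t)) j) = (\<lambda>j. c j + y j)(i := c i + t)" for t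
      by auto
    then show ?thesis
      using deriv_shift_real[of "\<lambda>t. G ((\<lambda>j. c j + y j)(i := t))" "c i" "y i"]
      by (simp add: partial_deriv_def)
  qed
  then show ?case
    using Cons by simp
qed simp

lemma partial_deriv_translate:
  "partial_deriv i (\<lambda>y. F (\<lambda>i. c i + y i)) y = partial_deriv i F (\<lambda>i. c i + y i)"
  using foldr_partial_deriv_translate[of "[i]" F c] by (simp add: fun_eq_iff)

lemma Cb_smooth_translate:
  assumes F: "F \<in> Cb_smooth k"
  shows "(\<lambda>y. F (\<lambda>i. c i + y i)) \<in> Cb_smooth k"
proof (rule Cb_smoothI)
  show "depends_on k (\<lambda>y. F (\<lambda>i. c i + y i))"
    using Cb_smoothD(1)[OF F] by (auto simp: depends_on_def)
  fix "is" assume s: "set is \<subseteq> {..<k}"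
  let ?G = "foldr partial_deriv is F"
  have cont: "continuous_on UNIV (\<lambda>y::nat \<Rightarrow> real. (\<lambda>i. c i + y i))"
    by (intro continuous_on_coordinatewise_then_product continuous_intros
        continuous_on_product_coordinates)
  show "continuous_on UNIV (foldr partial_deriv is (\<lambda>y. F (\<lambda>i. c i + y i)))"
    unfolding foldr_partial_deriv_translate
    by (rule continuous_on_compose2[OF Cb_smoothD(2)[OF F s] cont]) auto
  show "bounded (range (foldr partial_deriv is (\<lambda>y. F (\<lambda>i. c i + y i))))"
    unfolding foldr_partial_deriv_translate
    by (rule bounded_subset[OF Cb_smoothD(3)[OF F s]]) auto
  show "(\<lambda>t. foldr partial_deriv is (\<lambda>y. F (\<lambda>i. c i + y i)) (y(i := t))) differentiable (at (y i))"
    if i: "i < k" for i y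
  proof -
    let ?z = "\<lambda>j. c j + y j"
    have eq: "(\<lambda>j. c j + (y(i := t)) j) = ?z(i := c i + t)" for t
      by auto
    have "(\<lambda>t. ?G (?z(i := t))) differentiable (at (c i + y i))"
      using Cb_smoothD(4)[OF F s i, of ?z] by simp
    then obtain D where "((\<lambda>t. ?G (?z(i := t))) has_field_derivative D) (at (y i + c i))"
      by (auto simp: real_differentiable_def add.commute)
    then have "(\<lambda>t. ?G (?z(i := c i + t))) differentiable (at (y i))"
      unfolding real_differentiable_def DERIV_shift by (auto simp: add.commute)
    then show ?thesis
      unfolding foldr_partial_deriv_translate eq .
  qed
qed

text \<open>
  Raising the dimension and shifting the coordinates allow two cylinder functions to be written
  over one common tuple of functions on the base space.
\<close>

lemma foldr_partial_deriv_beyond: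
  assumes "depends_on k F" "\<not> set is \<subseteq> {..<k}"
  shows "foldr partial_deriv is F = (\<lambda>y. 0)"
  using assms(2)
proof (induction "is")
  case (Cons i "is")
  show ?case
  proof (cases "set is \<subseteq> {..<k}")
    case True
    with Cons have "k \<le> i" by auto
    then show ?thesis
      using partial_deriv_beyond[OF depends_on_foldr_partial_deriv[OF assms(1)]] by simp
  qed (use Cons in simp)
qed simp

lemma Cb_smooth_mono:
  assumes F: "F \<in> Cb_smooth k" and "k \<le> m"
  shows "F \<in> Cb_smooth m"
proof (rule Cb_smoothI)
  note dep = Cb_smoothD(1)[OF F]
  show "depends_on m F"
    using dep \<open>k \<le> m\<close> unfolding depends_on_def by (meson less_le_trans)
  fix "is"
  show "continuous_on UNIV (foldr partial_deriv is F)"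
    by (cases "set is \<subseteq> {..<k}")
      (use Cb_smoothD(2)[OF F] foldr_partial_deriv_beyond[OF dep] in auto)
  show "bounded (range (foldr partial_deriv is F))"
    by (cases "set is \<subseteq> {..<k}")
      (use Cb_smoothD(3)[OF F] foldr_partial_deriv_beyond[OF dep] in auto)
  show "(\<lambda>t. foldr partial_deriv is F (y(i := t))) differentiable (at (y i))" for i y
  proof (cases "set is \<subseteq> {..<k} \<and> i < k")
    case True
    then show ?thesis using Cb_smoothD(4)[OF F] by blast
  next
    case False
    have "(\<lambda>t. foldr partial_deriv is F (y(i := t))) = (\<lambda>t. foldr partial_deriv is F y)"
    proof (cases "set is \<subseteq> {..<k}")
      case True
      with False show ?thesis
        by (auto intro!: depends_onD[OF depends_on_foldr_partial_deriv[OF dep]])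
    qed (use foldr_partial_deriv_beyond[OF dep] in simp)
    then show ?thesis by simp
  qed
qed

lemma foldr_partial_deriv_shift:
  "foldr partial_deriv is (\<lambda>y. F (\<lambda>j. y (k + j))) =
    (if \<forall>i\<in>set is. k \<le> i
     then (\<lambda>y. foldr partial_deriv (map (\<lambda>i. i - k) is) F (\<lambda>j. y (k + j))) else (\<lambda>y. 0))"
proof (induction "is")
  case (Cons i "is")
  have "partial_deriv i (\<lambda>y. G (\<lambda>j. y (k + j))) y =
      (if k \<le> i then partial_deriv (i - k) G (\<lambda>j. y (k + j)) else 0)" for G y
  proof (cases "k \<le> i")
    case True
    then have "(\<lambda>j. (y(i := t)) (k + j)) = (\<lambda>j. y (k + j))(i - k := t)" for t
      by (auto simp: fun_eq_iff)
    then show ?thesis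
      using True by (simp add: partial_deriv_def)
  next
    case False
    then have "(\<lambda>j. (y(i := t)) (k + j)) = (\<lambda>j. y (k + j))" for t
      by auto
    then show ?thesis
      using False by (simp add: partial_deriv_def)
  qed
  then have "partial_deriv i (\<lambda>y. G (\<lambda>j. y (k + j))) =
      (if k \<le> i then (\<lambda>y. partial_deriv (i - k) G (\<lambda>j. y (k + j))) else (\<lambda>y. 0))" for G
    by (auto simp: fun_eq_iff)
  then show ?case
    by (auto simp: Cons.IH)
qed simp

lemma Cb_smooth_shift:
  assumes F: "F \<in> Cb_smooth m"
  shows "(\<lambda>y. F (\<lambda>j. y (k + j))) \<in> Cb_smooth (k + m)"
proof (rule Cb_smoothI)
  show "depends_on (k + m) (\<lambda>y. F (\<lambda>j. y (k + j)))"
    using Cb_smoothD(1)[OF F] by (auto simp: depends_on_def)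
  fix "is" assume s: "set is \<subseteq> {..<k + m}"
  let ?js = "map (\<lambda>i. i - k) is"
  have cont: "continuous_on UNIV (\<lambda>y::nat \<Rightarrow> real. (\<lambda>j. y (k + j)))"
    by (intro continuous_on_coordinatewise_then_product continuous_on_product_coordinates)
  have js: "set ?js \<subseteq> {..<m}" if "\<forall>i\<in>set is. k \<le> i"
    using s that by fastforce
  show "continuous_on UNIV (foldr partial_deriv is (\<lambda>y. F (\<lambda>j. y (k + j))))"
    unfolding foldr_partial_deriv_shift
    using continuous_on_compose2[OF Cb_smoothD(2)[OF F js] cont] by auto
  show "bounded (range (foldr partial_deriv is (\<lambda>y. F (\<lambda>j. y (k + j)))))"
  proof (cases "\<forall>i\<in>set is. k \<le> i")
    case True
    then show ?thesis
      unfolding foldr_partial_deriv_shift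
      by (auto intro!: bounded_subset[OF Cb_smoothD(3)[OF F js[OF True]]])
  next
    case False
    then have "foldr partial_deriv is (\<lambda>y. F (\<lambda>j. y (k + j))) = (\<lambda>y. 0)"
      unfolding foldr_partial_deriv_shift by auto
    then show ?thesis by auto
  qed
  show "(\<lambda>t. foldr partial_deriv is (\<lambda>y. F (\<lambda>j. y (k + j))) (y(i := t))) differentiable (at (y i))"
    if i: "i < k + m" for i y
  proof (cases "(\<forall>i\<in>set is. k \<le> i) \<and> k \<le> i")
    case True
    then have "(\<lambda>j. (y(i := t)) (k + j)) = (\<lambda>j. y (k + j))(i - k := t)" for t
      by (auto simp: fun_eq_iff)
    then show ?thesis
      using Cb_smoothD(4)[OF F js, of "i - k" "\<lambda>j. y (k + j)"] True i
      unfolding foldr_partial_deriv_shift by (simp add: less_diff_conv2 add.commute)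
  next
    case False
    have "(\<lambda>t. foldr partial_deriv is (\<lambda>y. F (\<lambda>j. y (k + j))) (y(i := t))) =
        (\<lambda>t. foldr partial_deriv is (\<lambda>y. F (\<lambda>j. y (k + j))) y)"
    proof (cases "\<forall>i\<in>set is. k \<le> i")
      case True
      with False have "(\<lambda>j. (y(i := t)) (k + j)) = (\<lambda>j. y (k + j))" for t
        by auto
      then show ?thesis unfolding foldr_partial_deriv_shift by simp
    qed (auto simp: foldr_partial_deriv_shift)
    then show ?thesis by simp
  qed
qed

text \<open>The sine provides a bounded smooth function of one variable with value \<open>c\<close> and vanishing
  derivative at a prescribed point \<open>c \<noteq> 0\<close>.\<close>

lemma partial_deriv_sin_cos:
  "partial_deriv 0 (\<lambda>y. A * sin (b * y 0) + B * cos (b * y 0)) =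
    (\<lambda>y. (- (B * b)) * sin (b * y 0) + (A * b) * cos (b * y 0))"
  unfolding partial_deriv_def
  by (intro ext DERIV_imp_deriv) (auto intro!: derivative_eq_intros)

lemma foldr_partial_deriv_sin_cos:
  assumes "set is \<subseteq> {0}"
  shows "\<exists>A' B'. foldr partial_deriv is (\<lambda>y. A * sin (b * y 0) + B * cos (b * y 0)) =
    (\<lambda>y. A' * sin (b * y 0) + B' * cos (b * y 0))"
  using assms
proof (induction "is")
  case (Cons i "is")
  then obtain A' B' where "foldr partial_deriv is (\<lambda>y. A * sin (b * y 0) + B * cos (b * y 0)) =
    (\<lambda>y. A' * sin (b * y 0) + B' * cos (b * y 0))" and "i = 0"
    by auto
  then show ?case
    using partial_deriv_sin_cos[of A' b B'] by (intro exI[of _ "- (B' * b)"] exI[of _ "A' * b"]) simp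
qed auto

lemma Cb_smooth_sin: "(\<lambda>y. a * sin (b * y 0)) \<in> Cb_smooth 1"
proof (rule Cb_smoothI)
  fix "is" :: "nat list" assume "set is \<subseteq> {..<1}"
  then have "set is \<subseteq> {0}" by auto
  from foldr_partial_deriv_sin_cos[OF this, of a b 0]
  obtain A B where eq: "foldr partial_deriv is (\<lambda>y. a * sin (b * y 0)) =
      (\<lambda>y. A * sin (b * y 0) + B * cos (b * y 0))"
    by auto
  have c: "continuous_on UNIV (\<lambda>y::nat \<Rightarrow> real. y 0)"
    by (rule continuous_on_product_coordinates)
  show "continuous_on UNIV (foldr partial_deriv is (\<lambda>y. a * sin (b * y 0)))"
    unfolding eq by (intro continuous_intros c)
  have "\<bar>A * sin (b * y 0) + B * cos (b * y 0)\<bar> \<le> \<bar>A\<bar> * 1 + \<bar>B\<bar> * 1" for y :: "nat \<Rightarrow> real"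
    by (rule order_trans[OF abs_triangle_ineq], unfold abs_mult, intro add_mono mult_left_mono)
      auto
  then show "bounded (range (foldr partial_deriv is (\<lambda>y. a * sin (b * y 0))))"
    unfolding eq bounded_iff by auto
  show "(\<lambda>t. foldr partial_deriv is (\<lambda>y. a * sin (b * y 0)) (y(i := t))) differentiable (at (y i))"
    if "i < 1" for i y
    using that unfolding eq real_differentiable_def by (auto intro!: derivative_eq_intros exI)
qed (auto simp: depends_on_def)

lemma partial_deriv_sin: "partial_deriv 0 (\<lambda>y. a * sin (b * y 0)) y = a * b * cos (b * y 0)"
  using partial_deriv_sin_cos[of a b 0] by (simp add: fun_eq_iff)

section \<open>The square field operator\<close>

text \<open>A topological local diffusion space with a strong lifting.\<close>

locale diffusion_space =
  fixes X :: "('x::t2_space) local_space"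
  assumes diffusion: "topological_local_diffusion_space X"
    and lifting: "strong_lifting X"
begin

lemma local_structure: "topological_local_structure X"
  and square_field: "square_field_operator X"
  using diffusion by (simp_all add: topological_local_diffusion_space_def)

lemma space_meas [simp]: "space (meas X) = UNIV"
  and borel_subset_meas: "sets borel \<subseteq> sets (meas X)"
  and ring: "localizing_ring (meas X) (lring X)"
  using local_structure by (auto simp: topological_local_structure_def)

lemma continuous_measurable_meas:
  fixes f :: "'x \<Rightarrow> real"
  assumes "continuous_on UNIV f"
  shows "f \<in> borel_measurable (meas X)"
proof (rule measurableI)
  fix A :: "real set" assume "A \<in> sets borel"
  then have "f -` A \<inter> space borel \<in> sets borel"
    using assms by (intro measurable_sets[OF borel_measurable_continuous_onI])
  then show "f -` A \<inter> space (meas X) \<in> sets (meas X)"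
    using borel_subset_meas by auto
qed simp

lemma lring_sets: "E \<in> lring X \<Longrightarrow> E \<in> sets (meas X)"
  and lring_finite: "E \<in> lring X \<Longrightarrow> emeasure (meas X) E < \<infinity>"
  and lring_Un: "E \<in> lring X \<Longrightarrow> E' \<in> lring X \<Longrightarrow> E \<union> E' \<in> lring X"
  and lring_Int: "A \<in> sets (meas X) \<Longrightarrow> E \<in> lring X \<Longrightarrow> A \<inter> E \<in> lring X"
  using ring[unfolded localizing_ring_def, THEN conjunct1]
    ring[unfolded localizing_ring_def, THEN conjunct2, THEN conjunct1]
    ring[unfolded localizing_ring_def, THEN conjunct2, THEN conjunct2, THEN conjunct1]
  by auto

lemma lring_exhaustion:
  obtains E :: "nat \<Rightarrow> 'x set" where "incseq E" "(\<Union>h. E h) = UNIV" "\<And>h. E h \<in> lring X"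
    "\<And>A. A \<in> lring X \<Longrightarrow> \<exists>h. A \<subseteq> E h"
proof -
  obtain E :: "nat \<Rightarrow> 'x set" where E: "incseq E" "(\<Union>h. E h) = UNIV"
    "\<And>h. E h \<in> sets (meas X)" "lring X = (\<Union>h. {A \<inter> E h |A. A \<in> sets (meas X)})"
    using ring[unfolded localizing_ring_def, THEN conjunct2, THEN conjunct2, THEN conjunct2,
        THEN conjunct1] by (elim exE conjE) simp
  have "E h \<in> lring X" for h
    unfolding E(4) using E(3)[of h] by blast
  moreover have "\<exists>h. A \<subseteq> E h" if "A \<in> lring X" for A
    using that unfolding E(4) by auto
  ultimately show thesis using that[OF E(1,2)] by simp
qed

lemma lring_nonempty: "lring X \<noteq> {}"
  by (rule lring_exhaustion) auto

lemma empty_lring: "{} \<in> lring X"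
  using lring_nonempty lring_Int[of "{}"] by auto

lemma core_subspace: "fun_subspace (core X)"
  by (rule square_field[unfolded square_field_operator_def, THEN conjunct1])

lemma core_lincomb: "f \<in> core X \<Longrightarrow> g \<in> core X \<Longrightarrow> (\<lambda>x. a * f x + b * g x) \<in> core X"
  using core_subspace by (simp add: fun_subspace_def)

lemma core_zero: "(\<lambda>x. 0) \<in> core X"
proof -
  obtain f where "f \<in> core X" using core_subspace by (auto simp: fun_subspace_def)
  from core_lincomb[OF this this, of 0 0] show ?thesis by simp
qed

lemma core_add: "f \<in> core X \<Longrightarrow> g \<in> core X \<Longrightarrow> (\<lambda>x. f x + g x) \<in> core X"
  and core_diff: "f \<in> core X \<Longrightarrow> g \<in> core X \<Longrightarrow> (\<lambda>x. f x - g x) \<in> core X"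
  and core_scale: "f \<in> core X \<Longrightarrow> (\<lambda>x. a * f x) \<in> core X"
  using core_lincomb[of f g 1 1] core_lincomb[of f g 1 "-1"] core_lincomb[of f f a 0] by auto

lemma core_C0: "f \<in> core X \<Longrightarrow> f \<in> C0_fun X"
  using square_field[unfolded square_field_operator_def, THEN conjunct2, THEN conjunct1] by auto

lemma core_continuous: "f \<in> core X \<Longrightarrow> continuous_on UNIV f"
  and core_bounded: "f \<in> core X \<Longrightarrow> bounded (range f)"
  using core_C0 by (auto simp: C0_fun_def)

lemma core_support:
  assumes "f \<in> core X"
  obtains E where "E \<in> lring X" "\<And>x. x \<notin> E \<Longrightarrow> f x = 0"
  using core_C0[OF assms] by (auto simp: C0_fun_def)

lemma core_measurable: "f \<in> core X \<Longrightarrow> f \<in> borel_measurable (meas X)"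
  by (intro continuous_measurable_meas core_continuous)

lemma core_L2: "f \<in> core X \<Longrightarrow> f \<in> L2_fun (meas X)"
  using diffusion by (auto simp: topological_local_diffusion_space_def L2_dense_def)

lemma core_compose:
  "\<phi> \<in> Cb_smooth k \<Longrightarrow> (\<And>i. i < k \<Longrightarrow> f i \<in> core X) \<Longrightarrow>
    (\<lambda>x. \<phi> (\<lambda>i. f i x) - \<phi> (\<lambda>i. 0)) \<in> core X"
proof -
  have "\<forall>k. \<forall>\<phi>\<in>Cb_smooth k. \<forall>f. (\<forall>i<k. f i \<in> core X) \<longrightarrow>
        (\<lambda>x. \<phi> (\<lambda>i. f i x) - \<phi> (\<lambda>i. 0)) \<in> core X"
    by (rule square_field[unfolded square_field_operator_def,
          THEN conjunct2, THEN conjunct2, THEN conjunct2, THEN conjunct2,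
          THEN conjunct1])
  then show "\<phi> \<in> Cb_smooth k \<Longrightarrow> (\<And>i. i < k \<Longrightarrow> f i \<in> core X) \<Longrightarrow>
    (\<lambda>x. \<phi> (\<lambda>i. f i x) - \<phi> (\<lambda>i. 0)) \<in> core X"
    by blast
qed

lemma sqf_measurable: "f \<in> core X \<Longrightarrow> g \<in> core X \<Longrightarrow> sqf X f g \<in> borel_measurable (meas X)"
  and sqf_sym_AE: "f \<in> core X \<Longrightarrow> g \<in> core X \<Longrightarrow> AE x in meas X. sqf X f g x = sqf X g f x"
  and sqf_linear_AE: "f \<in> core X \<Longrightarrow> g \<in> core X \<Longrightarrow> h \<in> core X \<Longrightarrow>
    AE x in meas X. sqf X (\<lambda>y. a * f y + b * g y) h x = a * sqf X f h x + b * sqf X g h x"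
  and sqf_nonneg_AE: "f \<in> core X \<Longrightarrow> AE x in meas X. 0 \<le> sqf X f f x"
proof -
  have "\<forall>f\<in>core X. \<forall>g\<in>core X. sqf X f g \<in> borel_measurable (meas X) \<and>
        (\<exists>h\<in>Sb_fun X. AE x in meas X. sqf X f g x = h x)"
    by (rule square_field[unfolded square_field_operator_def,
          THEN conjunct2, THEN conjunct2, THEN conjunct2, THEN conjunct2,
          THEN conjunct2, THEN conjunct1])
  then show "f \<in> core X \<Longrightarrow> g \<in> core X \<Longrightarrow> sqf X f g \<in> borel_measurable (meas X)"
    by blast
  have "\<forall>f\<in>core X. \<forall>g\<in>core X. AE x in meas X. sqf X f g x = sqf X g f x"
    by (rule square_field[unfolded square_field_operator_def,
          THEN conjunct2, THEN conjunct2, THEN conjunct2, THEN conjunct2,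
          THEN conjunct2, THEN conjunct2, THEN conjunct1])
  then show "f \<in> core X \<Longrightarrow> g \<in> core X \<Longrightarrow> AE x in meas X. sqf X f g x = sqf X g f x"
    by blast
  have "\<forall>f\<in>core X. \<forall>g\<in>core X. \<forall>h\<in>core X. \<forall>a b. AE x in meas X.
        sqf X (\<lambda>y. a * f y + b * g y) h x = a * sqf X f h x + b * sqf X g h x"
    by (rule square_field[unfolded square_field_operator_def,
          THEN conjunct2, THEN conjunct2, THEN conjunct2, THEN conjunct2,
          THEN conjunct2, THEN conjunct2, THEN conjunct2, THEN conjunct1])
  then show "f \<in> core X \<Longrightarrow> g \<in> core X \<Longrightarrow> h \<in> core X \<Longrightarrow>
    AE x in meas X. sqf X (\<lambda>y. a * f y + b * g y) h x = a * sqf X f h x + b * sqf X g h x"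
    by blast
  have "\<forall>f\<in>core X. AE x in meas X. 0 \<le> sqf X f f x"
    by (rule square_field[unfolded square_field_operator_def,
          THEN conjunct2, THEN conjunct2, THEN conjunct2, THEN conjunct2,
          THEN conjunct2, THEN conjunct2, THEN conjunct2, THEN conjunct2,
          THEN conjunct1])
  then show "f \<in> core X \<Longrightarrow> AE x in meas X. 0 \<le> sqf X f f x"
    by blast
qed

lemma sqf_bound:
  assumes "f \<in> core X" "g \<in> core X"
  obtains E C where "E \<in> lring X" "0 \<le> C" "AE x in meas X. \<bar>sqf X f g x\<bar> \<le> C * indicator E x"
proof -
  obtain h where h: "h \<in> Sb_fun X" "AE x in meas X. sqf X f g x = h x"
  proof -
    have "\<forall>f\<in>core X. \<forall>g\<in>core X. sqf X f g \<in> borel_measurable (meas X) \<and>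
        (\<exists>h\<in>Sb_fun X. AE x in meas X. sqf X f g x = h x)"
      by (rule square_field[unfolded square_field_operator_def,
          THEN conjunct2, THEN conjunct2, THEN conjunct2, THEN conjunct2,
          THEN conjunct2, THEN conjunct1])
    then show ?thesis using assms that by blast
  qed
  obtain E C where E: "E \<in> lring X" "\<And>x. x \<notin> E \<Longrightarrow> h x = 0" and C: "\<And>x. \<bar>h x\<bar> \<le> C"
    using h(1) by (auto simp: Sb_fun_def bounded_iff)
  have "0 \<le> C" using C[of undefined] by linarith
  moreover have "AE x in meas X. \<bar>sqf X f g x\<bar> \<le> C * indicator E x"
    using h(2) by eventually_elim (use C E(2) in \<open>auto simp: indicator_def\<close>)
  ultimately show thesis using that E(1) by blast
qed

lemma sqf_Linf: "f \<in> core X \<Longrightarrow> g \<in> core X \<Longrightarrow> sqf X f g \<in> Linf_fun (meas X)"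
proof -
  assume fg: "f \<in> core X" "g \<in> core X"
  obtain E C where E: "E \<in> lring X" "0 \<le> C" "AE x in meas X. \<bar>sqf X f g x\<bar> \<le> C * indicator E x"
    using sqf_bound[OF fg] .
  from E(3) have "AE x in meas X. \<bar>sqf X f g x\<bar> \<le> C"
    by eventually_elim (use E(2) in \<open>auto simp: indicator_def intro: order_trans\<close>)
  then show ?thesis using sqf_measurable[OF fg] by (auto simp: Linf_fun_def)
qed

lemma sqf_integrable: "f \<in> core X \<Longrightarrow> g \<in> core X \<Longrightarrow> integrable (meas X) (sqf X f g)"
proof -
  assume fg: "f \<in> core X" "g \<in> core X"
  obtain E C where E: "E \<in> lring X" "0 \<le> C" "AE x in meas X. \<bar>sqf X f g x\<bar> \<le> C * indicator E x"
    using sqf_bound[OF fg] .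
  show ?thesis
  proof (rule Bochner_Integration.integrable_bound)
    show "integrable (meas X) (\<lambda>x. C * indicator E x)"
      using lring_sets[OF E(1)] lring_finite[OF E(1)] by (intro integrable_mult_right) auto
    show "AE x in meas X. norm (sqf X f g x) \<le> norm (C * indicator E x)"
      using E(3) by eventually_elim (use E(2) in auto)
  qed (rule sqf_measurable[OF fg])
qed

text \<open>The quadratic form \<open>f \<mapsto> \<Gamma>(f, f)\<close> of a linear combination, almost everywhere.\<close>

lemma sqf_quadratic_AE:
  assumes f: "f \<in> core X" and g: "g \<in> core X"
  shows "AE x in meas X. sqf X (\<lambda>y. a * f y + b * g y) (\<lambda>y. a * f y + b * g y) x =
    a\<^sup>2 * sqf X f f x + 2 * a * b * sqf X f g x + b\<^sup>2 * sqf X g g x"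
proof -
  let ?h = "\<lambda>y. a * f y + b * g y"
  have h: "?h \<in> core X" using core_lincomb[OF f g] .
  from sqf_linear_AE[OF f g h, of a b] sqf_sym_AE[OF f h] sqf_sym_AE[OF g h]
    sqf_linear_AE[OF f g f, of a b] sqf_linear_AE[OF f g g, of a b] sqf_sym_AE[OF f g]
  show ?thesis
    by eventually_elim (simp add: algebra_simps power2_eq_square)
qed

text \<open>Young's inequality, from the non-negativity of \<open>\<Gamma>(s f \<plusminus> g / s)\<close> with \<open>s\<^sup>2 = \<epsilon>\<close>.\<close>

lemma sqf_young_AE:
  assumes f: "f \<in> core X" and g: "g \<in> core X" and "0 < \<epsilon>"
  shows "AE x in meas X. \<bar>2 * sqf X f g x\<bar> \<le> \<epsilon> * sqf X f f x + sqf X g g x / \<epsilon>"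
proof -
  define s where "s = sqrt \<epsilon>"
  have s: "s\<^sup>2 = \<epsilon>" "2 * s * (1/s) = 2" "2 * s * (-1/s) = -2" "(1/s)\<^sup>2 = 1/\<epsilon>" "(-1/s)\<^sup>2 = 1/\<epsilon>"
    using assms(3) by (auto simp: s_def power_divide)
  have "AE x in meas X. 0 \<le> s\<^sup>2 * sqf X f f x + 2 * s * t * sqf X f g x + t\<^sup>2 * sqf X g g x" for t
    using sqf_quadratic_AE[OF f g, of s t] sqf_nonneg_AE[OF core_lincomb[OF f g, of s t]]
    by eventually_elim simp
  from this[of "1/s", unfolded s] this[of "-1/s", unfolded s] show ?thesis
    by eventually_elim (auto simp: abs_le_iff)
qed

lemma sqf_add_le_AE:
  assumes f: "f \<in> core X" and g: "g \<in> core X"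
  shows "AE x in meas X. sqf X (\<lambda>y. f y + g y) (\<lambda>y. f y + g y) x \<le> 2 * sqf X f f x + 2 * sqf X g g x"
proof -
  from sqf_quadratic_AE[OF f g, of 1 1] sqf_young_AE[OF f g, of 1, simplified]
  show ?thesis
    by eventually_elim (simp add: abs_le_iff)
qed

text \<open>The energy \<open>\<integral> \<Gamma>(f, f) dm\<close> of an element of the core.\<close>

abbreviation energy :: "('x \<Rightarrow> real) \<Rightarrow> real" where
  "energy f \<equiv> pre_form X f f"

lemma energy_nonneg: "f \<in> core X \<Longrightarrow> 0 \<le> energy f"
  unfolding pre_form_def by (intro integral_nonneg_AE sqf_nonneg_AE)

lemma energy_quadratic:
  assumes f: "f \<in> core X" and g: "g \<in> core X"
  shows "energy (\<lambda>y. a * f y + b * g y) =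
    a\<^sup>2 * energy f + 2 * a * b * pre_form X f g + b\<^sup>2 * energy g"
proof -
  let ?h = "\<lambda>y. a * f y + b * g y"
  note h = core_lincomb[OF f g, of a b]
  have "energy ?h = (\<integral>x. a\<^sup>2 * sqf X f f x + 2 * a * b * sqf X f g x + b\<^sup>2 * sqf X g g x \<partial>meas X)"
    unfolding pre_form_def using sqf_quadratic_AE[OF f g, of a b]
    by (intro integral_cong_AE) (auto intro!: borel_measurable_add borel_measurable_times
        sqf_measurable f g h)
  also have "\<dots> = a\<^sup>2 * energy f + 2 * a * b * pre_form X f g + b\<^sup>2 * energy g"
    unfolding pre_form_def using sqf_integrable f g by simp
  finally show ?thesis .
qed

lemma energy_add_le:
  assumes f: "f \<in> core X" and g: "g \<in> core X"
  shows "energy (\<lambda>y. f y + g y) \<le> 2 * energy f + 2 * energy g"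
  using energy_quadratic[OF f g, of 1 1] energy_quadratic[OF f g, of 1 "-1"]
    energy_nonneg[OF core_diff[OF f g]] by simp

lemma energy_minus: "f \<in> core X \<Longrightarrow> energy (\<lambda>y. - f y) = energy f"
  using energy_quadratic[of f f "-1" 0] by simp

lemma energy_zero: "energy (\<lambda>y. 0) = 0"
  using energy_quadratic[OF core_zero core_zero, of 0 0] by simp

lemma energy_diff_le:
  assumes f: "f \<in> core X" and g: "g \<in> core X"
  shows "energy (\<lambda>y. f y - g y) \<le> 2 * energy f + 2 * energy g"
  using energy_add_le[OF f, of "\<lambda>y. - g y"] energy_minus[OF g] core_scale[OF g, of "-1"] by simp

lemma core_closable: "closable (meas X) (pre_form X) (core X)"
  using diffusion by (simp add: topological_local_diffusion_space_def)

end

section \<open>Square integrable functions\<close>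

lemma L2_fun_lincomb:
  assumes "f \<in> L2_fun M" "g \<in> L2_fun M"
  shows "(\<lambda>x. a * f x + b * g x) \<in> L2_fun M"
proof -
  have [measurable]: "f \<in> borel_measurable M" "g \<in> borel_measurable M"
    and i: "integrable M (\<lambda>x. (f x)\<^sup>2)" "integrable M (\<lambda>x. (g x)\<^sup>2)"
    using assms by (auto simp: L2_fun_def)
  have "integrable M (\<lambda>x. (a * f x + b * g x)\<^sup>2)"
  proof (rule Bochner_Integration.integrable_bound)
    show "integrable M (\<lambda>x. 2 * a\<^sup>2 * (f x)\<^sup>2 + 2 * b\<^sup>2 * (g x)\<^sup>2)"
      using i by simp
    have "(s + t)\<^sup>2 \<le> 2 * s\<^sup>2 + 2 * t\<^sup>2" for s t :: real
      using sum_squares_bound[of s t] by (simp add: power2_sum)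
    from this[of "a * f x" "b * g x" for x]
    show "AE x in M. norm ((a * f x + b * g x)\<^sup>2) \<le> norm (2 * a\<^sup>2 * (f x)\<^sup>2 + 2 * b\<^sup>2 * (g x)\<^sup>2)"
      by (simp add: power_mult_distrib mult.assoc)
  qed simp
  then show ?thesis by (simp add: L2_fun_def)
qed

lemma L2_fun_diff: "f \<in> L2_fun M \<Longrightarrow> g \<in> L2_fun M \<Longrightarrow> (\<lambda>x. f x - g x) \<in> L2_fun M"
  using L2_fun_lincomb[of f M g 1 "-1"] by simp

lemma L2_norm_sq: "(L2_norm M f)\<^sup>2 = (\<integral>x. (f x)\<^sup>2 \<partial>M)"
  by (simp add: L2_norm_def)

lemma L2_norm_tendsto_0_iff: "(\<lambda>n. L2_norm M (f n)) \<longlonglongrightarrow> 0 \<longleftrightarrow> (\<lambda>n. \<integral>x. (f n x)\<^sup>2 \<partial>M) \<longlonglongrightarrow> 0"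
proof
  assume "(\<lambda>n. L2_norm M (f n)) \<longlonglongrightarrow> 0"
  from tendsto_power[OF this, of 2] show "(\<lambda>n. \<integral>x. (f n x)\<^sup>2 \<partial>M) \<longlonglongrightarrow> 0"
    by (simp add: L2_norm_sq)
next
  assume "(\<lambda>n. \<integral>x. (f n x)\<^sup>2 \<partial>M) \<longlonglongrightarrow> 0"
  from tendsto_real_sqrt[OF this] show "(\<lambda>n. L2_norm M (f n)) \<longlonglongrightarrow> 0"
    by (simp add: L2_norm_def)
qed

lemma L2_integral_diff_le:
  assumes "f \<in> L2_fun M" "g \<in> L2_fun M"
  shows "(\<integral>x. (f x - g x)\<^sup>2 \<partial>M) \<le> 2 * (\<integral>x. (f x)\<^sup>2 \<partial>M) + 2 * (\<integral>x. (g x)\<^sup>2 \<partial>M)"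
proof -
  have "(\<integral>x. (f x - g x)\<^sup>2 \<partial>M) \<le> (\<integral>x. 2 * (f x)\<^sup>2 + 2 * (g x)\<^sup>2 \<partial>M)"
  proof (rule integral_mono)
    show "integrable M (\<lambda>x. (f x - g x)\<^sup>2)"
      using L2_fun_diff[OF assms] by (simp add: L2_fun_def)
    show "integrable M (\<lambda>x. 2 * (f x)\<^sup>2 + 2 * (g x)\<^sup>2)"
      using assms by (simp add: L2_fun_def)
    show "(f x - g x)\<^sup>2 \<le> 2 * (f x)\<^sup>2 + 2 * (g x)\<^sup>2" for x
      using sum_squares_bound[of "f x" "- g x"] by (simp add: power2_diff)
  qed
  also have "\<dots> = 2 * (\<integral>x. (f x)\<^sup>2 \<partial>M) + 2 * (\<integral>x. (g x)\<^sup>2 \<partial>M)"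
    using assms by (simp add: L2_fun_def)
  finally show ?thesis .
qed

lemma L2_norm_diff_tendsto_0:
  assumes "\<And>n. f n \<in> L2_fun M" "\<And>n. g n \<in> L2_fun M"
    and "(\<lambda>n. L2_norm M (f n)) \<longlonglongrightarrow> 0" "(\<lambda>n. L2_norm M (g n)) \<longlonglongrightarrow> 0"
  shows "(\<lambda>n. L2_norm M (\<lambda>x. f n x - g n x)) \<longlonglongrightarrow> 0"
  unfolding L2_norm_tendsto_0_iff
proof (rule tendsto_sandwich[OF _ _ tendsto_const])
  show "\<forall>\<^sub>F n in sequentially. 0 \<le> (\<integral>x. (f n x - g n x)\<^sup>2 \<partial>M)"
    by simp
  show "\<forall>\<^sub>F n in sequentially. (\<integral>x. (f n x - g n x)\<^sup>2 \<partial>M) \<le>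
      2 * (\<integral>x. (f n x)\<^sup>2 \<partial>M) + 2 * (\<integral>x. (g n x)\<^sup>2 \<partial>M)"
    using L2_integral_diff_le[OF assms(1,2)] by simp
  show "(\<lambda>n. 2 * (\<integral>x. (f n x)\<^sup>2 \<partial>M) + 2 * (\<integral>x. (g n x)\<^sup>2 \<partial>M)) \<longlonglongrightarrow> 0"
    using assms(3,4) unfolding L2_norm_tendsto_0_iff
    by (intro tendsto_add_zero tendsto_mult_right_zero)
qed

lemma L2_norm_tendsto_0_AE_subseq:
  assumes "\<And>n. f n \<in> L2_fun M" and "(\<lambda>n. L2_norm M (f n)) \<longlonglongrightarrow> 0"
  shows "\<exists>s::nat \<Rightarrow> nat. strict_mono s \<and> (AE x in M. (\<lambda>n. f (s n) x) \<longlonglongrightarrow> 0)"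
proof -
  have "\<exists>s::nat \<Rightarrow> nat. strict_mono s \<and> (AE x in M. (\<lambda>n. (f (s n) x)\<^sup>2) \<longlonglongrightarrow> 0)"
    using assms by (intro tendsto_L1_AE_subseq) (auto simp: L2_fun_def L2_norm_tendsto_0_iff)
  moreover have "(\<lambda>n. g n) \<longlonglongrightarrow> 0" if "(\<lambda>n. (g n)\<^sup>2) \<longlonglongrightarrow> 0" for g :: "nat \<Rightarrow> real"
    using tendsto_real_sqrt[OF that] by (simp add: tendsto_rabs_zero_iff)
  ultimately show ?thesis by fastforce
qed

text \<open>
  Completeness of \<open>L\<^sup>2\<close> over a finite measure: a Cauchy sequence in \<open>L\<^sup>2\<close> is Cauchy in \<open>L\<^sup>1\<close>, so it has
  a subsequence converging almost everywhere, and Fatou's lemma identifies the limit in \<open>L\<^sup>2\<close>.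
\<close>

lemma L2_complete:
  fixes M :: "'a measure"
  assumes "finite_measure M" and u: "\<And>n. u n \<in> L2_fun M"
    and cauchy: "\<And>e. e > 0 \<Longrightarrow> \<exists>N. \<forall>i\<ge>N. \<forall>j\<ge>N. (\<integral>x. (u i x - u j x)\<^sup>2 \<partial>M) < e"
  obtains f where "f \<in> L2_fun M" "(\<lambda>n. L2_norm M (\<lambda>x. u n x - f x)) \<longlonglongrightarrow> 0"
proof -
  interpret finite_measure M by fact
  have [measurable]: "u n \<in> borel_measurable M" for n
    using u by (simp add: L2_fun_def)
  have d2: "integrable M (\<lambda>x. (u i x - u j x)\<^sup>2)" for i j
    using L2_fun_diff[OF u u] by (simp add: L2_fun_def)
  have young: "\<bar>t\<bar> \<le> (\<delta> + t\<^sup>2 / \<delta>) / 2" if "\<delta> > 0" for t \<delta> :: real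
  proof -
    have "2 * \<bar>t\<bar> * \<delta> \<le> \<delta>\<^sup>2 + t\<^sup>2"
      using sum_squares_bound[of "\<bar>t\<bar>" \<delta>] by simp
    then show ?thesis using that by (simp add: field_simps power2_eq_square)
  qed
  have u1: "integrable M (u n)" for n
  proof (rule Bochner_Integration.integrable_bound)
    show "integrable M (\<lambda>x. (1 + (u n x)\<^sup>2 / 1) / 2)"
      using u[of n] by (auto simp: L2_fun_def)
    show "AE x in M. norm (u n x) \<le> norm ((1 + (u n x)\<^sup>2 / 1) / 2)"
      by (rule AE_I2) (use young[of 1] in \<open>auto simp: abs_of_nonneg\<close>)
  qed simp
  have "\<exists>N. \<forall>i\<ge>N. \<forall>j\<ge>N. (\<integral>x. norm (u i x - u j x) \<partial>M) < e" if e0: "e > 0" for e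
  proof -
    define K where "K = measure M (space M) + 1"
    define \<delta> where "\<delta> = e / K"
    have K: "K > 0" "\<delta> > 0" "\<delta> * measure M (space M) \<le> e"
      using that by (auto simp: K_def \<delta>_def field_simps add_pos_nonneg add_nonneg_pos)
    obtain N where N: "\<forall>i\<ge>N. \<forall>j\<ge>N. (\<integral>x. (u i x - u j x)\<^sup>2 \<partial>M) < \<delta> * e"
      using cauchy[OF mult_pos_pos[OF K(2) e0]] by auto
    have "(\<integral>x. norm (u i x - u j x) \<partial>M) < e" if ij: "i \<ge> N" "j \<ge> N" for i j
    proof -
      have "(\<integral>x. norm (u i x - u j x) \<partial>M) \<le> (\<integral>x. (\<delta> + (u i x - u j x)\<^sup>2 / \<delta>) / 2 \<partial>M)"
        using u1 d2 young[OF K(2)] by (intro integral_mono) auto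
      also have "\<dots> = (\<delta> * measure M (space M) + (\<integral>x. (u i x - u j x)\<^sup>2 \<partial>M) / \<delta>) / 2"
        using d2 by (simp add: mult.commute)
      also have "\<dots> < (e + e) / 2"
      proof -
        have "(\<integral>x. (u i x - u j x)\<^sup>2 \<partial>M) / \<delta> < e"
          using N ij K(2) by (simp add: field_simps)
        with K(3) show ?thesis by simp
      qed
      finally show ?thesis by simp
    qed
    then show ?thesis by blast
  qed
  from cauchy_L1_AE_cauchy_subseq[OF u1 this]
  obtain r where r: "strict_mono r" "AE x in M. Cauchy (\<lambda>i. u (r i) x)" by blast
  define f where "f x = lim (\<lambda>i. u (r i) x)" for x
  have [measurable]: "f \<in> borel_measurable M"
    unfolding f_def by (rule borel_measurable_lim_metric) simp
  have lim: "AE x in M. (\<lambda>i. u (r i) x) \<longlonglongrightarrow> f x"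
    using r(2) by eventually_elim (auto simp: f_def Cauchy_convergent_iff convergent_LIMSEQ_iff)
  have bound: "\<exists>N. \<forall>i\<ge>N. (\<integral>\<^sup>+x. ennreal ((u i x - f x)\<^sup>2) \<partial>M) \<le> ennreal e" if e: "e > 0" for e
  proof -
    obtain N where N: "\<forall>i\<ge>N. \<forall>j\<ge>N. (\<integral>x. (u i x - u j x)\<^sup>2 \<partial>M) < e"
      using cauchy[OF e] by auto
    have "(\<integral>\<^sup>+x. ennreal ((u i x - f x)\<^sup>2) \<partial>M) \<le> ennreal e" if i: "i \<ge> N" for i
    proof -
      have "(\<integral>\<^sup>+x. ennreal ((u i x - f x)\<^sup>2) \<partial>M) =
          (\<integral>\<^sup>+x. liminf (\<lambda>n. ennreal ((u i x - u (r n) x)\<^sup>2)) \<partial>M)"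
      proof (rule nn_integral_cong_AE)
        show "AE x in M. ennreal ((u i x - f x)\<^sup>2) = liminf (\<lambda>n. ennreal ((u i x - u (r n) x)\<^sup>2))"
          using lim
        proof eventually_elim
          case (elim x)
          then have "(\<lambda>n. ennreal ((u i x - u (r n) x)\<^sup>2)) \<longlonglongrightarrow> ennreal ((u i x - f x)\<^sup>2)"
            by (intro tendsto_intros)
          then show ?case by (rule lim_imp_Liminf[OF trivial_limit_sequentially, symmetric])
        qed
      qed
      also have "\<dots> \<le> liminf (\<lambda>n. \<integral>\<^sup>+x. ennreal ((u i x - u (r n) x)\<^sup>2) \<partial>M)"
        by (rule nn_integral_liminf) simp
      also have "\<dots> \<le> ennreal e"
      proof (rule Liminf_le)
        show "\<forall>\<^sub>F n in sequentially. (\<integral>\<^sup>+x. ennreal ((u i x - u (r n) x)\<^sup>2) \<partial>M) \<le> ennreal e"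
          using eventually_ge_at_top[of N]
        proof eventually_elim
          case (elim n)
          then have "r n \<ge> N" using seq_suble[OF r(1), of n] by linarith
          then have "(\<integral>x. (u i x - u (r n) x)\<^sup>2 \<partial>M) \<le> e" using N i by (simp add: less_imp_le)
          then show ?case using d2 by (simp add: nn_integral_eq_integral ennreal_leI)
        qed
      qed simp
      finally show ?thesis .
    qed
    then show ?thesis by blast
  qed
  obtain N0 where N0: "(\<integral>\<^sup>+x. ennreal ((u N0 x - f x)\<^sup>2) \<partial>M) \<le> ennreal 1"
    using bound[of 1] by auto
  have "integrable M (\<lambda>x. (u N0 x - f x)\<^sup>2)"
    using N0 by (intro integrableI_bounded) (auto simp: le_less_trans)
  then have "(\<lambda>x. u N0 x - f x) \<in> L2_fun M" by (simp add: L2_fun_def)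
  from L2_fun_diff[OF u[of N0] this] have f: "f \<in> L2_fun M" by simp
  have "(\<lambda>n. \<integral>x. (u n x - f x)\<^sup>2 \<partial>M) \<longlonglongrightarrow> 0"
  proof (rule LIMSEQ_I)
    fix e :: real assume "e > 0"
    then obtain N where N: "\<forall>i\<ge>N. (\<integral>\<^sup>+x. ennreal ((u i x - f x)\<^sup>2) \<partial>M) \<le> ennreal (e/2)"
      using bound[of "e/2"] by auto
    have "norm ((\<integral>x. (u n x - f x)\<^sup>2 \<partial>M) - 0) < e" if "n \<ge> N" for n
    proof -
      have i: "integrable M (\<lambda>x. (u n x - f x)\<^sup>2)"
        using L2_fun_diff[OF u f] by (simp add: L2_fun_def)
      have "(\<integral>\<^sup>+x. ennreal ((u n x - f x)\<^sup>2) \<partial>M) \<le> ennreal (e/2)"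
        using N that by blast
      then have "ennreal (\<integral>x. (u n x - f x)\<^sup>2 \<partial>M) \<le> ennreal (e/2)"
        unfolding nn_integral_eq_integral[OF i AE_I2[OF zero_le_power2]] .
      then have "(\<integral>x. (u n x - f x)\<^sup>2 \<partial>M) \<le> e/2"
        using \<open>e > 0\<close> by (simp add: ennreal_le_iff)
      then show ?thesis using \<open>e > 0\<close> by simp
    qed
    then show "\<exists>no. \<forall>n\<ge>no. norm ((\<integral>x. (u n x - f x)\<^sup>2 \<partial>M) - 0) < e" by blast
  qed
  then show thesis using that[OF f] by (simp add: L2_norm_tendsto_0_iff)
qed

context diffusion_space
begin

section \<open>Locality of the base form\<close>

lemma sqf_chain_AE:
  assumes "\<phi> \<in> Cb_smooth k" "\<And>i. i < k \<Longrightarrow> f i \<in> core X"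
  shows "AE x in meas X.
    sqf X (\<lambda>y. \<phi> (\<lambda>i. f i y) - \<phi> (\<lambda>i. 0)) (\<lambda>y. \<phi> (\<lambda>i. f i y) - \<phi> (\<lambda>i. 0)) x =
    (\<Sum>i<k. \<Sum>j<k. partial_deriv i \<phi> (\<lambda>i. f i x) * partial_deriv j \<phi> (\<lambda>j. f j x) *
      sqf X (f i) (f j) x)"
proof -
  have "\<forall>k m. \<forall>\<phi>\<in>Cb_smooth k. \<forall>\<psi>\<in>Cb_smooth m. \<forall>f g.
        (\<forall>i<k. f i \<in> core X) \<longrightarrow> (\<forall>j<m. g j \<in> core X) \<longrightarrow>
        (AE x in meas X.
           sqf X (\<lambda>y. \<phi> (\<lambda>i. f i y) - \<phi> (\<lambda>i. 0)) (\<lambda>y. \<psi> (\<lambda>j. g j y) - \<psi> (\<lambda>j. 0)) x =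
           (\<Sum>i<k. \<Sum>j<m. partial_deriv i \<phi> (\<lambda>i. f i x) * partial_deriv j \<psi> (\<lambda>j. g j x) *
              sqf X (f i) (g j) x))"
    by (rule square_field[unfolded square_field_operator_def,
          THEN conjunct2, THEN conjunct2, THEN conjunct2, THEN conjunct2,
          THEN conjunct2, THEN conjunct2, THEN conjunct2, THEN conjunct2,
          THEN conjunct2])
  then show ?thesis using assms by simp
qed

text \<open>
  A sequence in the core which converges to a non-zero constant \<open>c\<close> in \<open>L\<^sup>2\<close> and is Cauchy for the
  form has energy tending to \<open>0\<close>. Composing it with the function \<open>\<phi>(t) = c sin(\<pi> t / 2c)\<close>, for
  which \<open>\<phi>(c) = c\<close> and \<open>\<phi>'(c) = 0\<close>, makes the energy vanish in the limit along an almost everywhere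
  convergent subsequence, without changing the limit in \<open>L\<^sup>2\<close>; closability does the rest.
\<close>

lemma energy_tendsto_0_of_const_limit:
  assumes d: "\<And>n. d n \<in> core X" and cauchy: "form_cauchy (pre_form X) d"
    and L2: "\<And>n. (\<lambda>x. d n x - c) \<in> L2_fun (meas X)"
    and lim: "(\<lambda>n. L2_norm (meas X) (\<lambda>x. d n x - c)) \<longlonglongrightarrow> 0"
  shows "(\<lambda>n. energy (d n)) \<longlonglongrightarrow> 0"
proof (cases "c = 0")
  case True
  then have "form_approx (meas X) (pre_form X) (core X) d (\<lambda>x. 0)"
    using assms by (simp add: form_approx_def)
  then show ?thesis using core_closable by (auto simp: closable_def)
next
  case False
  define b where "b = pi / (2 * c)"
  have bc: "c * b = pi / 2" "b * c = pi / 2"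
    using False by (auto simp: b_def)
  define \<phi> :: "(nat \<Rightarrow> real) \<Rightarrow> real" where "\<phi> y = c * sin (b * y 0)" for y
  have \<phi>: "\<phi> \<in> Cb_smooth 1" unfolding \<phi>_def by (rule Cb_smooth_sin)
  have \<phi>': "partial_deriv 0 \<phi> y = (pi / 2) * cos (b * y 0)" for y
    unfolding \<phi>_def partial_deriv_sin bc ..
  define B where "B = (pi / 2)\<^sup>2"
  have "((pi/2) * cos t)\<^sup>2 \<le> B" for t
    unfolding B_def power_mult_distrib by (rule mult_left_le) (auto simp: abs_square_le_1)
  then have B: "B > 0" "((pi/2) * cos t)\<^sup>2 \<le> B" for t
    by (auto simp: B_def)
  obtain s where s: "strict_mono s" "AE x in meas X. (\<lambda>n. d (s n) x - c) \<longlonglongrightarrow> 0"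
    using L2_norm_tendsto_0_AE_subseq[OF L2 lim] by blast
  define e where "e n = d (s n)" for n
  define h where "h n x = c * sin (b * e n x)" for n x
  have e [simp]: "e n \<in> core X" for n using d by (simp add: e_def)
  have h [simp]: "h n \<in> core X" for n
    using core_compose[OF \<phi>, of "\<lambda>_. e n"] by (simp add: \<phi>_def h_def[abs_def])
  have sqf_h: "AE x in meas X. sqf X (h n) (h n) x = ((pi/2) * cos (b * e n x))\<^sup>2 * sqf X (e n) (e n) x" for n
    using sqf_chain_AE[OF \<phi>, of "\<lambda>_. e n"]
    by (simp add: \<phi>' power2_eq_square) (simp add: \<phi>_def h_def[abs_def])
  have cauchy_e: "\<exists>n. \<forall>i\<ge>n. \<forall>j\<ge>n. energy (\<lambda>x. e i x - e j x) < \<epsilon>" if pos: "\<epsilon> > 0" for \<epsilon>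
  proof -
    obtain n where n: "\<forall>i\<ge>n. \<forall>j\<ge>n. energy (\<lambda>x. d i x - d j x) < \<epsilon>"
      using cauchy pos unfolding form_cauchy_def by blast
    have "i \<ge> n \<Longrightarrow> s i \<ge> n" for i using seq_suble[OF s(1), of i] by linarith
    with n show ?thesis unfolding e_def by blast
  qed
  have energy_h: "(\<lambda>n. energy (h n)) \<longlonglongrightarrow> 0"
  proof (rule LIMSEQ_I)
    fix \<epsilon> :: real assume "\<epsilon> > 0"
    \<comment> \<open>\<open>\<Gamma>(h\<^sub>n) = \<phi>'(e\<^sub>n)\<^sup>2 \<Gamma>(e\<^sub>n)\<close> is at most \<open>2 \<phi>'(e\<^sub>n)\<^sup>2 (\<Gamma>(e\<^sub>n - e\<^sub>N) + \<Gamma>(e\<^sub>N))\<close> for a fixed large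
      \<open>N\<close>: the first term has a small integral for all \<open>n \<ge> N\<close>, and dominated convergence applies to
      the second one, as \<open>\<phi>'(c) = 0\<close>.\<close>
    define \<delta> where "\<delta> = \<epsilon> / (4 * B)"
    have \<delta>: "\<delta> > 0" "2 * B * \<delta> = \<epsilon> / 2" using \<open>\<epsilon> > 0\<close> B(1) by (auto simp: \<delta>_def)
    obtain N where N: "\<And>i. i \<ge> N \<Longrightarrow> energy (\<lambda>x. e i x - e N x) < \<delta>"
      using cauchy_e[OF \<delta>(1)] by blast
    let ?w = "\<lambda>n x. ((pi/2) * cos (b * e n x))\<^sup>2 * sqf X (e N) (e N) x"
    have [measurable]: "e n \<in> borel_measurable (meas X)" "sqf X (e N) (e N) \<in> borel_measurable (meas X)" for n
      using core_measurable sqf_measurable e by blast+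
    have wbound: "AE x in meas X. norm (?w n x) \<le> B * sqf X (e N) (e N) x" for n
      using sqf_nonneg_AE[OF e[of N]]
    proof eventually_elim
      case (elim x)
      then have "?w n x \<le> B * sqf X (e N) (e N) x" by (intro mult_right_mono B(2))
      with elim show ?case by simp
    qed
    have w: "integrable (meas X) (?w n)" for n
    proof (rule Bochner_Integration.integrable_bound)
      show "integrable (meas X) (\<lambda>x. B * sqf X (e N) (e N) x)"
        using sqf_integrable by simp
      show "AE x in meas X. norm (?w n x) \<le> norm (B * sqf X (e N) (e N) x)"
        using wbound[of n] by eventually_elim (erule order_trans, simp only: real_norm_def abs_ge_self)
    qed simp
    have "(\<lambda>n. \<integral>x. ?w n x \<partial>meas X) \<longlonglongrightarrow> (\<integral>x. 0 \<partial>meas X)"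
    proof (rule integral_dominated_convergence)
      show "integrable (meas X) (\<lambda>x. B * sqf X (e N) (e N) x)"
        using sqf_integrable by simp
      show "AE x in meas X. (\<lambda>n. ?w n x) \<longlonglongrightarrow> 0"
        using s(2)
      proof eventually_elim
        case (elim x)
        then have "(\<lambda>n. e n x) \<longlonglongrightarrow> c" unfolding e_def by (simp add: LIM_zero_iff)
        then have "(\<lambda>n. ?w n x) \<longlonglongrightarrow> ((pi/2) * cos (b * c))\<^sup>2 * sqf X (e N) (e N) x"
          by (intro tendsto_intros)
        then show ?case using bc by simp
      qed
    qed (use wbound in auto)
    then obtain N' where N': "\<And>n. n \<ge> N' \<Longrightarrow> (\<integral>x. ?w n x \<partial>meas X) < \<epsilon> / 4"
      using LIMSEQ_D[of _ 0 "\<epsilon>/4"] \<open>\<epsilon> > 0\<close> by fastforce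
    have "norm (energy (h n) - 0) < \<epsilon>" if n: "n \<ge> max N N'" for n
    proof -
      let ?D = "\<lambda>x. e n x - e N x"
      have D: "?D \<in> core X" by (intro core_diff e)
      have "AE x in meas X. sqf X (h n) (h n) x \<le> 2 * B * sqf X ?D ?D x + 2 * ?w n x"
        using sqf_h[of n] sqf_add_le_AE[OF D e[of N]] sqf_nonneg_AE[OF D]
      proof eventually_elim
        case (elim x)
        let ?c = "((pi/2) * cos (b * e n x))\<^sup>2"
        have "sqf X (h n) (h n) x \<le> ?c * (2 * sqf X ?D ?D x + 2 * sqf X (e N) (e N) x)"
          using elim(1,2) by (simp add: mult_left_mono)
        also have "\<dots> = ?c * (2 * sqf X ?D ?D x) + 2 * ?w n x"
          by (simp add: algebra_simps)
        also have "?c * (2 * sqf X ?D ?D x) \<le> B * (2 * sqf X ?D ?D x)"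
          using elim(3) by (intro mult_right_mono B(2)) simp
        finally show ?case by simp
      qed
      then have "energy (h n) \<le> (\<integral>x. 2 * B * sqf X ?D ?D x + 2 * ?w n x \<partial>meas X)"
        unfolding pre_form_def
        using w[of n] sqf_integrable[OF D D] sqf_integrable[OF h h]
        by (intro integral_mono_AE) auto
      also have "\<dots> = 2 * B * energy ?D + 2 * (\<integral>x. ?w n x \<partial>meas X)"
        using w[of n] sqf_integrable[OF D D] by (simp add: pre_form_def)
      also have "\<dots> < 2 * B * \<delta> + 2 * (\<epsilon> / 4)"
        using N[of n] N'[of n] n B(1) by (intro add_strict_mono mult_strict_left_mono) auto
      finally show ?thesis using \<delta>(2) energy_nonneg[OF h] by simp
    qed
    then show "\<exists>no. \<forall>n\<ge>no. norm (energy (h n) - 0) < \<epsilon>" by blast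
  qed
  \<comment> \<open>\<open>e\<^sub>n\<close> and \<open>h\<^sub>n\<close> have the same limit \<open>c\<close> in \<open>L\<^sup>2\<close>, so closability applies to the difference.\<close>
  define q where "q n x = e n x - h n x" for n x
  have q [simp]: "q n \<in> core X" for n unfolding q_def[abs_def] by (intro core_diff e h)
  have "form_approx (meas X) (pre_form X) (core X) q (\<lambda>x. 0)"
    unfolding form_approx_def
  proof (intro conjI allI)
    show "form_cauchy (pre_form X) q"
      unfolding form_cauchy_def
    proof (intro allI impI)
      fix \<epsilon> :: real assume "\<epsilon> > 0"
      then obtain N where N: "\<And>i j. i \<ge> N \<Longrightarrow> j \<ge> N \<Longrightarrow> energy (\<lambda>x. e i x - e j x) < \<epsilon> / 4"
        using cauchy_e[of "\<epsilon>/4"] by auto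
      obtain N' where N': "\<And>n. n \<ge> N' \<Longrightarrow> energy (h n) < \<epsilon> / 16"
        using LIMSEQ_D[OF energy_h, of "\<epsilon>/16"] \<open>\<epsilon> > 0\<close> by fastforce
      have "energy (\<lambda>x. q i x - q j x) < \<epsilon>" if "i \<ge> max N N'" "j \<ge> max N N'" for i j
      proof -
        have "(\<lambda>x. q i x - q j x) = (\<lambda>x. (e i x - e j x) - (h i x - h j x))"
          by (auto simp: q_def)
        then have "energy (\<lambda>x. q i x - q j x) \<le> 2 * energy (\<lambda>x. e i x - e j x) + 2 * energy (\<lambda>x. h i x - h j x)"
          using energy_diff_le[OF core_diff[OF e[of i] e[of j]] core_diff[OF h[of i] h[of j]]] by simp
        also have "\<dots> < 2 * (\<epsilon> / 4) + 2 * (2 * (\<epsilon>/16) + 2 * (\<epsilon>/16))"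
          using N[of i j] N'[of i] N'[of j] that energy_diff_le[OF h[of i] h[of j]]
          by (intro add_strict_mono) auto
        finally show ?thesis by simp
      qed
      then show "\<exists>n. \<forall>i\<ge>n. \<forall>j\<ge>n. energy (\<lambda>x. q i x - q j x) < \<epsilon>" by blast
    qed
    have L2e: "(\<lambda>x. e n x - c) \<in> L2_fun (meas X)" for n
      using L2 by (simp add: e_def)
    have lime: "(\<lambda>n. \<integral>x. (e n x - c)\<^sup>2 \<partial>meas X) \<longlonglongrightarrow> 0"
      using LIMSEQ_subseq_LIMSEQ[OF lim s(1)] unfolding e_def L2_norm_tendsto_0_iff[symmetric]
      by (simp add: o_def)
    define A where "A = 1 + pi/2"
    have point: "(q n x)\<^sup>2 \<le> A\<^sup>2 * (e n x - c)\<^sup>2" for n x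
    proof -
      have "\<bar>sin (b * e n x) - sin (b * c)\<bar> \<le> \<bar>b * e n x - b * c\<bar>"
      proof -
        have "\<bar>sin u - sin v\<bar> \<le> \<bar>u - v\<bar>" for u v :: real
        proof -
          have "sin u - sin v = 2 * sin ((u - v) / 2) * cos ((u + v) / 2)"
            by (rule sin_diff_sin)
          then have "\<bar>sin u - sin v\<bar> = 2 * \<bar>sin ((u - v) / 2)\<bar> * \<bar>cos ((u + v) / 2)\<bar>"
            by (simp add: abs_mult)
          also have "\<dots> \<le> 2 * \<bar>(u - v) / 2\<bar> * 1"
            by (intro mult_mono abs_sin_x_le_abs_x abs_cos_le_one) auto
          finally show ?thesis by simp
        qed
        then show ?thesis .
      qed
      then have "\<bar>c\<bar> * \<bar>sin (b * e n x) - sin (b * c)\<bar> \<le> \<bar>c\<bar> * \<bar>b * e n x - b * c\<bar>"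
        by (intro mult_left_mono) auto
      also have "\<dots> = \<bar>(c * b) * (e n x - c)\<bar>"
        by (simp add: abs_mult[symmetric] algebra_simps)
      also have "\<dots> = (pi/2) * \<bar>e n x - c\<bar>"
        unfolding bc by (simp add: abs_mult)
      also have "\<bar>c\<bar> * \<bar>sin (b * e n x) - sin (b * c)\<bar> = \<bar>h n x - c\<bar>"
        unfolding abs_mult[symmetric] by (simp add: bc h_def right_diff_distrib)
      finally have "\<bar>h n x - c\<bar> \<le> (pi/2) * \<bar>e n x - c\<bar>" .
      moreover have "\<bar>q n x\<bar> \<le> \<bar>e n x - c\<bar> + \<bar>h n x - c\<bar>"
        unfolding q_def by arith
      moreover have "\<bar>A * (e n x - c)\<bar> = \<bar>e n x - c\<bar> + (pi/2) * \<bar>e n x - c\<bar>"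
        unfolding abs_mult A_def using pi_gt_zero by (simp add: abs_of_pos add_pos_pos distrib_right)
      ultimately have "\<bar>q n x\<bar> \<le> \<bar>A * (e n x - c)\<bar>"
        by linarith
      then show ?thesis
        using abs_le_square_iff power_mult_distrib by metis
    qed
    show "(\<lambda>n. L2_norm (meas X) (\<lambda>x. q n x - 0)) \<longlonglongrightarrow> 0"
      unfolding L2_norm_tendsto_0_iff
    proof (rule tendsto_sandwich[OF _ _ tendsto_const tendsto_mult_right_zero[OF lime, of "A\<^sup>2"]])
      show "\<forall>\<^sub>F n in sequentially. (\<integral>x. (q n x - 0)\<^sup>2 \<partial>meas X) \<le> A\<^sup>2 * (\<integral>x. (e n x - c)\<^sup>2 \<partial>meas X)"
        using point core_L2[OF q] L2e
        by (subst integral_mult_right_zero[symmetric], intro always_eventually allI integral_mono)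
          (auto simp: L2_fun_def)
    qed simp
  qed simp
  then have energy_q: "(\<lambda>n. energy (q n)) \<longlonglongrightarrow> 0"
    using core_closable by (auto simp: closable_def)
  have energy_e: "(\<lambda>n. energy (e n)) \<longlonglongrightarrow> 0"
  proof (rule tendsto_sandwich[OF _ _ tendsto_const])
    show "\<forall>\<^sub>F n in sequentially. energy (e n) \<le> 2 * energy (q n) + 2 * energy (h n)"
    proof (intro always_eventually allI)
      fix n
      have "e n = (\<lambda>x. q n x + h n x)" by (simp add: q_def)
      then show "energy (e n) \<le> 2 * energy (q n) + 2 * energy (h n)"
        using energy_add_le[OF q[of n] h[of n]] by simp
    qed
    show "(\<lambda>n. 2 * energy (q n) + 2 * energy (h n)) \<longlonglongrightarrow> 0"
      using energy_q energy_h by (intro tendsto_add_zero tendsto_mult_right_zero)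
  qed (use energy_nonneg in auto)
  show ?thesis
  proof (rule LIMSEQ_I)
    fix \<epsilon> :: real assume "\<epsilon> > 0"
    obtain N where N: "\<And>i j. i \<ge> N \<Longrightarrow> j \<ge> N \<Longrightarrow> energy (\<lambda>x. d i x - d j x) < \<epsilon> / 4"
      using cauchy[unfolded form_cauchy_def, rule_format, of "\<epsilon>/4"] \<open>\<epsilon> > 0\<close> by auto
    obtain N' where N': "\<And>n. n \<ge> N' \<Longrightarrow> energy (e n) < \<epsilon> / 4"
      using LIMSEQ_D[OF energy_e, of "\<epsilon>/4"] \<open>\<epsilon> > 0\<close> by fastforce
    define m where "m = s (max N N')"
    have m: "m \<ge> N" "energy (d m) < \<epsilon> / 4"
      using seq_suble[OF s(1), of "max N N'"] N'[of "max N N'"] by (auto simp: m_def e_def)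
    have "norm (energy (d n) - 0) < \<epsilon>" if "n \<ge> N" for n
      using energy_add_le[OF core_diff[OF d[of n] d[of m]] d[of m]] N[OF that m(1)] m(2)
        energy_nonneg[OF d[of n]] by simp
    then show "\<exists>no. \<forall>n\<ge>no. norm (energy (d n) - 0) < \<epsilon>" by blast
  qed
qed

text \<open>If \<open>f + c\<close> lies in the domain of the closure, every sequence in the core which approximates it
  converges to \<open>f\<close> in energy.\<close>

lemma energy_tendsto_0_of_translate:
  assumes f: "f \<in> core X" and fc: "(\<lambda>x. f x + c) \<in> L2_fun (meas X)"
    and approx: "form_approx (meas X) (pre_form X) (core X) v (\<lambda>x. f x + c)"
  shows "(\<lambda>n. energy (\<lambda>x. v n x - f x)) \<longlonglongrightarrow> 0"
proof (rule energy_tendsto_0_of_const_limit)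
  have v: "v n \<in> core X" for n using approx by (simp add: form_approx_def)
  show "(\<lambda>x. v n x - f x) \<in> core X" for n using v f by (rule core_diff)
  show "form_cauchy (pre_form X) (\<lambda>n x. v n x - f x)"
    using approx by (simp add: form_approx_def form_cauchy_def)
  have eq: "v n x - f x - c = v n x - (f x + c)" for n x by simp
  show "(\<lambda>x. v n x - f x - c) \<in> L2_fun (meas X)" for n
    unfolding eq by (intro L2_fun_diff core_L2 v fc)
  show "(\<lambda>n. L2_norm (meas X) (\<lambda>x. v n x - f x - c)) \<longlonglongrightarrow> 0"
    unfolding eq using approx by (simp add: form_approx_def)
qed

lemma sqf_L1_tendsto:
  assumes f: "f \<in> core X" and v: "\<And>n. v n \<in> core X"
    and lim: "(\<lambda>n. energy (\<lambda>x. v n x - f x)) \<longlonglongrightarrow> 0"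
  shows "(\<lambda>n. \<integral>x. \<bar>sqf X (v n) (v n) x - sqf X f f x\<bar> \<partial>meas X) \<longlonglongrightarrow> 0"
proof (rule LIMSEQ_I)
  fix e :: real assume e: "e > 0"
  define \<epsilon> where "\<epsilon> = e / (2 * (energy f + 1))"
  have ef: "energy f \<ge> 0" using f by (rule energy_nonneg)
  have \<epsilon>: "\<epsilon> > 0"
    using e ef by (simp add: \<epsilon>_def)
  have \<epsilon>2: "\<epsilon> * energy f < e / 2"
  proof -
    define k where "k = energy f + 1"
    have "k > 0" using ef by (simp add: k_def)
    then have "\<epsilon> * k = e / 2" unfolding \<epsilon>_def k_def[symmetric] by simp
    then have "\<epsilon> * (energy f + 1) = e / 2" by (simp only: k_def)
    then show ?thesis using \<epsilon> by (simp add: algebra_simps)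
  qed
  have "(\<lambda>n. (1 + 1/\<epsilon>) * energy (\<lambda>x. v n x - f x)) \<longlonglongrightarrow> 0"
    using lim by (rule tendsto_mult_right_zero)
  then obtain N where N: "\<And>n. n \<ge> N \<Longrightarrow> (1 + 1/\<epsilon>) * energy (\<lambda>x. v n x - f x) < e / 2"
    using LIMSEQ_D[of _ 0 "e/2"] e by fastforce
  have "(\<integral>x. \<bar>sqf X (v n) (v n) x - sqf X f f x\<bar> \<partial>meas X) < e" if "n \<ge> N" for n
  proof -
    let ?d = "\<lambda>x. v n x - f x"
    have d: "?d \<in> core X" using v f by (rule core_diff)
    have "AE x in meas X. \<bar>sqf X (v n) (v n) x - sqf X f f x\<bar> \<le> \<epsilon> * sqf X f f x + (1 + 1/\<epsilon>) * sqf X ?d ?d x"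
      using sqf_quadratic_AE[OF f d, of 1 1, simplified] sqf_young_AE[OF f d \<epsilon>] sqf_nonneg_AE[OF d]
      by eventually_elim (auto simp: abs_le_iff algebra_simps)
    then have "(\<integral>x. \<bar>sqf X (v n) (v n) x - sqf X f f x\<bar> \<partial>meas X) \<le>
        (\<integral>x. \<epsilon> * sqf X f f x + (1 + 1/\<epsilon>) * sqf X ?d ?d x \<partial>meas X)"
      using sqf_integrable f d v by (intro integral_mono_AE) auto
    also have "\<dots> = \<epsilon> * energy f + (1 + 1/\<epsilon>) * energy ?d"
      using sqf_integrable f d by (simp add: pre_form_def)
    also have "\<dots> < e" using \<epsilon>2 N[OF that] by linarith
    finally show ?thesis .
  qed
  then show "\<exists>no. \<forall>n\<ge>no. norm ((\<integral>x. \<bar>sqf X (v n) (v n) x - sqf X f f x\<bar> \<partial>meas X) - 0) < e"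
    by (auto intro!: exI[of _ N] simp: abs_of_nonneg)
qed

lemma core_subset_base_dom: "core X \<subseteq> base_dom X"
proof
  fix f assume f: "f \<in> core X"
  have "form_approx (meas X) (pre_form X) (core X) (\<lambda>_. f) f"
    using f by (simp add: form_approx_def form_cauchy_def energy_zero L2_norm_def)
  then show "f \<in> base_dom X"
    using core_L2[OF f] by (auto simp: base_dom_def closure_dom_def)
qed

lemma core_subset_base_extended_dom: "core X \<subseteq> base_extended_dom X"
proof
  fix f assume f: "f \<in> core X"
  have dir: "dirichlet_form (meas X) (base_form X) (base_dom X)"
    using diffusion by (simp add: topological_local_diffusion_space_def)
  have lin: "\<forall>f\<in>base_dom X. \<forall>g\<in>base_dom X. \<forall>h\<in>base_dom X. \<forall>a b.
      base_form X (\<lambda>x. a * f x + b * g x) h = a * base_form X f h + b * base_form X g h"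
    by (rule dir[unfolded dirichlet_form_def, THEN conjunct2, THEN conjunct2, THEN conjunct2, THEN conjunct1])
  have z: "(\<lambda>x. 0) \<in> base_dom X" using core_zero core_subset_base_dom by blast
  have "base_form X (\<lambda>x. 0) (\<lambda>x. 0) = 0"
    using lin[rule_format, OF z z z, of 0 0] by simp
  then have "form_cauchy (base_form X) (\<lambda>_. f)"
    by (simp add: form_cauchy_def)
  then show "f \<in> base_extended_dom X"
    using f core_measurable core_subset_base_dom
    by (auto simp: base_extended_dom_def extended_dom_def intro!: exI[of _ "\<lambda>_. f"])
qed

text \<open>
  On the translate \<open>f + c\<close> of an element of the core, the limit in \<open>L\<^sup>1\<close> which defines
  \<open>sqf_closure\<close> exists and is \<open>\<Gamma>(f, f)\<close>, whichever approximating sequence is chosen.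
\<close>

lemma sqf_closure_translate:
  assumes f: "f \<in> core X" and fc: "(\<lambda>x. f x + c) \<in> base_dom X"
  shows "integrable (meas X) (sqf_closure X (\<lambda>x. f x + c)) \<and>
    (AE x in meas X. sqf_closure X (\<lambda>x. f x + c) x = sqf X f f x)"
proof -
  let ?P = "\<lambda>g. integrable (meas X) g \<and>
     (\<exists>v. form_approx (meas X) (pre_form X) (core X) v (\<lambda>x. f x + c) \<and>
        (\<lambda>n. \<integral>x. \<bar>sqf X (v n) (v n) x - g x\<bar> \<partial>meas X) \<longlonglongrightarrow> 0)"
  have L2: "(\<lambda>x. f x + c) \<in> L2_fun (meas X)"
    using fc by (simp add: base_dom_def closure_dom_def)
  obtain v0 where v0: "form_approx (meas X) (pre_form X) (core X) v0 (\<lambda>x. f x + c)"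
    using fc by (auto simp: base_dom_def closure_dom_def)
  have conv: "(\<lambda>n. \<integral>x. \<bar>sqf X (v n) (v n) x - sqf X f f x\<bar> \<partial>meas X) \<longlonglongrightarrow> 0"
    if "form_approx (meas X) (pre_form X) (core X) v (\<lambda>x. f x + c)" for v
    using that by (intro sqf_L1_tendsto f energy_tendsto_0_of_translate[OF f L2])
      (auto simp: form_approx_def)
  have "?P (sqf X f f)"
    using sqf_integrable[OF f f] v0 conv[OF v0] by blast
  from someI[where P = ?P, OF this] have P: "?P (sqf_closure X (\<lambda>x. f x + c))"
    unfolding sqf_closure_def .
  let ?g = "sqf_closure X (\<lambda>x. f x + c)"
  obtain v where v: "form_approx (meas X) (pre_form X) (core X) v (\<lambda>x. f x + c)"
    "(\<lambda>n. \<integral>x. \<bar>sqf X (v n) (v n) x - ?g x\<bar> \<partial>meas X) \<longlonglongrightarrow> 0" and g: "integrable (meas X) ?g"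
    using P by blast
  have vc: "v n \<in> core X" for n using v(1) by (simp add: form_approx_def)
  have "(\<lambda>n. (\<integral>x. \<bar>sqf X (v n) (v n) x - ?g x\<bar> \<partial>meas X) +
      (\<integral>x. \<bar>sqf X (v n) (v n) x - sqf X f f x\<bar> \<partial>meas X)) \<longlonglongrightarrow> 0"
    using v(2) conv[OF v(1)] by (rule tendsto_add_zero)
  moreover have "(\<integral>x. \<bar>?g x - sqf X f f x\<bar> \<partial>meas X) \<le> (\<integral>x. \<bar>sqf X (v n) (v n) x - ?g x\<bar> \<partial>meas X) +
      (\<integral>x. \<bar>sqf X (v n) (v n) x - sqf X f f x\<bar> \<partial>meas X)" for n
  proof -
    have i: "integrable (meas X) (\<lambda>x. \<bar>sqf X (v n) (v n) x - ?g x\<bar>)"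
      "integrable (meas X) (\<lambda>x. \<bar>sqf X (v n) (v n) x - sqf X f f x\<bar>)"
      "integrable (meas X) (\<lambda>x. \<bar>?g x - sqf X f f x\<bar>)"
      using g sqf_integrable vc f by auto
    show ?thesis
      unfolding Bochner_Integration.integral_add[OF i(1,2), symmetric]
      by (rule integral_mono[OF i(3) Bochner_Integration.integrable_add[OF i(1,2)]]) auto
  qed
  ultimately have "(\<integral>x. \<bar>?g x - sqf X f f x\<bar> \<partial>meas X) \<le> 0"
    by (intro LIMSEQ_le_const) auto
  then have "(\<integral>x. \<bar>?g x - sqf X f f x\<bar> \<partial>meas X) = 0"
    by (intro antisym) auto
  moreover have "integrable (meas X) (\<lambda>x. \<bar>?g x - sqf X f f x\<bar>)"
    using g sqf_integrable[OF f f] by auto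
  ultimately have "AE x in meas X. \<bar>?g x - sqf X f f x\<bar> = 0"
    by (subst (asm) integral_nonneg_eq_0_iff_AE) auto
  then show ?thesis using g by (auto elim!: eventually_mono)
qed

text \<open>
  Functions which differ from an element of the core by a constant. Sections of cylinder functions
  are of this kind.
\<close>

definition core_const :: "('x \<Rightarrow> real) set" where
  "core_const = {w. \<exists>c. (\<lambda>x. w x - c) \<in> core X}"

text \<open>The constant chosen in the definition of \<open>sqfX\<close> may differ from \<open>c\<close>; by locality this does
  not matter.\<close>

lemma sqfX_AE:
  assumes w: "(\<lambda>x. w x - c) \<in> core X"
  shows "sqfX X w \<in> Linf_fun (meas X)"
    and "AE x in meas X. sqfX X w x = sqf X (\<lambda>x. w x - c) (\<lambda>x. w x - c) x"
proof -
  let ?f = "\<lambda>x. w x - c"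
  have ex: "\<exists>c. (\<lambda>x. w x - c) \<in> base_dom X"
    using w core_subset_base_dom by blast
  define c' where "c' = (SOME c. (\<lambda>x. w x - c) \<in> base_dom X)"
  have c': "(\<lambda>x. w x - c') \<in> base_dom X" unfolding c'_def by (rule someI_ex[OF ex])
  have eq: "(\<lambda>x. w x - c') = (\<lambda>x. ?f x + (c - c'))" by auto
  have "sqfX X w = sqf_closure X (\<lambda>x. ?f x + (c - c'))"
    using ex c' unfolding sqfX_def c'_def[symmetric] by (simp add: sqf_extended_def flip: eq)
  then have i: "integrable (meas X) (sqfX X w)"
    and ae: "AE x in meas X. sqfX X w x = sqf X ?f ?f x"
    using sqf_closure_translate[OF w, of "c - c'"] c' unfolding eq by auto
  show "AE x in meas X. sqfX X w x = sqf X ?f ?f x" by (rule ae)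
  obtain C where "AE x in meas X. \<bar>sqf X ?f ?f x\<bar> \<le> C"
    using sqf_Linf[OF w w] by (auto simp: Linf_fun_def)
  with ae have "AE x in meas X. \<bar>sqfX X w x\<bar> \<le> C"
    by eventually_elim simp
  then show "sqfX X w \<in> Linf_fun (meas X)"
    using i by (auto simp: Linf_fun_def)
qed

lemma core_const_sqf_dom:
  assumes w: "w \<in> core_const"
  shows "w \<in> sqf_dom X" "sqfX X w \<in> Linf_fun (meas X)"
proof -
  obtain c where c: "(\<lambda>x. w x - c) \<in> core X" using w by (auto simp: core_const_def)
  have "bounded ((\<lambda>t. t + c) ` range (\<lambda>x. w x - c))"
    using core_bounded[OF c] by (rule bounded_plus_comp[of id _ "\<lambda>_. c", simplified])
      (auto simp: bounded_iff)
  then have "bounded (range w)" by (simp add: image_image)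
  then show "w \<in> sqf_dom X"
    using c core_subset_base_extended_dom by (auto simp: sqf_dom_def)
  show "sqfX X w \<in> Linf_fun (meas X)" by (rule sqfX_AE[OF c])
qed


section \<open>The lifted square field operator\<close>

lemma lift_props:
  assumes "f \<in> Linf_fun (meas X)"
  shows "lift X f \<in> borel_measurable (meas X)" "bounded (range (lift X f))"
    "AE x in meas X. lift X f x = f x"
  using bspec[OF lifting[unfolded strong_lifting_def, THEN conjunct1] assms] by simp_all

lemma lift_cong_AE:
  "f \<in> Linf_fun (meas X) \<Longrightarrow> g \<in> Linf_fun (meas X) \<Longrightarrow> AE x in meas X. f x = g x \<Longrightarrow> lift X f = lift X g"
  and lift_mono_AE:
  "f \<in> Linf_fun (meas X) \<Longrightarrow> g \<in> Linf_fun (meas X) \<Longrightarrow> AE x in meas X. f x \<le> g x \<Longrightarrow> lift X f x \<le> lift X g x"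
  and lift_linear:
  "f \<in> Linf_fun (meas X) \<Longrightarrow> g \<in> Linf_fun (meas X) \<Longrightarrow>
    lift X (\<lambda>y. a * f y + b * g y) x = a * lift X f x + b * lift X g x"
  and lift_mult:
  "f \<in> Linf_fun (meas X) \<Longrightarrow> g \<in> Linf_fun (meas X) \<Longrightarrow>
    lift X (\<lambda>y. f y * g y) x = lift X f x * lift X g x"
proof -
  have *: "((AE x in meas X. f x = g x) \<longrightarrow> lift X f = lift X g) \<and>
        ((AE x in meas X. f x \<le> g x) \<longrightarrow> (\<forall>x. lift X f x \<le> lift X g x)) \<and>
        (\<forall>a b x. lift X (\<lambda>y. a * f y + b * g y) x = a * lift X f x + b * lift X g x) \<and>
        (\<forall>x. lift X (\<lambda>y. f y * g y) x = lift X f x * lift X g x)"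
    if "f \<in> Linf_fun (meas X)" "g \<in> Linf_fun (meas X)"
    using lifting[unfolded strong_lifting_def, THEN conjunct2, THEN conjunct1] that by blast
  show "f \<in> Linf_fun (meas X) \<Longrightarrow> g \<in> Linf_fun (meas X) \<Longrightarrow>
      AE x in meas X. f x = g x \<Longrightarrow> lift X f = lift X g"
    using * by blast
  show "f \<in> Linf_fun (meas X) \<Longrightarrow> g \<in> Linf_fun (meas X) \<Longrightarrow>
      AE x in meas X. f x \<le> g x \<Longrightarrow> lift X f x \<le> lift X g x"
    using * by blast
  show "f \<in> Linf_fun (meas X) \<Longrightarrow> g \<in> Linf_fun (meas X) \<Longrightarrow>
      lift X (\<lambda>y. a * f y + b * g y) x = a * lift X f x + b * lift X g x"
    using * by blast
  show "f \<in> Linf_fun (meas X) \<Longrightarrow> g \<in> Linf_fun (meas X) \<Longrightarrow>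
      lift X (\<lambda>y. f y * g y) x = lift X f x * lift X g x"
    using * by blast
qed

lemma lift_continuous:
  "continuous_on UNIV f \<Longrightarrow> bounded (range f) \<Longrightarrow> lift X f = f"
  using lifting[unfolded strong_lifting_def, THEN conjunct2, THEN conjunct2, THEN conjunct2] by blast

lemma Linf_lincomb:
  assumes "f \<in> Linf_fun (meas X)" "g \<in> Linf_fun (meas X)"
  shows "(\<lambda>x. a * f x + b * g x) \<in> Linf_fun (meas X)"
proof -
  obtain A B where "AE x in meas X. \<bar>f x\<bar> \<le> A" "AE x in meas X. \<bar>g x\<bar> \<le> B"
    using assms by (auto simp: Linf_fun_def)
  then have "AE x in meas X. \<bar>a * f x + b * g x\<bar> \<le> \<bar>a\<bar> * A + \<bar>b\<bar> * B"
    by eventually_elim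
      (rule order_trans[OF abs_triangle_ineq], auto simp: abs_mult intro!: add_mono mult_left_mono)
  then show ?thesis using assms by (auto simp: Linf_fun_def)
qed

lemma Linf_mult:
  assumes "f \<in> Linf_fun (meas X)" "g \<in> Linf_fun (meas X)"
  shows "(\<lambda>x. f x * g x) \<in> Linf_fun (meas X)"
proof -
  obtain A B where "AE x in meas X. \<bar>f x\<bar> \<le> A" "AE x in meas X. \<bar>g x\<bar> \<le> B"
    using assms by (auto simp: Linf_fun_def)
  then have "AE x in meas X. \<bar>f x * g x\<bar> \<le> \<bar>A\<bar> * \<bar>B\<bar>"
    by eventually_elim (auto simp: abs_mult intro!: mult_mono)
  then show ?thesis using assms by (auto simp: Linf_fun_def)
qed

lemma Linf_continuous:
  "continuous_on UNIV f \<Longrightarrow> bounded (range f) \<Longrightarrow> f \<in> Linf_fun (meas X)"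
  using continuous_measurable_meas by (auto simp: Linf_fun_def bounded_iff)

lemma Linf_sum:
  assumes "finite I" "\<And>i. i \<in> I \<Longrightarrow> g i \<in> Linf_fun (meas X)"
  shows "(\<lambda>y. \<Sum>i\<in>I. g i y) \<in> Linf_fun (meas X) \<and>
    lift X (\<lambda>y. \<Sum>i\<in>I. g i y) x = (\<Sum>i\<in>I. lift X (g i) x)"
  using assms
proof (induction I rule: finite_induct)
  case empty
  have "lift X (\<lambda>y. 0) = (\<lambda>y. 0)" by (rule lift_continuous) auto
  then show ?case using Linf_continuous[of "\<lambda>y. 0"] by auto
next
  case (insert i I)
  then have g: "g i \<in> Linf_fun (meas X)" "(\<lambda>y. \<Sum>i\<in>I. g i y) \<in> Linf_fun (meas X)"
    and eq: "lift X (\<lambda>y. \<Sum>i\<in>I. g i y) x = (\<Sum>i\<in>I. lift X (g i) x)"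
    by auto
  show ?case
    using Linf_lincomb[OF g, of 1 1] lift_linear[OF g, of 1 1 x] insert(1,2) eq by simp
qed

text \<open>The version \<open>\<ell>(\<Gamma>(f, g))\<close> of \<open>\<Gamma>(f, g)\<close>. It is bilinear, symmetric and non-negative definite in
  \<open>f, g\<close> at every point of the space.\<close>

definition lsqf :: "('x \<Rightarrow> real) \<Rightarrow> ('x \<Rightarrow> real) \<Rightarrow> 'x \<Rightarrow> real" where
  "lsqf f g = lift X (sqf X f g)"

lemma lsqf_sym: "f \<in> core X \<Longrightarrow> g \<in> core X \<Longrightarrow> lsqf f g = lsqf g f"
  unfolding lsqf_def by (intro lift_cong_AE sqf_Linf sqf_sym_AE)

lemma lsqf_linear:
  assumes "f \<in> core X" "g \<in> core X" "h \<in> core X"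
  shows "lsqf (\<lambda>y. a * f y + b * g y) h x = a * lsqf f h x + b * lsqf g h x"
proof -
  have "lsqf (\<lambda>y. a * f y + b * g y) h = lift X (\<lambda>x. a * sqf X f h x + b * sqf X g h x)"
    unfolding lsqf_def using assms
    by (intro lift_cong_AE sqf_Linf sqf_linear_AE core_lincomb Linf_lincomb)
  then show ?thesis
    using assms lift_linear sqf_Linf by (simp add: lsqf_def)
qed

lemma lsqf_linear':
  assumes "f \<in> core X" "g \<in> core X" "h \<in> core X"
  shows "lsqf h (\<lambda>y. a * f y + b * g y) x = a * lsqf h f x + b * lsqf h g x"
  using lsqf_linear[OF assms, of a b x]
  unfolding lsqf_sym[OF core_lincomb[OF assms(1,2)] assms(3)] lsqf_sym[OF assms(1,3)]
    lsqf_sym[OF assms(2,3)] .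

lemma lsqf_nonneg:
  assumes "f \<in> core X"
  shows "0 \<le> lsqf f f x"
proof -
  have "lift X (\<lambda>x. 0) x \<le> lsqf f f x"
    unfolding lsqf_def using assms
    by (intro lift_mono_AE sqf_Linf sqf_nonneg_AE Linf_continuous) auto
  moreover have "lift X (\<lambda>x. 0) = (\<lambda>x. 0)" by (rule lift_continuous) auto
  ultimately show ?thesis by simp
qed

lemma lsqf_polarization:
  assumes f: "f \<in> core X" and g: "g \<in> core X"
  shows "(lsqf (\<lambda>y. f y + g y) (\<lambda>y. f y + g y) x - lsqf (\<lambda>y. f y - g y) (\<lambda>y. f y - g y) x) / 4 =
    lsqf f g x"
proof -
  note fg = core_add[OF f g] core_diff[OF f g]
  show ?thesis
    using lsqf_linear[OF f g fg(1), of 1 1 x] lsqf_linear[OF f g fg(2), of 1 "-1" x]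
      lsqf_linear'[OF f g f, of 1 1 x] lsqf_linear'[OF f g f, of 1 "-1" x]
      lsqf_linear'[OF f g g, of 1 1 x] lsqf_linear'[OF f g g, of 1 "-1" x] lsqf_sym[OF f g]
    by (simp add: field_simps)
qed

text \<open>The pointwise energy density at \<open>x\<close> of a function which is in the core up to a constant.\<close>

definition density :: "('x \<Rightarrow> real) \<Rightarrow> 'x \<Rightarrow> real" where
  "density w = lift X (sqfX X w)"

lemma density_eq:
  assumes w: "(\<lambda>x. w x - c) \<in> core X"
  shows "density w = lsqf (\<lambda>x. w x - c) (\<lambda>x. w x - c)"
  unfolding density_def lsqf_def by (intro lift_cong_AE sqfX_AE[OF w] sqf_Linf w)

lemma density_nonneg: "w \<in> core_const \<Longrightarrow> 0 \<le> density w x"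
  using density_eq lsqf_nonneg by (auto simp: core_const_def)

text \<open>The polarization of the quadratic form \<open>w \<mapsto> density w x\<close>.\<close>

definition density2 :: "('x \<Rightarrow> real) \<Rightarrow> ('x \<Rightarrow> real) \<Rightarrow> 'x \<Rightarrow> real" where
  "density2 v w x = (density (\<lambda>y. v y + w y) x - density (\<lambda>y. v y - w y) x) / 4"

lemma density2_eq:
  assumes v: "(\<lambda>x. v x - c) \<in> core X" and w: "(\<lambda>x. w x - d) \<in> core X"
  shows "density2 v w x = lsqf (\<lambda>x. v x - c) (\<lambda>x. w x - d) x"
proof -
  have eq: "(\<lambda>x. (v x + w x) - (c + d)) = (\<lambda>x. (v x - c) + (w x - d))"
    "(\<lambda>x. (v x - w x) - (c - d)) = (\<lambda>x. (v x - c) - (w x - d))"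
    by auto
  show ?thesis
    unfolding density2_def
    using density_eq[of "\<lambda>x. v x + w x" "c + d"] density_eq[of "\<lambda>x. v x - w x" "c - d"]
      core_add[OF v w] core_diff[OF v w] lsqf_polarization[OF v w]
    by (simp add: eq)
qed

lemma density2_same: "w \<in> core_const \<Longrightarrow> density2 w w x = density w x"
  using density2_eq density_eq by (auto simp: core_const_def)

lemma density2_sym:
  assumes "v \<in> core_const" "w \<in> core_const"
  shows "density2 v w x = density2 w v x"
proof -
  obtain c d where cd: "(\<lambda>x. v x - c) \<in> core X" "(\<lambda>x. w x - d) \<in> core X"
    using assms by (auto simp: core_const_def)
  show ?thesis
    unfolding density2_eq[OF cd] density2_eq[OF cd(2,1)] lsqf_sym[OF cd] ..
qed

lemma density2_linear:
  assumes "v \<in> core_const" "v' \<in> core_const" "w \<in> core_const"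
  shows "density2 (\<lambda>y. a * v y + b * v' y) w x = a * density2 v w x + b * density2 v' w x"
proof -
  obtain c c' d where cd: "(\<lambda>x. v x - c) \<in> core X" "(\<lambda>x. v' x - c') \<in> core X" "(\<lambda>x. w x - d) \<in> core X"
    using assms by (auto simp: core_const_def)
  have eq: "(\<lambda>x. a * (v x - c) + b * (v' x - c')) = (\<lambda>x. (a * v x + b * v' x) - (a * c + b * c'))"
    by (auto simp: algebra_simps)
  have "(\<lambda>x. (a * v x + b * v' x) - (a * c + b * c')) \<in> core X"
    using core_lincomb[OF cd(1,2), of a b] unfolding eq .
  from density2_eq[OF this cd(3)] show ?thesis
    using lsqf_linear[OF cd, of a b x] unfolding eq
    by (simp add: density2_eq[OF cd(1,3)] density2_eq[OF cd(2,3)])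
qed

lemma density_const: "density (\<lambda>z. c) x = 0"
proof -
  have "density (\<lambda>z. c) x = lsqf (\<lambda>x. 0) (\<lambda>x. 0) x"
    using density_eq[of "\<lambda>z. c" c] core_zero by simp
  also have "\<dots> = 0"
    using lsqf_linear[OF core_zero core_zero core_zero, of 0 0 x] by simp
  finally show ?thesis .
qed

lemma core_const_const: "(\<lambda>z. c) \<in> core_const"
  using core_zero by (auto simp: core_const_def intro!: exI[of _ c])

text \<open>The chain rule holds at every point, since the lifting is multiplicative and fixes
  continuous functions.\<close>

lemma density_chain:
  assumes \<phi>: "\<phi> \<in> Cb_smooth k" and f: "\<And>i. i < k \<Longrightarrow> f i \<in> core X"
  shows "(\<lambda>z. \<phi> (\<lambda>i. f i z)) \<in> core_const"
    and "density (\<lambda>z. \<phi> (\<lambda>i. f i z)) x =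
      (\<Sum>i<k. \<Sum>j<k. partial_deriv i \<phi> (\<lambda>i. f i x) * partial_deriv j \<phi> (\<lambda>j. f j x) *
        lsqf (f i) (f j) x)"
proof -
  let ?w = "\<lambda>z. \<phi> (\<lambda>i. f i z) - \<phi> (\<lambda>i. 0)"
  have w: "?w \<in> core X" using core_compose[OF \<phi> f] .
  then show "(\<lambda>z. \<phi> (\<lambda>i. f i z)) \<in> core_const" by (auto simp: core_const_def)
  let ?c = "\<lambda>i j x. partial_deriv i \<phi> (\<lambda>i. f i x) * partial_deriv j \<phi> (\<lambda>j. f j x)"
  obtain C where C: "\<And>i y. i < k \<Longrightarrow> \<bar>partial_deriv i \<phi> y\<bar> \<le> C" "0 \<le> C"
    using Cb_smooth_bounded[OF \<phi>] by metis
  have cont: "continuous_on UNIV (\<lambda>x. partial_deriv i \<phi> (\<lambda>i. f i x))" if "i < k" for i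
  proof -
    have "continuous_on UNIV (\<lambda>x j. if j < k then f j x else 0)"
    proof (rule continuous_on_coordinatewise_then_product)
      show "continuous_on UNIV (\<lambda>x. if j < k then f j x else 0)" for j
        using core_continuous[OF f, of j] by (cases "j < k") auto
    qed
    then have "continuous_on UNIV (\<lambda>x. partial_deriv i \<phi> (\<lambda>j. if j < k then f j x else 0))"
      by (rule continuous_on_compose2[OF Cb_smooth_continuous(2)[OF \<phi> that]]) auto
    moreover have "partial_deriv i \<phi> (\<lambda>j. if j < k then f j x else 0) = partial_deriv i \<phi> (\<lambda>j. f j x)" for x
      by (rule depends_onD[OF depends_on_partial_deriv[OF Cb_smoothD(1)[OF \<phi>]]]) simp
    ultimately show ?thesis by simp
  qed
  have c: "continuous_on UNIV (?c i j)" "bounded (range (?c i j))" if "i < k" "j < k" for i j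
  proof -
    show "continuous_on UNIV (?c i j)" using that cont by (intro continuous_intros)
    have "\<bar>?c i j x\<bar> \<le> C * C" for x
      unfolding abs_mult using that C by (intro mult_mono) auto
    then show "bounded (range (?c i j))" by (auto simp: bounded_iff)
  qed
  have Linf: "(\<lambda>x. ?c i j x * sqf X (f i) (f j) x) \<in> Linf_fun (meas X)" if "i < k" "j < k" for i j
    using that by (intro Linf_mult Linf_continuous sqf_Linf f c)
  have inner: "(\<lambda>x. \<Sum>j<k. ?c i j x * sqf X (f i) (f j) x) \<in> Linf_fun (meas X)"
    "lift X (\<lambda>x. \<Sum>j<k. ?c i j x * sqf X (f i) (f j) x) x =
      (\<Sum>j<k. lift X (\<lambda>x. ?c i j x * sqf X (f i) (f j) x) x)" if "i < k" for i
    using Linf_sum[of "{..<k}" "\<lambda>j x. ?c i j x * sqf X (f i) (f j) x" x] Linf[OF that] by auto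
  have outer: "(\<lambda>x. \<Sum>i<k. \<Sum>j<k. ?c i j x * sqf X (f i) (f j) x) \<in> Linf_fun (meas X)"
    "lift X (\<lambda>x. \<Sum>i<k. \<Sum>j<k. ?c i j x * sqf X (f i) (f j) x) x =
      (\<Sum>i<k. lift X (\<lambda>x. \<Sum>j<k. ?c i j x * sqf X (f i) (f j) x) x)"
    using Linf_sum[of "{..<k}" "\<lambda>i x. \<Sum>j<k. ?c i j x * sqf X (f i) (f j) x" x] inner(1) by auto
  have "density (\<lambda>z. \<phi> (\<lambda>i. f i z)) = lift X (\<lambda>x. \<Sum>i<k. \<Sum>j<k. ?c i j x * sqf X (f i) (f j) x)"
    unfolding density_eq[of "\<lambda>z. \<phi> (\<lambda>i. f i z)", OF w] lsqf_def
    by (intro lift_cong_AE sqf_Linf w outer(1) sqf_chain_AE \<phi> f)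
  then have "density (\<lambda>z. \<phi> (\<lambda>i. f i z)) x =
      (\<Sum>i<k. \<Sum>j<k. lift X (\<lambda>x. ?c i j x * sqf X (f i) (f j) x) x)"
    using outer(2) inner(2) by simp
  also have "\<dots> = (\<Sum>i<k. \<Sum>j<k. ?c i j x * lsqf (f i) (f j) x)"
  proof (intro sum.cong refl)
    fix i j assume ij: "i \<in> {..<k}" "j \<in> {..<k}"
    then have "lift X (\<lambda>x. ?c i j x * sqf X (f i) (f j) x) x = lift X (?c i j) x * lift X (sqf X (f i) (f j)) x"
      by (intro lift_mult Linf_continuous c sqf_Linf f) auto
    then show "lift X (\<lambda>x. ?c i j x * sqf X (f i) (f j) x) x = ?c i j x * lsqf (f i) (f j) x"
      using lift_continuous[OF c[of i j]] ij by (simp add: lsqf_def)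
  qed
  finally show "density (\<lambda>z. \<phi> (\<lambda>i. f i z)) x =
      (\<Sum>i<k. \<Sum>j<k. partial_deriv i \<phi> (\<lambda>i. f i x) * partial_deriv j \<phi> (\<lambda>j. f j x) *
        lsqf (f i) (f j) x)" .
qed

end

section \<open>Locally finite sequences\<close>

lemma idx_enat [simp]: "idx (enat n) = {..<n}" and idx_infinity [simp]: "idx \<infinity> = UNIV"
  by (auto simp: idx_def)

text \<open>The sum of \<open>g\<close> over the first \<open>N \<le> \<infinity>\<close> entries of a sequence.\<close>

definition psum :: "enat \<Rightarrow> ('x \<Rightarrow> real) \<Rightarrow> (nat \<Rightarrow> 'x) \<Rightarrow> real" where
  "psum N g x = (\<Sum>p. if enat p < N then g (x p) else 0)"

lemma psum_eq_sum:
  assumes "finite I" "\<And>p. enat p < N \<Longrightarrow> p \<notin> I \<Longrightarrow> g (x p) = 0"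
  shows "psum N g x = (\<Sum>p\<in>I. if enat p < N then g (x p) else 0)"
    "summable (\<lambda>p. if enat p < N then g (x p) else 0)"
  unfolding psum_def using assms
  by (auto intro!: suminf_finite summable_finite[of I])

context diffusion_space
begin

text \<open>\<open>lcf x\<close> says that the infinite sequence \<open>x\<close> has finitely many entries in each set of the
  localizing ring, that is, \<open>(\<infinity>, x) \<in> X_lcf_inf X\<close>.\<close>

definition lcf :: "(nat \<Rightarrow> 'x) \<Rightarrow> bool" where
  "lcf x \<longleftrightarrow> (\<forall>E\<in>lring X. finite {i. x i \<in> E})"

lemma X_lcf_inf_iff: "\<xi> \<in> X_lcf_inf X \<longleftrightarrow> fst \<xi> = \<infinity> \<and> lcf (snd \<xi>)"
  by (cases \<xi>) (auto simp: X_lcf_inf_def X_lcf_def lcf_def)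

lemma lcf_update: "lcf x \<Longrightarrow> lcf (x(p := z))"
  unfolding lcf_def
proof (intro ballI)
  fix E assume "\<forall>E\<in>lring X. finite {i. x i \<in> E}" "E \<in> lring X"
  then have "finite (insert p {i. x i \<in> E})" by auto
  then show "finite {i. (x(p := z)) i \<in> E}"
    by (rule rev_finite_subset) auto
qed

lemma truncated_lcf:
  assumes "lcf x"
  shows "(N, restrict x (idx N)) \<in> X_lcf X"
proof -
  have "finite {i \<in> idx N. restrict x (idx N) i \<in> E}" if "E \<in> lring X" for E
    using assms that by (auto simp: lcf_def intro: rev_finite_subset)
  then show ?thesis by (auto simp: X_lcf_def)
qed

text \<open>Bounds by a multiple of the indicator function of a set in the localizing ring.\<close>

definition ring_bounded :: "('x \<Rightarrow> real) \<Rightarrow> bool" where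
  "ring_bounded g \<longleftrightarrow> (\<exists>E\<in>lring X. \<exists>C\<ge>0. \<forall>x. \<bar>g x\<bar> \<le> C * indicator E x)"

lemma ring_bounded_support:
  assumes "ring_bounded g"
  obtains E where "E \<in> lring X" "\<And>x. x \<notin> E \<Longrightarrow> g x = 0"
  using assms unfolding ring_bounded_def by (metis abs_le_zero_iff indicator_simps(2) mult_zero_right)

lemma core_ring_bounded:
  assumes "f \<in> core X"
  shows "ring_bounded f"
proof -
  obtain E where E: "E \<in> lring X" "\<And>x. x \<notin> E \<Longrightarrow> f x = 0"
    using core_support[OF assms] by blast
  obtain C where C: "\<And>x. \<bar>f x\<bar> \<le> C"
    using core_bounded[OF assms] by (auto simp: bounded_iff)
  have "0 \<le> C" using C[of undefined] by linarith
  moreover have "\<bar>f x\<bar> \<le> C * indicator E x" for x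
    using C[of x] E(2)[of x] by (auto simp: indicator_def)
  ultimately show ?thesis using E(1) by (auto simp: ring_bounded_def)
qed

lemma lcf_finite_support:
  assumes "lcf x" "ring_bounded g"
  shows "finite {p. g (x p) \<noteq> 0}"
proof -
  obtain E where E: "E \<in> lring X" "\<And>x. x \<notin> E \<Longrightarrow> g x = 0"
    using ring_bounded_support[OF assms(2)] by blast
  then have "finite {p. x p \<in> E}" using assms(1) by (simp add: lcf_def)
  then show ?thesis by (rule rev_finite_subset) (use E in auto)
qed

lemma psum_summable:
  assumes "lcf x" "ring_bounded g"
  shows "summable (\<lambda>p. if enat p < N then g (x p) else 0)"
  by (rule psum_eq_sum(2)[OF lcf_finite_support[OF assms]]) auto

lemma psum_eventually_const:
  assumes "lcf x" "ring_bounded g"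
  shows "\<forall>\<^sub>F n in sequentially. psum (enat n) g x = psum \<infinity> g x"
proof -
  let ?I = "{p. g (x p) \<noteq> 0}"
  have I: "finite ?I" using lcf_finite_support[OF assms] .
  then obtain m where "?I \<subseteq> {..<m}" using finite_nat_set_iff_bounded by (auto simp: subset_eq)
  then have m: "p < m" if "g (x p) \<noteq> 0" for p using that by auto
  show ?thesis
    using eventually_ge_at_top[of m]
  proof eventually_elim
    case (elim n)
    then have "(\<Sum>p\<in>?I. if enat p < enat n then g (x p) else 0) = (\<Sum>p\<in>?I. if enat p < \<infinity> then g (x p) else 0)"
      using m by (intro sum.cong) force+
    then show ?case
      using psum_eq_sum(1)[OF I, of "enat n" g x] psum_eq_sum(1)[OF I, of \<infinity> g x] by simp
  qed
qed

lemma psum_update: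
  assumes "lcf x" "ring_bounded g"
  shows "psum N g (x(p := z)) = (if enat p < N then psum N g x - g (x p) + g z else psum N g x)"
proof (cases "enat p < N")
  case True
  let ?I = "insert p {p. g (x p) \<noteq> 0}"
  have I: "finite ?I" using lcf_finite_support[OF assms] by simp
  have "psum N g (x(p := z)) = (\<Sum>q\<in>?I. if enat q < N then g ((x(p := z)) q) else 0)"
    by (rule psum_eq_sum(1)[OF I]) auto
  also have "\<dots> = g z + (\<Sum>q\<in>?I - {p}. if enat q < N then g ((x(p := z)) q) else 0)"
    using I True by (subst sum.remove[of _ p]) auto
  also have "(\<Sum>q\<in>?I - {p}. if enat q < N then g ((x(p := z)) q) else 0) =
      (\<Sum>q\<in>?I - {p}. if enat q < N then g (x q) else 0)"
    by (intro sum.cong) auto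
  also have "\<dots> = (\<Sum>q\<in>?I. if enat q < N then g (x q) else 0) - g (x p)"
    using I True by (subst (2) sum.remove[of _ p]) auto
  also have "(\<Sum>q\<in>?I. if enat q < N then g (x q) else 0) = psum N g x"
    by (rule psum_eq_sum(1)[OF I, symmetric]) auto
  finally show ?thesis using True by (simp add: fun_upd_def)
next
  case False
  then have "(\<lambda>q. if enat q < N then g ((x(p := z)) q) else 0) = (\<lambda>q. if enat q < N then g (x q) else 0)"
    by auto
  then show ?thesis using False by (simp add: psum_def)
qed

lemma psum_abs_le:
  assumes "lcf x" "ring_bounded g"
  shows "\<bar>psum N g x\<bar> \<le> psum \<infinity> (\<lambda>y. \<bar>g y\<bar>) x"
proof -
  let ?I = "{p. g (x p) \<noteq> 0}"
  have I: "finite ?I" using lcf_finite_support[OF assms] .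
  have "psum N g x = (\<Sum>p\<in>?I. if enat p < N then g (x p) else 0)"
    by (rule psum_eq_sum(1)[OF I]) auto
  moreover have "psum \<infinity> (\<lambda>y. \<bar>g y\<bar>) x = (\<Sum>p\<in>?I. if enat p < \<infinity> then \<bar>g (x p)\<bar> else 0)"
    by (rule psum_eq_sum(1)[OF I]) auto
  moreover have "\<bar>\<Sum>p\<in>?I. if enat p < N then g (x p) else 0\<bar> \<le> (\<Sum>p\<in>?I. if enat p < \<infinity> then \<bar>g (x p)\<bar> else 0)"
    by (rule order_trans[OF sum_abs]) (auto intro!: sum_mono)
  ultimately show ?thesis by simp
qed

section \<open>Configurations\<close>

lemma sets_lab: "sets (lab X \<xi>) = sets (meas X)"
  by (simp add: lab_def)

lemma emeasure_lab:
  "A \<in> sets (meas X) \<Longrightarrow>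
    emeasure (lab X \<xi>) A = emeasure (count_space (idx (fst \<xi>))) {i \<in> idx (fst \<xi>). snd \<xi> i \<in> A}"
  unfolding lab_def by (subst emeasure_distr) (auto intro!: arg_cong2[where f=emeasure])

lemma lab_in_conf: "\<xi> \<in> X_lcf X \<Longrightarrow> lab X \<xi> \<in> conf X"
  unfolding conf_def X_lcf_def
  by (cases \<xi>) (auto intro!: exI simp: emeasure_lab[OF lring_sets] of_nat_less_top)

text \<open>Integrals over a truncated configuration are finite sums.\<close>

lemma integral_lab_truncated:
  assumes g: "g \<in> borel_measurable (meas X)" "ring_bounded g" and x: "lcf x"
  shows "(\<integral>y. g y \<partial>lab X (N, restrict x (idx N))) = psum N g x"
proof -
  let ?I = "{p. g (x p) \<noteq> 0}"
  have I: "finite ?I" using lcf_finite_support[OF x g(2)] .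
  have eq: "{p \<in> idx N. g (restrict x (idx N) p) \<noteq> 0} = {p \<in> ?I. enat p < N}"
    by (auto simp: idx_def)
  have "(\<integral>y. g y \<partial>lab X (N, restrict x (idx N))) = (\<integral>p. g (restrict x (idx N) p) \<partial>count_space (idx N))"
    unfolding lab_def fst_conv snd_conv by (rule integral_distr) (use g in auto)
  also have "\<dots> = (\<Sum>p | p \<in> idx N \<and> g (restrict x (idx N) p) \<noteq> 0. g (restrict x (idx N) p))"
    by (rule lebesgue_integral_count_space_finite_support) (use I in \<open>unfold eq, simp\<close>)
  also have "\<dots> = (\<Sum>p | p \<in> ?I \<and> enat p < N. g (x p))"
    unfolding eq by (intro sum.cong) (auto simp: idx_def)
  also have "\<dots> = (\<Sum>p\<in>?I. if enat p < N then g (x p) else 0)"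
    by (rule sum.inter_filter[OF I])
  also have "\<dots> = psum N g x"
    by (rule psum_eq_sum(1)[OF I, symmetric]) auto
  finally show ?thesis .
qed

lemma integral_lab:
  assumes g: "g \<in> borel_measurable (meas X)" "ring_bounded g" and x: "lcf x"
  shows "(\<integral>y. g y \<partial>lab X (\<infinity>, x)) = psum \<infinity> g x"
  using integral_lab_truncated[OF assms, of \<infinity>] by (simp add: restrict_def)

section \<open>Cylinder functions\<close>

text \<open>A representation \<open>u = F(f\<^sub>0\<^sup>\<star>, f\<^sub>1\<^sup>\<star>, \<dots>)\<close> of a cylinder function in which the functions beyond
  the \<open>k\<close>-th one, on which \<open>F\<close> does not depend, also belong to the core.\<close>

definition cyl_data :: "('x measure \<Rightarrow> real) \<Rightarrow> nat \<Rightarrow> ((nat \<Rightarrow> real) \<Rightarrow> real) \<Rightarrow> (nat \<Rightarrow> 'x \<Rightarrow> real) \<Rightarrow> bool"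
  where "cyl_data u k F f \<longleftrightarrow> F \<in> Cb_smooth k \<and> (\<forall>i. f i \<in> core X) \<and>
    (\<forall>\<gamma>\<in>conf X. u \<gamma> = F (\<lambda>i. \<integral>x. f i x \<partial>\<gamma>))"

lemma cyl_data_of_rep:
  assumes "cyl_rep X u (k, F, f)"
  shows "cyl_data u k F (\<lambda>i. if i < k then f i else (\<lambda>x. 0))"
proof -
  have F: "F \<in> Cb_smooth k" and f: "\<forall>i<k. f i \<in> core X"
    and u: "\<forall>\<gamma>\<in>conf X. u \<gamma> = F (\<lambda>i. \<integral>x. f i x \<partial>\<gamma>)"
    using assms by (auto simp: cyl_rep_def)
  have "F (\<lambda>i. \<integral>x. f i x \<partial>\<gamma>) = F (\<lambda>i. \<integral>x. (if i < k then f i else (\<lambda>x. 0)) x \<partial>\<gamma>)" for \<gamma> :: "'x measure"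
    by (rule depends_onD[OF Cb_smoothD(1)[OF F]]) simp
  then show ?thesis using F f u core_zero by (simp add: cyl_data_def)
qed

lemma cyl_rep_of_data: "cyl_data u k F f \<Longrightarrow> cyl_rep X u (k, F, f)"
  by (auto simp: cyl_data_def cyl_rep_def)

lemma cyl_iff: "u \<in> cyl X \<longleftrightarrow> (\<exists>k F f. cyl_data u k F f)"
proof
  assume "u \<in> cyl X"
  then obtain r where r: "cyl_rep X u r" by (auto simp: cyl_def)
  obtain k F f where "r = (k, F, f)" by (rule prod_cases3)
  with r show "\<exists>k F f. cyl_data u k F f" using cyl_data_of_rep by blast
next
  assume "\<exists>k F f. cyl_data u k F f"
  then obtain k F f where "cyl_data u k F f" by blast
  from cyl_rep_of_data[OF this] show "u \<in> cyl X" unfolding cyl_def by blast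
qed

text \<open>The representation of \<open>u\<close> chosen in the definition of \<open>conf_sqf\<close>.\<close>

lemma conf_sqf_eq:
  assumes "u \<in> cyl X"
  obtains k F f where "cyl_data u k F f"
    "\<And>\<gamma>. conf_sqf X u u \<gamma> = (\<Sum>i<k. \<Sum>j<k. partial_deriv i F (\<lambda>i. \<integral>x. f i x \<partial>\<gamma>) *
      partial_deriv j F (\<lambda>j. \<integral>x. f j x \<partial>\<gamma>) * (\<integral>x. lsqf (f i) (f j) x \<partial>\<gamma>))"
proof -
  obtain k F f where r: "(SOME r. cyl_rep X u r) = (k, F, f)"
    by (metis prod_cases3)
  have rep: "cyl_rep X u (k, F, f)"
    using assms someI_ex[of "cyl_rep X u"] by (simp add: cyl_def r)
  then have F: "F \<in> Cb_smooth k" by (simp add: cyl_rep_def)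
  let ?f = "\<lambda>i. if i < k then f i else (\<lambda>x. 0)"
  have dep: "partial_deriv i F (\<lambda>i. \<integral>x. ?f i x \<partial>\<gamma>) = partial_deriv i F (\<lambda>i. \<integral>x. f i x \<partial>\<gamma>)"
    for i and \<gamma> :: "'x measure"
    by (rule depends_onD[OF depends_on_partial_deriv[OF Cb_smoothD(1)[OF F]]]) simp
  show thesis
  proof (rule that)
    show "cyl_data u k F ?f" by (rule cyl_data_of_rep[OF rep])
    show "conf_sqf X u u \<gamma> = (\<Sum>i<k. \<Sum>j<k. partial_deriv i F (\<lambda>i. \<integral>x. ?f i x \<partial>\<gamma>) *
      partial_deriv j F (\<lambda>j. \<integral>x. ?f j x \<partial>\<gamma>) * (\<integral>x. lsqf (?f i) (?f j) x \<partial>\<gamma>))" for \<gamma>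
      unfolding conf_sqf_def r dep by (simp add: lsqf_def)
  qed
qed

lemma cyl_lincomb:
  assumes "u \<in> cyl X" "v \<in> cyl X"
  shows "(\<lambda>\<gamma>. a * u \<gamma> + b * v \<gamma>) \<in> cyl X"
proof -
  obtain k F f m G g where u: "cyl_data u k F f" and v: "cyl_data v m G g"
    using assms cyl_iff by blast
  have F: "F \<in> Cb_smooth (k + m)" and G: "(\<lambda>y. G (\<lambda>j. y (k + j))) \<in> Cb_smooth (k + m)"
    using u v by (auto simp: cyl_data_def intro: Cb_smooth_mono Cb_smooth_shift)
  let ?h = "\<lambda>i. if i < k then f i else g (i - k)"
  have "F (\<lambda>i. \<integral>x. f i x \<partial>\<gamma>) = F (\<lambda>i. \<integral>x. ?h i x \<partial>\<gamma>)" for \<gamma> :: "'x measure"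
    using u by (intro depends_onD[OF Cb_smoothD(1)[of F k]]) (auto simp: cyl_data_def)
  then have "cyl_data (\<lambda>\<gamma>. a * u \<gamma> + b * v \<gamma>) (k + m) (\<lambda>y. a * F y + b * G (\<lambda>j. y (k + j))) ?h"
    using u v Cb_smooth_lincomb[OF F G] by (simp add: cyl_data_def)
  then show ?thesis using cyl_iff by blast
qed

lemma cyl_add: "u \<in> cyl X \<Longrightarrow> v \<in> cyl X \<Longrightarrow> (\<lambda>\<gamma>. u \<gamma> + v \<gamma>) \<in> cyl X"
  and cyl_diff: "u \<in> cyl X \<Longrightarrow> v \<in> cyl X \<Longrightarrow> (\<lambda>\<gamma>. u \<gamma> - v \<gamma>) \<in> cyl X"
  using cyl_lincomb[of u v 1 1] cyl_lincomb[of u v 1 "-1"] by auto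

lemma cyl_zero: "(\<lambda>\<gamma>. 0) \<in> cyl X"
proof -
  have "(\<lambda>y. 0 * sin (0 * y 0)) \<in> Cb_smooth 1" by (rule Cb_smooth_sin)
  then have "cyl_data (\<lambda>\<gamma>. 0) 1 (\<lambda>y. 0) (\<lambda>i x. 0)"
    using core_zero by (simp add: cyl_data_def)
  then show ?thesis using cyl_iff by blast
qed

text \<open>The function of labelled points which evaluates \<open>u\<close> at the first \<open>N \<le> \<infinity>\<close> points.\<close>

definition cyl_seq :: "enat \<Rightarrow> ('x measure \<Rightarrow> real) \<Rightarrow> 'x cseq \<Rightarrow> real" where
  "cyl_seq N u = (case N of enat n \<Rightarrow> (u \<circ> lab X) \<circ> tr n | \<infinity> \<Rightarrow> u \<circ> lab X)"

lemma cyl_seq_enat: "cyl_seq (enat n) u = (u \<circ> lab X) \<circ> tr n"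
  and cyl_seq_infinity: "cyl_seq \<infinity> u = u \<circ> lab X"
  by (simp_all add: cyl_seq_def)

lemma cyl_seq_add: "(\<lambda>\<xi>. cyl_seq N u \<xi> + cyl_seq N v \<xi>) = cyl_seq N (\<lambda>\<gamma>. u \<gamma> + v \<gamma>)"
  and cyl_seq_diff: "(\<lambda>\<xi>. cyl_seq N u \<xi> - cyl_seq N v \<xi>) = cyl_seq N (\<lambda>\<gamma>. u \<gamma> - v \<gamma>)"
  and cyl_seq_lincomb: "(\<lambda>\<xi>. a * cyl_seq N u \<xi> + b * cyl_seq N v \<xi>) = cyl_seq N (\<lambda>\<gamma>. a * u \<gamma> + b * v \<gamma>)"
  by (cases N; simp add: cyl_seq_def fun_eq_iff)+

lemma cyl_seq_apply: "cyl_seq N u (\<infinity>, x) = u (lab X (N, restrict x (idx N)))"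
  by (cases N) (simp_all add: cyl_seq_def tr_def restrict_def)

lemma cyl_seq_eq:
  assumes u: "cyl_data u k F f" and x: "lcf x"
  shows "cyl_seq N u (\<infinity>, x) = F (\<lambda>i. psum N (f i) x)"
proof -
  have "u (lab X (N, restrict x (idx N))) = F (\<lambda>i. \<integral>y. f i y \<partial>lab X (N, restrict x (idx N)))"
    using u lab_in_conf[OF truncated_lcf[OF x]] by (simp add: cyl_data_def)
  also have "\<dots> = F (\<lambda>i. psum N (f i) x)"
    using u x integral_lab_truncated core_measurable core_ring_bounded by (simp add: cyl_data_def)
  finally show ?thesis by (simp add: cyl_seq_apply)
qed

lemma coord_section_cyl_seq:
  assumes u: "cyl_data u k F f" and x: "lcf x"
  shows "coord_section (cyl_seq N u) (\<infinity>, x) p z =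
    (if enat p < N then F (\<lambda>i. (psum N (f i) x - f i (x p)) + f i z) else F (\<lambda>i. psum N (f i) x))"
proof -
  have "ring_bounded (f i)" for i using u core_ring_bounded by (simp add: cyl_data_def)
  then show ?thesis
    using cyl_seq_eq[OF u lcf_update[OF x], of N p z] psum_update[OF x]
    by (simp add: coord_section_def)
qed

lemma seq_sqf_term_density: "seq_sqf_term X U \<xi> p = density (coord_section U \<xi> p) (snd \<xi> p)"
  by (simp add: seq_sqf_term_def density_def)

text \<open>
  For \<open>p < N\<close> the section at \<open>p\<close> is \<open>z \<mapsto> F(c + f(z))\<close>, where \<open>c\<close> collects the contributions of the other
  points, and at \<open>z = x\<^sub>p\<close> the argument \<open>c + f(z)\<close> is the full sum again. For \<open>p \<ge> N\<close> it is constant.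
\<close>

lemma cyl_seq_section:
  assumes u: "cyl_data u k F f" and x: "lcf x"
  shows "coord_section (cyl_seq N u) (\<infinity>, x) p \<in> core_const"
    and "seq_sqf_term X (cyl_seq N u) (\<infinity>, x) p =
      (if enat p < N then \<Sum>i<k. \<Sum>j<k. partial_deriv i F (\<lambda>i. psum N (f i) x) *
        partial_deriv j F (\<lambda>i. psum N (f i) x) * lsqf (f i) (f j) (x p) else 0)"
proof -
  let ?w = "coord_section (cyl_seq N u) (\<infinity>, x) p"
  have F: "F \<in> Cb_smooth k" and f: "\<And>i. f i \<in> core X" using u by (auto simp: cyl_data_def)
  have "?w \<in> core_const \<and> density ?w (x p) =
      (if enat p < N then \<Sum>i<k. \<Sum>j<k. partial_deriv i F (\<lambda>i. psum N (f i) x) *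
        partial_deriv j F (\<lambda>i. psum N (f i) x) * lsqf (f i) (f j) (x p) else 0)"
  proof (cases "enat p < N")
    case True
    let ?c = "\<lambda>i. psum N (f i) x - f i (x p)"
    let ?\<phi> = "\<lambda>y. F (\<lambda>i. ?c i + y i)"
    have w: "?w = (\<lambda>z. ?\<phi> (\<lambda>i. f i z))"
      using coord_section_cyl_seq[OF u x, of N p] True by auto
    have \<phi>: "?\<phi> \<in> Cb_smooth k" using Cb_smooth_translate[OF F] .
    have "partial_deriv i ?\<phi> (\<lambda>i. f i (x p)) = partial_deriv i F (\<lambda>i. psum N (f i) x)" for i
      using partial_deriv_translate[of i F ?c "\<lambda>i. f i (x p)"] by simp
    then show ?thesis
      using density_chain(1)[OF \<phi>, of f] density_chain(2)[OF \<phi>, of f "x p"] f True unfolding w by simp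
  next
    case False
    then have w: "?w = (\<lambda>z. F (\<lambda>i. psum N (f i) x))"
      using coord_section_cyl_seq[OF u x, of N p] by auto
    show ?thesis using False unfolding w by (simp add: density_const core_const_const)
  qed
  then show "?w \<in> core_const"
    and "seq_sqf_term X (cyl_seq N u) (\<infinity>, x) p =
      (if enat p < N then \<Sum>i<k. \<Sum>j<k. partial_deriv i F (\<lambda>i. psum N (f i) x) *
        partial_deriv j F (\<lambda>i. psum N (f i) x) * lsqf (f i) (f j) (x p) else 0)"
    by (simp_all add: seq_sqf_term_density)
qed

end

section \<open>Borel versions modulo null sets\<close>

lemma borel_measurable_completion_AE:
  fixes U V :: "'a \<Rightarrow> real"
  assumes V: "V \<in> borel_measurable M" and eq: "AE x in M. U x = V x"
  shows "U \<in> borel_measurable (completion M)"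
proof (rule measurableI)
  fix A :: "real set" assume A: "A \<in> sets borel"
  obtain N where N: "N \<in> null_sets M" "{x \<in> space M. U x \<noteq> V x} \<subseteq> N"
    using eq unfolding eventually_ae_filter by blast
  have "U -` A \<inter> space M = (V -` A \<inter> space M - N) \<union> (U -` A \<inter> space M \<inter> N)"
    using N(2) by auto
  moreover have "V -` A \<inter> space M - N \<in> sets M"
    using measurable_sets[OF V A] N(1) by auto
  ultimately have "U -` A \<inter> space M \<in> {S \<union> N |S N N'. S \<in> sets M \<and> N' \<in> null_sets M \<and> N \<subseteq> N'}"
    using N(1) by blast
  then show "U -` A \<inter> space (completion M) \<in> sets (completion M)"
    by (simp add: sets_completion)
qed simp

context diffusion_space
begin

lemma null_set_borel_cover:
  assumes A: "A \<in> null_sets (meas X)"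
  obtains N where "N \<in> sets borel" "N \<in> null_sets (meas X)" "A \<subseteq> N"
proof -
  let ?R = "restr_to_subalg (meas X) borel"
  have sub: "subalgebra (meas X) borel"
    using borel_subset_meas by (simp add: subalgebra_def)
  have "A \<in> sets (completion ?R)"
    using A local_structure by (auto simp: topological_local_structure_def null_sets_def)
  then obtain S N N' where S: "A = S \<union> N" "N \<subseteq> N'" "N' \<in> null_sets ?R" "S \<in> sets ?R"
    by (auto simp: sets_completion)
  have N': "N' \<in> null_sets (meas X)" "N' \<in> sets borel"
    using S(3) null_sets_restr_to_subalg[OF sub] sub
    by (auto simp: null_sets_def sets_restr_to_subalg[OF sub])
  have Sb: "S \<in> sets borel" "S \<in> sets (meas X)"
    using S(4) borel_subset_meas by (auto simp: sets_restr_to_subalg[OF sub])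
  have "S \<in> null_sets (meas X)"
    using null_sets_subset[OF A Sb(2)] S(1) by auto
  with N' Sb(1) S(1,2) show thesis
    by (intro that[of "S \<union> N'"]) auto
qed

lemma AE_borel_null:
  assumes "AE x in meas X. P x"
  obtains N where "N \<in> sets borel" "N \<in> null_sets (meas X)" "\<And>x. x \<notin> N \<Longrightarrow> P x"
proof -
  obtain A where A: "A \<in> null_sets (meas X)" "{x \<in> space (meas X). \<not> P x} \<subseteq> A"
    using assms unfolding eventually_ae_filter by blast
  obtain N where "N \<in> sets borel" "N \<in> null_sets (meas X)" "A \<subseteq> N"
    using null_set_borel_cover[OF A(1)] by blast
  with A(2) show thesis by (intro that[of N]) auto
qed

text \<open>
  A \<open>\<Sigma>\<close>-measurable function which is almost everywhere bounded by a multiple of the indicator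
  function of some \<open>E\<close> in the localizing ring agrees off a Borel null set with a Borel function
  which has such a bound everywhere.
\<close>

lemma ring_bounded_borel_version:
  assumes g: "g \<in> borel_measurable (meas X)" and E: "E \<in> lring X" "0 \<le> C"
    and bound: "AE x in meas X. \<bar>g x\<bar> \<le> C * indicator E x"
  obtains h N where "h \<in> borel_measurable borel" "ring_bounded h" "N \<in> sets borel"
    "N \<in> null_sets (meas X)" "\<And>x. x \<notin> N \<Longrightarrow> g x = h x"
proof -
  let ?R = "restr_to_subalg (meas X) borel"
  have sub: "subalgebra (meas X) borel"
    using borel_subset_meas by (simp add: subalgebra_def)
  have "g \<in> borel_measurable (completion ?R)"
  proof (rule measurableI)
    fix A :: "real set" assume "A \<in> sets borel"
    then have "g -` A \<inter> space (meas X) \<in> sets (meas X)" using g by (rule measurable_sets[rotated])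
    then show "g -` A \<inter> space (completion ?R) \<in> sets (completion ?R)"
      using local_structure by (auto simp: topological_local_structure_def space_restr_to_subalg)
  qed simp
  from completion_ex_borel_measurable_real[OF this]
  obtain g' where g': "g' \<in> borel_measurable ?R" "AE x in ?R. g x = g' x" by blast
  have "AE x in meas X. g x = g' x" by (rule AE_restr_to_subalg[OF sub g'(2)])
  with bound have "AE x in meas X. g x = g' x \<and> \<bar>g x\<bar> \<le> C * indicator E x"
    by eventually_elim simp
  from AE_borel_null[OF this] obtain N where N: "N \<in> sets borel" "N \<in> null_sets (meas X)"
    "\<And>x. x \<notin> N \<Longrightarrow> g x = g' x \<and> \<bar>g x\<bar> \<le> C * indicator E x" by blast
  define h where "h x = (if x \<in> N then 0 else g' x)" for x
  have "g' \<in> borel_measurable borel"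
    using g'(1) by (simp add: measurable_cong_sets[OF sets_restr_to_subalg[OF sub] refl])
  then have "h \<in> borel_measurable borel"
    unfolding h_def using N(1) by measurable
  moreover have "\<bar>h x\<bar> \<le> C * indicator E x" for x
    using N(3)[of x] E(2) by (auto simp: h_def)
  then have "ring_bounded h" using E by (auto simp: ring_bounded_def)
  ultimately show thesis using N by (intro that[of h N]) (auto simp: h_def)
qed

section \<open>The Borel structure of sequences\<close>

lemma space_cseq_borel: "space (cseq_borel :: 'x cseq measure) = (SIGMA N:UNIV. extensional (idx N))"
  and sets_cseq_borelI: "openin (product_topology (\<lambda>_. euclidean) (idx N)) V \<Longrightarrow>
    {N} \<times> V \<in> sets (cseq_borel :: 'x cseq measure)"
proof -
  have sub: "V \<subseteq> extensional (idx N)"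
    if "openin (product_topology (\<lambda>_. euclidean) (idx N)) V" for N and V :: "(nat \<Rightarrow> 'x) set"
    using openin_subset[OF that] by (auto simp: PiE_def)
  then have *: "{{N} \<times> V |N V. openin (product_topology (\<lambda>_. euclidean) (idx N)) V} \<subseteq>
      Pow (SIGMA N:UNIV. (extensional (idx N) :: (nat \<Rightarrow> 'x) set))"
    by blast
  show "space (cseq_borel :: 'x cseq measure) = (SIGMA N:UNIV. extensional (idx N))"
    unfolding cseq_borel_def by (rule space_measure_of[OF *])
  show "{N} \<times> V \<in> sets (cseq_borel :: 'x cseq measure)"
    if "openin (product_topology (\<lambda>_. euclidean) (idx N)) V"
    unfolding cseq_borel_def sets_measure_of[OF *] using that by (intro sigma_sets.Basic) blast
qed

lemma openin_coordinate:
  assumes "p \<in> I" "open U"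
  shows "openin (product_topology (\<lambda>_. euclidean) I) {x \<in> extensional I. x p \<in> U}"
proof -
  have "continuous_map (product_topology (\<lambda>_. euclidean) I) euclidean (\<lambda>x. x p)"
    using assms(1) by (rule continuous_map_product_projection)
  from openin_continuous_map_preimage[OF this, of U] assms(2)
  show ?thesis by (simp add: PiE_def)
qed

text \<open>The \<open>p\<close>-th entry of an infinite sequence; sequences of finite length play no role.\<close>

definition entry :: "nat \<Rightarrow> 'x cseq \<Rightarrow> 'x" where
  "entry p \<xi> = (if fst \<xi> = \<infinity> then snd \<xi> p else undefined)"

lemma infinite_sequences_measurable: "{\<xi> \<in> space cseq_borel. fst \<xi> = \<infinity>} \<in> sets (cseq_borel :: 'x cseq measure)"
proof -
  have "openin (product_topology (\<lambda>_. euclidean) (idx \<infinity>)) (UNIV :: (nat \<Rightarrow> 'x) set)"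
    using openin_topspace[of "product_topology (\<lambda>_. euclidean :: 'x topology) (idx \<infinity>)"] by simp
  from sets_cseq_borelI[OF this] have "{\<infinity>} \<times> UNIV \<in> sets (cseq_borel :: 'x cseq measure)" .
  also have "{\<infinity>} \<times> UNIV = {\<xi> \<in> space (cseq_borel :: 'x cseq measure). fst \<xi> = \<infinity>}"
    by (auto simp: space_cseq_borel)
  finally show ?thesis .
qed

lemma pred_infinite_sequences [measurable]: "Measurable.pred (cseq_borel :: 'x cseq measure) (\<lambda>\<xi>. fst \<xi> = \<infinity>)"
  using infinite_sequences_measurable by (simp add: pred_def)

lemma entry_measurable [measurable]: "entry p \<in> borel_measurable cseq_borel"
proof (rule borel_measurableI)
  fix U :: "'x set" assume U: "open U"
  have "{\<infinity>} \<times> {x \<in> extensional (idx \<infinity>). x p \<in> U} \<in> sets (cseq_borel :: 'x cseq measure)"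
    by (rule sets_cseq_borelI[OF openin_coordinate[OF _ U]]) simp
  moreover have "entry p -` U \<inter> space cseq_borel = {\<infinity>} \<times> {x \<in> extensional (idx \<infinity>). x p \<in> U} \<union>
      (if undefined \<in> U then space cseq_borel - {\<xi> \<in> space cseq_borel. fst \<xi> = \<infinity>} else {})"
    by (auto simp: space_cseq_borel entry_def split: if_splits)
  ultimately show "entry p -` U \<inter> space cseq_borel \<in> sets cseq_borel"
    using infinite_sequences_measurable by auto
qed

text \<open>All entries of an infinite sequence, as measurable functions of it.\<close>

definition entries :: "'x cseq \<Rightarrow> nat \<Rightarrow> 'x" where
  "entries \<xi> = (\<lambda>p. entry p \<xi>)"

lemma entries_eq: "fst \<xi> = \<infinity> \<Longrightarrow> entries \<xi> = snd \<xi>"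
  by (auto simp: entries_def entry_def)

lemma psum_measurable [measurable]:
  assumes [measurable]: "h \<in> borel_measurable borel"
  shows "(\<lambda>\<xi>. psum N h (entries \<xi>)) \<in> borel_measurable cseq_borel"
  unfolding psum_def entries_def by measurable

lemma pow_borel_coordinate:
  assumes "p < n" "A \<in> sets (borel :: 'x measure)"
  shows "{x \<in> extensional (idx (enat n)). x p \<in> A} \<in> sets (pow_borel (enat n))"
proof -
  let ?G = "{V. openin (product_topology (\<lambda>_. euclidean :: 'x topology) (idx (enat n))) V}"
  have *: "?G \<subseteq> Pow (extensional (idx (enat n)))"
    using openin_subset by (fastforce simp: PiE_def)
  have sp: "space (pow_borel (enat n) :: (nat \<Rightarrow> 'x) measure) = extensional (idx (enat n))"
    unfolding pow_borel_def by (rule space_measure_of[OF *])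
  have "(\<lambda>x. x p) \<in> borel_measurable (pow_borel (enat n) :: (nat \<Rightarrow> 'x) measure)"
  proof (rule borel_measurableI)
    fix U :: "'x set" assume U: "open U"
    have "{x \<in> extensional (idx (enat n)). x p \<in> U} \<in> sets (pow_borel (enat n))"
      unfolding pow_borel_def sets_measure_of[OF *]
      using openin_coordinate[OF _ U, of p "idx (enat n)"] assms(1) by (intro sigma_sets.Basic) simp
    also have "{x \<in> extensional (idx (enat n)). x p \<in> U} = (\<lambda>x. x p) -` U \<inter> space (pow_borel (enat n))"
      by (auto simp: sp)
    finally show "(\<lambda>x. x p) -` U \<inter> space (pow_borel (enat n)) \<in> sets (pow_borel (enat n))" .
  qed
  from measurable_sets[OF this assms(2)] show ?thesis
    by (simp add: sp vimage_def Int_def conj_commute)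
qed

lemma PiM_coordinate_null:
  assumes "p < n" "A \<in> null_sets (meas X)"
  shows "{x \<in> extensional (idx (enat n)). x p \<in> A} \<in> null_sets (PiM (idx (enat n)) (\<lambda>_. meas X))"
proof -
  interpret product_sigma_finite "\<lambda>_::nat. meas X"
    using local_structure by (simp add: product_sigma_finite_def topological_local_structure_def)
  let ?B = "\<lambda>i. if i = p then A else UNIV"
  have A: "A \<in> sets (meas X)" "emeasure (meas X) A = 0" using assms(2) by auto
  have UNIV: "UNIV \<in> sets (meas X)" using sets.top[of "meas X"] by simp
  have eq: "{x \<in> extensional (idx (enat n)). x p \<in> A} = PiE (idx (enat n)) ?B"
    using assms(1) by (auto simp: PiE_def Pi_def)
  have B: "\<And>i. ?B i \<in> sets (meas X)" using A UNIV by auto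
  have "emeasure (PiM (idx (enat n)) (\<lambda>_. meas X)) (PiE (idx (enat n)) ?B) = (\<Prod>i\<in>idx (enat n). emeasure (meas X) (?B i))"
    by (rule emeasure_PiM) (use B in auto)
  also have "\<dots> = 0"
    using assms(1) A(2) by (intro prod_zero) (auto intro!: bexI[of _ p])
  finally have "emeasure (PiM (idx (enat n)) (\<lambda>_. meas X)) (PiE (idx (enat n)) ?B) = 0" .
  moreover have "PiE (idx (enat n)) ?B \<in> sets (PiM (idx (enat n)) (\<lambda>_. meas X))"
    by (rule sets_PiM_I_finite) (use B in auto)
  ultimately show ?thesis unfolding eq by auto
qed

end

section \<open>Laws of labelled configurations\<close>

text \<open>
  A probability measure on the configurations which charges only infinite ones, is marginally
  absolutely continuous and satisfies the closability assumption.
\<close>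

locale configuration_space = diffusion_space X for X :: "('x::t2_space) local_space" +
  fixes \<mu> :: "'x measure measure"
  assumes prob: "prob_space \<mu>" and space_mu: "space \<mu> = conf X"
    and sets_mu: "sets \<mu> = sets (conf_algebra X)"
    and infinite_mu: "AE \<gamma> in \<mu>. emeasure \<gamma> UNIV = \<infinity>"
    and mac: "marginally_ac X \<mu>"
    and closability: "closability_assumption X \<mu>"
begin

lemma labeling_measurable: "labeling X \<mu> l \<Longrightarrow> l \<in> completion \<mu> \<rightarrow>\<^sub>M cseq_borel"
  and labeling_conf: "labeling X \<mu> l \<Longrightarrow> \<gamma> \<in> conf X \<Longrightarrow> l \<gamma> \<in> X_lcf X"
  and lab_labeling: "labeling X \<mu> l \<Longrightarrow> \<gamma> \<in> conf X \<Longrightarrow> lab X (l \<gamma>) = \<gamma>"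
  by (auto simp: labeling_def)

lemma labeling_infinite:
  assumes l: "labeling X \<mu> l" and "\<gamma> \<in> conf X" "emeasure \<gamma> UNIV = \<infinity>"
  shows "l \<gamma> \<in> X_lcf_inf X"
proof -
  have "emeasure (lab X (l \<gamma>)) UNIV = emeasure (count_space (idx (fst (l \<gamma>)))) (idx (fst (l \<gamma>)))"
    using sets.top[of "meas X"] by (subst emeasure_lab) auto
  then have "infinite (idx (fst (l \<gamma>)))"
    using assms lab_labeling[OF l] by (auto simp: emeasure_count_space)
  then have "fst (l \<gamma>) = \<infinity>" by (cases "fst (l \<gamma>)") auto
  then show ?thesis using labeling_conf[OF l] assms(2) by (simp add: X_lcf_inf_def)
qed

lemma AE_labeling_infinite:
  assumes l: "labeling X \<mu> l"
  shows "AE \<gamma> in \<mu>. l \<gamma> \<in> X_lcf_inf X"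
  using infinite_mu AE_space by eventually_elim (use labeling_infinite[OF l] space_mu in auto)

text \<open>Here marginal absolute continuity enters: no labelled point lies in a given Borel null set.\<close>

lemma AE_labeling_avoids:
  assumes l: "labeling X \<mu> l" and N: "N \<in> sets borel" "N \<in> null_sets (meas X)"
  shows "AE \<gamma> in \<mu>. \<forall>p. snd (l \<gamma>) p \<notin> N"
  unfolding AE_all_countable
proof
  fix p
  let ?n = "Suc p"
  let ?A = "{x \<in> extensional (idx (enat ?n)). x p \<in> N}"
  have "{\<gamma> \<in> space \<mu>. of_nat ?n \<le> emeasure \<gamma> UNIV \<and> snd (tr ?n (l \<gamma>)) \<in> ?A} \<in> null_sets (completion \<mu>)"
    using mac l pow_borel_coordinate[of p ?n N] PiM_coordinate_null[of p ?n N] N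
    unfolding marginally_ac_def by blast
  from AE_not_in[OF this]
  have "AE \<gamma> in \<mu>. \<gamma> \<notin> {\<gamma> \<in> space \<mu>. of_nat ?n \<le> emeasure \<gamma> UNIV \<and> snd (tr ?n (l \<gamma>)) \<in> ?A}"
    unfolding AE_completion_iff .
  with infinite_mu AE_space AE_labeling_infinite[OF l]
  show "AE \<gamma> in \<mu>. snd (l \<gamma>) p \<notin> N"
    by eventually_elim (auto simp: X_lcf_inf_iff tr_def)
qed

text \<open>
  The law \<open>labelled_law \<mu> l\<close> is carried by the infinite, locally finite sequences avoiding a given
  Borel null set. The sets of an exhaustion by the localizing ring need not be Borel; they are
  replaced by Borel sets which differ from them by null sets.
\<close>

lemma AE_labelled_law:
  assumes l: "labeling X \<mu> l" and N: "N \<in> sets borel" "N \<in> null_sets (meas X)"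
  shows "AE \<xi> in labelled_law \<mu> l. \<xi> \<in> X_lcf_inf X \<and> (\<forall>p. snd \<xi> p \<notin> N)"
proof -
  obtain E :: "nat \<Rightarrow> 'x set" where E: "\<And>h. E h \<in> lring X" "\<And>A. A \<in> lring X \<Longrightarrow> \<exists>h. A \<subseteq> E h"
    using lring_exhaustion by metis
  have "\<exists>g N. g \<in> borel_measurable borel \<and> ring_bounded g \<and> N \<in> sets borel \<and>
      N \<in> null_sets (meas X) \<and> (\<forall>x. x \<notin> N \<longrightarrow> indicator (E h) x = (g x :: real))" for h
    by (rule ring_bounded_borel_version[of "indicator (E h)" "E h" 1])
      (use E(1) lring_sets in auto)
  then obtain g M where g: "\<And>h. g h \<in> borel_measurable borel" "\<And>h. ring_bounded (g h)"
    and M: "\<And>h. M h \<in> sets borel" "\<And>h. M h \<in> null_sets (meas X)"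
    and gM: "\<And>h x. x \<notin> M h \<Longrightarrow> indicator (E h) x = (g h x :: real)"
    by metis
  note g(1)[measurable]
  define N' where "N' = N \<union> (\<Union>h. M h)"
  have N': "N' \<in> sets borel" "N' \<in> null_sets (meas X)"
    using N M by (auto simp: N'_def)
  note N'(1)[measurable]
  define P where "P \<xi> \<longleftrightarrow> fst \<xi> = \<infinity> \<and> (\<forall>p. entry p \<xi> \<notin> N') \<and>
    (\<forall>h. \<exists>m. \<forall>p. g h (entry p \<xi>) \<noteq> 0 \<longrightarrow> p < m)" for \<xi>
  have P_meas: "{\<xi> \<in> space cseq_borel. P \<xi>} \<in> sets cseq_borel"
    unfolding P_def by measurable
  have imp: "\<xi> \<in> X_lcf_inf X \<and> (\<forall>p. snd \<xi> p \<notin> N)" if P: "P \<xi>" for \<xi>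
  proof -
    have inf: "fst \<xi> = \<infinity>" using P by (simp add: P_def)
    have avoid: "snd \<xi> p \<notin> N'" for p
      using P inf by (simp add: P_def entry_def)
    have "finite {i. snd \<xi> i \<in> A}" if A: "A \<in> lring X" for A
    proof -
      obtain h where h: "A \<subseteq> E h" using E(2)[OF A] by blast
      obtain m where m: "\<And>p. g h (entry p \<xi>) \<noteq> 0 \<Longrightarrow> p < m"
        using P unfolding P_def by blast
      have "i < m" if "snd \<xi> i \<in> A" for i
      proof (rule m)
        have "snd \<xi> i \<notin> M h" using avoid[of i] by (auto simp: N'_def)
        from gM[OF this] show "g h (entry i \<xi>) \<noteq> 0"
          using that h inf by (auto simp: entry_def)
      qed
      then have "{i. snd \<xi> i \<in> A} \<subseteq> {..<m}" by auto
      then show ?thesis by (rule finite_subset) simp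
    qed
    then have "\<xi> \<in> X_lcf_inf X" using inf by (simp add: X_lcf_inf_iff lcf_def)
    then show ?thesis using avoid by (auto simp: N'_def)
  qed
  have "AE \<gamma> in \<mu>. P (l \<gamma>)"
    using AE_labeling_infinite[OF l] AE_labeling_avoids[OF l N']
  proof eventually_elim
    case (elim \<gamma>)
    then have inf: "fst (l \<gamma>) = \<infinity>" and "lcf (snd (l \<gamma>))" by (auto simp: X_lcf_inf_iff)
    then have "finite {p. g h (snd (l \<gamma>) p) \<noteq> 0}" for h using lcf_finite_support g(2) by blast
    then have "\<exists>m. \<forall>p. g h (snd (l \<gamma>) p) \<noteq> 0 \<longrightarrow> p < m" for h
      using finite_nat_set_iff_bounded[of "{p. g h (snd (l \<gamma>) p) \<noteq> 0}"] by auto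
    then show ?case using elim inf by (simp add: P_def entry_def)
  qed
  then have "AE \<xi> in distr (completion \<mu>) cseq_borel l. P \<xi>"
    using AE_distr_iff[OF labeling_measurable[OF l] P_meas] by (simp add: AE_completion_iff)
  then show ?thesis
    unfolding labelled_law_def AE_completion_iff by eventually_elim (rule imp)
qed

lemma prob_labelled_law: "labeling X \<mu> l \<Longrightarrow> prob_space (labelled_law \<mu> l)"
proof -
  assume l: "labeling X \<mu> l"
  interpret mu: prob_space \<mu> by (rule prob)
  interpret cmu: prob_space "completion \<mu>" by (rule prob_space.prob_space_completion[OF prob])
  show "prob_space (labelled_law \<mu> l)"
    unfolding labelled_law_def
    by (intro prob_space.prob_space_completion cmu.prob_space_distr labeling_measurable l)
qed

lemma measurable_labelled_law:
  "V \<in> borel_measurable cseq_borel \<Longrightarrow> V \<in> borel_measurable (labelled_law \<mu> l)"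
  unfolding labelled_law_def by (intro measurable_completion) simp

lemma measurable_labelled_law_AE:
  fixes U V :: "'x cseq \<Rightarrow> real"
  assumes "V \<in> borel_measurable cseq_borel" "AE \<xi> in labelled_law \<mu> l. U \<xi> = V \<xi>"
  shows "U \<in> borel_measurable (labelled_law \<mu> l)"
  using assms unfolding labelled_law_def AE_completion_iff
  by (intro borel_measurable_completion_AE) auto

lemma integral_labelled_law:
  fixes V :: "'x cseq \<Rightarrow> real"
  assumes l: "labeling X \<mu> l" and V: "V \<in> borel_measurable cseq_borel"
    and u: "u \<in> borel_measurable \<mu>" "AE \<gamma> in \<mu>. V (l \<gamma>) = u \<gamma>"
  shows "(\<integral>\<xi>. V \<xi> \<partial>labelled_law \<mu> l) = (\<integral>\<gamma>. u \<gamma> \<partial>\<mu>)"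
    and "integrable (labelled_law \<mu> l) V \<longleftrightarrow> integrable \<mu> u"
proof -
  have V': "V \<in> borel_measurable (distr (completion \<mu>) cseq_borel l)" using V by simp
  have Vl: "(\<lambda>\<gamma>. V (l \<gamma>)) \<in> borel_measurable (completion \<mu>)"
    using V labeling_measurable[OF l] by measurable
  have u': "u \<in> borel_measurable (completion \<mu>)" using u(1) by (rule measurable_completion)
  have ae: "AE \<gamma> in completion \<mu>. V (l \<gamma>) = u \<gamma>" using u(2) by (simp add: AE_completion_iff)
  have "(\<integral>\<xi>. V \<xi> \<partial>labelled_law \<mu> l) = (\<integral>\<gamma>. V (l \<gamma>) \<partial>completion \<mu>)"
    unfolding labelled_law_def integral_completion[OF V']
    using labeling_measurable[OF l] V by (rule integral_distr)
  also have "\<dots> = (\<integral>\<gamma>. u \<gamma> \<partial>completion \<mu>)" by (rule integral_cong_AE[OF Vl u' ae])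
  also have "\<dots> = (\<integral>\<gamma>. u \<gamma> \<partial>\<mu>)" by (rule integral_completion[OF u(1)])
  finally show "(\<integral>\<xi>. V \<xi> \<partial>labelled_law \<mu> l) = (\<integral>\<gamma>. u \<gamma> \<partial>\<mu>)" .
  have "integrable (labelled_law \<mu> l) V \<longleftrightarrow> integrable (completion \<mu>) (\<lambda>\<gamma>. V (l \<gamma>))"
    unfolding labelled_law_def integrable_completion[OF V']
    using labeling_measurable[OF l] V by (rule integrable_distr_eq)
  also have "\<dots> \<longleftrightarrow> integrable (completion \<mu>) u" by (rule integrable_cong_AE[OF Vl u' ae])
  also have "\<dots> \<longleftrightarrow> integrable \<mu> u" by (rule integrable_completion[OF u(1)])
  finally show "integrable (labelled_law \<mu> l) V \<longleftrightarrow> integrable \<mu> u" .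
qed


section \<open>Integration against configurations\<close>

lemma conf_sets: "\<gamma> \<in> conf X \<Longrightarrow> sets \<gamma> = sets (meas X)"
  by (auto simp: conf_def sets_lab)

lemma emeasure_ring_measurable:
  assumes E: "E \<in> lring X"
  shows "(\<lambda>\<gamma>. emeasure \<gamma> E) \<in> borel_measurable \<mu>"
proof (rule measurableI)
  fix B :: "ennreal set" assume B: "B \<in> sets borel"
  let ?G = "{(\<lambda>\<gamma>. emeasure \<gamma> E) -` B \<inter> conf X |E B. E \<in> lring X \<and> B \<in> sets borel}"
  have "?G \<subseteq> Pow (conf X)" by blast
  then have "sets \<mu> = sigma_sets (conf X) ?G"
    unfolding sets_mu conf_algebra_def by (rule sets_measure_of)
  moreover have "(\<lambda>\<gamma>. emeasure \<gamma> E) -` B \<inter> conf X \<in> ?G" using E B by blast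
  ultimately show "(\<lambda>\<gamma>. emeasure \<gamma> E) -` B \<inter> space \<mu> \<in> sets \<mu>"
    unfolding space_mu by (simp add: sigma_sets.Basic)
qed simp

lemma emeasure_measurable:
  assumes A: "A \<in> sets (meas X)"
  shows "(\<lambda>\<gamma>. emeasure \<gamma> A) \<in> borel_measurable \<mu>"
proof -
  have "\<exists>E::nat \<Rightarrow> 'x set. incseq E \<and> (\<Union>h. E h) = UNIV \<and> (\<forall>h. E h \<in> lring X)"
  proof (rule lring_exhaustion)
    fix E :: "nat \<Rightarrow> 'x set" assume "incseq E" "(\<Union>h. E h) = UNIV" "\<And>h. E h \<in> lring X"
    then show ?thesis by (intro exI[of _ E]) simp
  qed
  then obtain E :: "nat \<Rightarrow> 'x set" where E: "incseq E" "(\<Union>h. E h) = UNIV" "\<And>h. E h \<in> lring X"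
    by (elim exE conjE) simp
  have "emeasure \<gamma> A = (SUP h. emeasure \<gamma> (A \<inter> E h))" if "\<gamma> \<in> space \<mu>" for \<gamma>
  proof -
    have "range (\<lambda>h. A \<inter> E h) \<subseteq> sets \<gamma>"
      using that A E(3) lring_sets by (auto simp: space_mu conf_sets)
    moreover have "incseq (\<lambda>h. A \<inter> E h)" using E(1) by (auto simp: incseq_def)
    ultimately have "(SUP h. emeasure \<gamma> (A \<inter> E h)) = emeasure \<gamma> (\<Union>h. A \<inter> E h)"
      by (rule SUP_emeasure_incseq)
    also have "(\<Union>h. A \<inter> E h) = A" using E(2) by auto
    finally show ?thesis by simp
  qed
  moreover have "(\<lambda>\<gamma>. SUP h. emeasure \<gamma> (A \<inter> E h)) \<in> borel_measurable \<mu>"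
    using emeasure_ring_measurable[OF lring_Int[OF A E(3)]] by measurable
  ultimately show ?thesis by (simp cong: measurable_cong)
qed

lemma measurable_conf:
  "\<gamma> \<in> space \<mu> \<Longrightarrow> g \<in> borel_measurable (meas X) \<Longrightarrow> g \<in> borel_measurable \<gamma>"
  using measurable_cong_sets[OF conf_sets[of \<gamma>] refl] by (auto simp: space_mu)

lemma nn_integral_conf_measurable:
  fixes g :: "'x \<Rightarrow> ennreal"
  assumes "g \<in> borel_measurable (meas X)"
  shows "(\<lambda>\<gamma>. \<integral>\<^sup>+x. g x \<partial>\<gamma>) \<in> borel_measurable \<mu>"
  using assms
proof (induction rule: borel_measurable_induct)
  case (cong f g)
  then have "f = g" by auto
  with cong show ?case by simp
next
  case (set A)
  have "(\<integral>\<^sup>+x. indicator A x \<partial>\<gamma>) = emeasure \<gamma> A" if "\<gamma> \<in> space \<mu>" for \<gamma>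
    using that set by (intro nn_integral_indicator) (simp add: space_mu conf_sets)
  then show ?case using emeasure_measurable[OF set] by (simp cong: measurable_cong)
next
  case (mult u c)
  have "(\<integral>\<^sup>+x. c * u x \<partial>\<gamma>) = c * (\<integral>\<^sup>+x. u x \<partial>\<gamma>)" if "\<gamma> \<in> space \<mu>" for \<gamma>
    using measurable_conf[OF that mult(2)] by (rule nn_integral_cmult)
  then show ?case using mult(4) by (simp cong: measurable_cong)
next
  case (add u v)
  have "(\<integral>\<^sup>+x. v x + u x \<partial>\<gamma>) = (\<integral>\<^sup>+x. v x \<partial>\<gamma>) + (\<integral>\<^sup>+x. u x \<partial>\<gamma>)" if "\<gamma> \<in> space \<mu>" for \<gamma>
    using measurable_conf[OF that] add by (intro nn_integral_add)
  then show ?case using add by (simp cong: measurable_cong)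
next
  case (seq U)
  have "(\<integral>\<^sup>+x. (SUP i. U i) x \<partial>\<gamma>) = (SUP i. \<integral>\<^sup>+x. U i x \<partial>\<gamma>)" if "\<gamma> \<in> space \<mu>" for \<gamma>
    using measurable_conf[OF that] seq unfolding SUP_apply
    by (intro nn_integral_monotone_convergence_SUP) auto
  moreover have "(\<lambda>\<gamma>. SUP i. \<integral>\<^sup>+x. U i x \<partial>\<gamma>) \<in> borel_measurable \<mu>"
    using seq by (intro borel_measurable_SUP) auto
  ultimately show ?case by (subst measurable_cong) assumption+
qed

text \<open>The Bochner integral is \<open>0\<close> at the configurations for which \<open>g\<close> is not integrable.\<close>

lemma integral_conf_measurable:
  fixes g :: "'x \<Rightarrow> real"
  assumes g: "g \<in> borel_measurable (meas X)"
  shows "(\<lambda>\<gamma>. \<integral>x. g x \<partial>\<gamma>) \<in> borel_measurable \<mu>"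
proof -
  have "(\<integral>x. g x \<partial>\<gamma>) = (if (\<integral>\<^sup>+x. ennreal \<bar>g x\<bar> \<partial>\<gamma>) < \<infinity>
      then enn2real (\<integral>\<^sup>+x. ennreal (g x) \<partial>\<gamma>) - enn2real (\<integral>\<^sup>+x. ennreal (- g x) \<partial>\<gamma>) else 0)"
    if "\<gamma> \<in> space \<mu>" for \<gamma>
  proof -
    have "integrable \<gamma> g \<longleftrightarrow> (\<integral>\<^sup>+x. ennreal \<bar>g x\<bar> \<partial>\<gamma>) < \<infinity>"
      using measurable_conf[OF that g] by (simp add: integrable_iff_bounded)
    then show ?thesis
      using real_lebesgue_integral_def[of \<gamma> g] not_integrable_integral_eq[of \<gamma> g] by auto
  qed
  moreover have [measurable]: "(\<lambda>\<gamma>. \<integral>\<^sup>+x. ennreal \<bar>g x\<bar> \<partial>\<gamma>) \<in> borel_measurable \<mu>"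
    "(\<lambda>\<gamma>. \<integral>\<^sup>+x. ennreal (g x) \<partial>\<gamma>) \<in> borel_measurable \<mu>"
    "(\<lambda>\<gamma>. \<integral>\<^sup>+x. ennreal (- g x) \<partial>\<gamma>) \<in> borel_measurable \<mu>"
    using g by (auto intro!: nn_integral_conf_measurable)
  have "(\<lambda>\<gamma>. if (\<integral>\<^sup>+x. ennreal \<bar>g x\<bar> \<partial>\<gamma>) < \<infinity>
      then enn2real (\<integral>\<^sup>+x. ennreal (g x) \<partial>\<gamma>) - enn2real (\<integral>\<^sup>+x. ennreal (- g x) \<partial>\<gamma>) else 0)
    \<in> borel_measurable \<mu>"
    by measurable
  ultimately show ?thesis by (simp cong: measurable_cong)
qed

lemma integral_conf_integrable:
  assumes g: "g \<in> borel_measurable (meas X)" "ring_bounded g"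
  shows "integrable \<mu> (\<lambda>\<gamma>. \<integral>x. g x \<partial>\<gamma>)"
proof (rule integrableI_bounded)
  show "(\<lambda>\<gamma>. \<integral>x. g x \<partial>\<gamma>) \<in> borel_measurable \<mu>" by (rule integral_conf_measurable[OF g(1)])
  obtain E C where E: "E \<in> lring X" "0 \<le> C" "\<And>x. \<bar>g x\<bar> \<le> C * indicator E x"
    using g(2) by (auto simp: ring_bounded_def)
  have "ennreal (norm (\<integral>x. g x \<partial>\<gamma>)) \<le> ennreal C * emeasure \<gamma> E" if "\<gamma> \<in> space \<mu>" for \<gamma>
  proof -
    have "ennreal (norm (\<integral>x. g x \<partial>\<gamma>)) \<le> (\<integral>\<^sup>+x. ennreal (norm (g x)) \<partial>\<gamma>)"
      using integral_norm_bound_ennreal[of \<gamma> g] not_integrable_integral_eq[of \<gamma> g]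
      by (cases "integrable \<gamma> g") auto
    also have "\<dots> \<le> (\<integral>\<^sup>+x. ennreal C * indicator E x \<partial>\<gamma>)"
    proof (rule nn_integral_mono)
      fix x
      have "ennreal (norm (g x)) \<le> ennreal (C * indicator E x)"
        using E(3)[of x] by (intro ennreal_leI) simp
      then show "ennreal (norm (g x)) \<le> ennreal C * indicator E x"
        using E(2) by (simp add: ennreal_mult' ennreal_indicator)
    qed
    also have "\<dots> = ennreal C * emeasure \<gamma> E"
      using that lring_sets[OF E(1)] by (intro nn_integral_cmult_indicator) (simp add: space_mu conf_sets)
    finally show ?thesis .
  qed
  then have "(\<integral>\<^sup>+\<gamma>. ennreal (norm (\<integral>x. g x \<partial>\<gamma>)) \<partial>\<mu>) \<le> (\<integral>\<^sup>+\<gamma>. ennreal C * emeasure \<gamma> E \<partial>\<mu>)"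
    by (rule nn_integral_mono)
  also have "\<dots> = ennreal C * (\<integral>\<^sup>+\<gamma>. emeasure \<gamma> E \<partial>\<mu>)"
    by (rule nn_integral_cmult[OF emeasure_ring_measurable[OF E(1)]])
  also have "\<dots> < \<infinity>"
    using closability E(1) by (auto simp: closability_assumption_def ennreal_mult_less_top)
  finally show "(\<integral>\<^sup>+\<gamma>. ennreal (norm (\<integral>x. g x \<partial>\<gamma>)) \<partial>\<mu>) < \<infinity>" .
qed

lemma integral_lab_cong:
  assumes "g \<in> borel_measurable (meas X)" "h \<in> borel_measurable (meas X)"
    and "\<And>p. g (snd \<xi> p) = (h (snd \<xi> p) :: real)"
  shows "(\<integral>y. g y \<partial>lab X \<xi>) = (\<integral>y. h y \<partial>lab X \<xi>)"
  using assms unfolding lab_def by (subst (1 2) integral_distr) auto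

lemma borel_meas: "h \<in> borel_measurable borel \<Longrightarrow> (h :: 'x \<Rightarrow> real) \<in> borel_measurable (meas X)"
  using borel_subset_meas by (auto simp: measurable_def)

section \<open>The square field of a cylinder function of labelled points\<close>

lemma smooth_measurable:
  fixes S :: "'a \<Rightarrow> nat \<Rightarrow> real" and G :: "(nat \<Rightarrow> real) \<Rightarrow> real"
  assumes "\<And>i. (\<lambda>x. S x i) \<in> borel_measurable M" "continuous_on UNIV G"
  shows "(\<lambda>x. G (S x)) \<in> borel_measurable M"
  by (rule measurable_compose[OF measurable_coordinatewise_then_product[of S, OF assms(1)]
        borel_measurable_continuous_onI[OF assms(2)]])

text \<open>Borel versions of the functions \<open>lsqf (f i) (f j)\<close>, with a common exceptional null set.\<close>

definition sqf_version :: "(nat \<Rightarrow> 'x \<Rightarrow> real) \<Rightarrow> (nat \<Rightarrow> nat \<Rightarrow> 'x \<Rightarrow> real) \<Rightarrow> 'x set \<Rightarrow> bool" where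
  "sqf_version f h N \<longleftrightarrow> N \<in> sets borel \<and> N \<in> null_sets (meas X) \<and>
    (\<forall>i j. h i j \<in> borel_measurable borel \<and> ring_bounded (h i j) \<and>
      (\<forall>x. x \<notin> N \<longrightarrow> lsqf (f i) (f j) x = h i j x))"

lemma lsqf_measurable: "f \<in> core X \<Longrightarrow> g \<in> core X \<Longrightarrow> lsqf f g \<in> borel_measurable (meas X)"
  unfolding lsqf_def by (rule lift_props[OF sqf_Linf])

lemma sqf_version_exists:
  assumes f: "\<And>i. f i \<in> core X"
  obtains h N where "sqf_version f h N"
proof -
  define P where "P i j h N \<longleftrightarrow> h \<in> borel_measurable borel \<and> ring_bounded h \<and> N \<in> sets borel \<and>
      N \<in> null_sets (meas X) \<and> (\<forall>x. x \<notin> N \<longrightarrow> lsqf (f i) (f j) x = h x)" for i j h N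
  have "\<exists>h N. P i j h N" for i j
  proof -
    obtain E C where E: "E \<in> lring X" "0 \<le> C" "AE x in meas X. \<bar>sqf X (f i) (f j) x\<bar> \<le> C * indicator E x"
      using sqf_bound[OF f f] .
    have "AE x in meas X. \<bar>lsqf (f i) (f j) x\<bar> \<le> C * indicator E x"
      using E(3) lift_props(3)[OF sqf_Linf[OF f[of i] f[of j]]] by eventually_elim (simp add: lsqf_def)
    from ring_bounded_borel_version[OF lsqf_measurable[OF f f] E(1,2) this]
    show ?thesis unfolding P_def by blast
  qed
  then have ex: "\<exists>hN. P (fst ij) (snd ij) (fst hN) (snd hN)" for ij
  proof -
    obtain h N where "P (fst ij) (snd ij) h N"
      using \<open>\<And>i j. \<exists>h N. P i j h N\<close> by blast
    then show ?thesis by (intro exI[of _ "(h, N)"]) simp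
  qed
  define H where "H ij = (SOME hN. P (fst ij) (snd ij) (fst hN) (snd hN))" for ij
  have H: "P i j (fst (H (i, j))) (snd (H (i, j)))" for i j
    using someI_ex[OF ex[of "(i, j)"]] unfolding H_def fst_conv snd_conv .
  have "sqf_version f (\<lambda>i j. fst (H (i, j))) (\<Union>i. \<Union>j. snd (H (i, j)))"
    unfolding sqf_version_def
  proof (intro conjI allI impI)
    show "(\<Union>i. \<Union>j. snd (H (i, j))) \<in> sets borel"
      using H unfolding P_def by (intro sets.countable_UN') auto
    show "(\<Union>i. \<Union>j. snd (H (i, j))) \<in> null_sets (meas X)"
      using H unfolding P_def by (intro null_sets_UN) auto
    fix i j
    show "fst (H (i, j)) \<in> borel_measurable borel" "ring_bounded (fst (H (i, j)))"
      using H[of i j] by (simp_all add: P_def)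
    show "lsqf (f i) (f j) x = fst (H (i, j)) x" if "x \<notin> (\<Union>i. \<Union>j. snd (H (i, j)))" for x
    proof -
      have "x \<notin> snd (H (i, j))" using that by blast
      then show ?thesis using H[of i j] unfolding P_def by blast
    qed
  qed
  then show thesis by (rule that)
qed

text \<open>The energy density of \<open>F(f\<^sub>0\<^sup>\<star>, f\<^sub>1\<^sup>\<star>, \<dots>)\<close> at a sequence truncated after \<open>N\<close> points.\<close>

definition cyl_density ::
  "nat \<Rightarrow> ((nat \<Rightarrow> real) \<Rightarrow> real) \<Rightarrow> (nat \<Rightarrow> 'x \<Rightarrow> real) \<Rightarrow> (nat \<Rightarrow> nat \<Rightarrow> 'x \<Rightarrow> real) \<Rightarrow>
    enat \<Rightarrow> (nat \<Rightarrow> 'x) \<Rightarrow> real" where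
  "cyl_density k F f h N x = (\<Sum>i<k. \<Sum>j<k. partial_deriv i F (\<lambda>i. psum N (f i) x) *
    partial_deriv j F (\<lambda>i. psum N (f i) x) * psum N (h i j) x)"

text \<open>Infinite, locally finite sequences with no entry in \<open>N\<close>.\<close>

definition good :: "'x set \<Rightarrow> 'x cseq \<Rightarrow> bool" where
  "good N \<xi> \<longleftrightarrow> \<xi> \<in> X_lcf_inf X \<and> (\<forall>p. snd \<xi> p \<notin> N)"

lemma AE_good:
  assumes "labeling X \<mu> l" "sqf_version f h N"
  shows "AE \<xi> in labelled_law \<mu> l. good N \<xi>" "AE \<gamma> in \<mu>. good N (l \<gamma>)"
proof -
  show "AE \<xi> in labelled_law \<mu> l. good N \<xi>"
    using AE_labelled_law[of l N] assms by (simp add: good_def sqf_version_def)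
  have "AE \<gamma> in \<mu>. \<forall>p. snd (l \<gamma>) p \<notin> N"
    using assms by (intro AE_labeling_avoids) (auto simp: sqf_version_def)
  with AE_labeling_infinite[OF assms(1)] show "AE \<gamma> in \<mu>. good N (l \<gamma>)"
    by eventually_elim (simp add: good_def)
qed

lemma psum_sums:
  assumes "lcf x" "ring_bounded g"
  shows "(\<lambda>p. if enat p < N then g (x p) else 0) sums psum N g x"
  unfolding psum_def by (rule summable_sums[OF psum_summable[OF assms]])

text \<open>The entries beyond the \<open>N\<close>-th one carry no energy, so \<open>\<Gamma>\<^sup>[\<^sup>N\<^sup>]\<close> and \<open>\<Gamma>\<^sup>[\<^sup>\<infinity>\<^sup>]\<close> agree on the function
  truncated after \<open>N\<close> points.\<close>

lemma seq_sqf_cyl_seq: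
  assumes u: "cyl_data u k F f" and h: "sqf_version f h Z" and \<xi>: "good Z \<xi>"
  shows "summable (seq_sqf_term X (cyl_seq N u) \<xi>)"
    and "summable (\<lambda>p. if enat p < N then seq_sqf_term X (cyl_seq N u) \<xi> p else 0)"
    and "seq_sqf X N (cyl_seq N u) \<xi> = cyl_density k F f h N (snd \<xi>)"
    and "seq_sqf X \<infinity> (cyl_seq N u) \<xi> = cyl_density k F f h N (snd \<xi>)"
proof -
  obtain x where x: "\<xi> = (\<infinity>, x)" "lcf x" "\<And>p. x p \<notin> Z"
    using \<xi> by (cases \<xi>) (auto simp: good_def X_lcf_inf_iff)
  let ?c = "\<lambda>i j. partial_deriv i F (\<lambda>i. psum N (f i) x) * partial_deriv j F (\<lambda>i. psum N (f i) x)"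
  have terms: "seq_sqf_term X (cyl_seq N u) \<xi> p =
      (\<Sum>i<k. \<Sum>j<k. ?c i j * (if enat p < N then h i j (x p) else 0))" for p
    using cyl_seq_section(2)[OF u x(2), of N p] h x(3) unfolding x(1)
    by (simp add: sqf_version_def)
  have sums: "seq_sqf_term X (cyl_seq N u) \<xi> sums cyl_density k F f h N x"
    unfolding terms[abs_def] cyl_density_def
    using h by (intro sums_sum sums_mult psum_sums x(2)) (simp add: sqf_version_def)
  then show "summable (seq_sqf_term X (cyl_seq N u) \<xi>)" by (rule sums_summable)
  have eq: "(\<lambda>p. if enat p < N then seq_sqf_term X (cyl_seq N u) \<xi> p else 0) = seq_sqf_term X (cyl_seq N u) \<xi>"
    unfolding terms by auto
  show "summable (\<lambda>p. if enat p < N then seq_sqf_term X (cyl_seq N u) \<xi> p else 0)"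
    unfolding eq using sums by (rule sums_summable)
  from eq show "seq_sqf X N (cyl_seq N u) \<xi> = cyl_density k F f h N (snd \<xi>)"
    unfolding seq_sqf_def using sums_unique[OF sums] x(1) by simp
  show "seq_sqf X \<infinity> (cyl_seq N u) \<xi> = cyl_density k F f h N (snd \<xi>)"
    unfolding seq_sqf_def using sums_unique[OF sums] x(1) by simp
qed

lemma cyl_density_nonneg:
  assumes u: "cyl_data u k F f" and h: "sqf_version f h Z" and \<xi>: "good Z \<xi>"
  shows "0 \<le> cyl_density k F f h N (snd \<xi>)"
proof -
  have \<xi>': "\<xi> = (\<infinity>, snd \<xi>)" and x: "lcf (snd \<xi>)"
    using \<xi> by (auto simp: good_def X_lcf_inf_iff prod_eq_iff)
  have "0 \<le> seq_sqf_term X (cyl_seq N u) \<xi> p" for p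
    unfolding seq_sqf_term_density
    by (rule density_nonneg, subst \<xi>', rule cyl_seq_section(1)[OF u x])
  then have "0 \<le> seq_sqf X N (cyl_seq N u) \<xi>"
    unfolding seq_sqf_def by (intro suminf_nonneg seq_sqf_cyl_seq(2)[OF assms]) simp
  then show ?thesis using seq_sqf_cyl_seq(3)[OF assms, of N] by simp
qed

lemma cyl_density_measurable:
  assumes u: "cyl_data u k F f" and h: "sqf_version f h Z"
  shows "(\<lambda>\<xi>. cyl_density k F f h N (entries \<xi>)) \<in> borel_measurable cseq_borel"
proof -
  have F: "F \<in> Cb_smooth k" using u by (simp add: cyl_data_def)
  have f: "f i \<in> borel_measurable borel" for i
    using u by (intro borel_measurable_continuous_onI core_continuous) (simp add: cyl_data_def)
  have S: "(\<lambda>\<xi>. partial_deriv i F (\<lambda>i. psum N (f i) (entries \<xi>))) \<in> borel_measurable cseq_borel" if "i < k" for i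
    by (rule smooth_measurable[where S = "\<lambda>\<xi> i. psum N (f i) (entries \<xi>)",
          OF psum_measurable[OF f] Cb_smooth_continuous(2)[OF F that]])
  show ?thesis
    unfolding cyl_density_def
  proof (intro borel_measurable_sum borel_measurable_times psum_measurable)
    fix i j assume ij: "i \<in> {..<k}" "j \<in> {..<k}"
    show "(\<lambda>\<xi>. partial_deriv i F (\<lambda>i. psum N (f i) (entries \<xi>))) \<in> borel_measurable cseq_borel"
      "(\<lambda>\<xi>. partial_deriv j F (\<lambda>i. psum N (f i) (entries \<xi>))) \<in> borel_measurable cseq_borel"
      using ij by (auto intro: S)
    show "h i j \<in> borel_measurable borel" using h by (simp add: sqf_version_def)
  qed
qed

lemma cyl_seq_measurable:
  assumes u: "cyl_data u k F f"
  shows "(\<lambda>\<xi>. F (\<lambda>i. psum N (f i) (entries \<xi>))) \<in> borel_measurable cseq_borel"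
proof -
  have F: "F \<in> Cb_smooth k" using u by (simp add: cyl_data_def)
  have f: "f i \<in> borel_measurable borel" for i
    using u by (intro borel_measurable_continuous_onI core_continuous) (simp add: cyl_data_def)
  show ?thesis
    by (rule smooth_measurable[where S = "\<lambda>\<xi> i. psum N (f i) (entries \<xi>)",
          OF psum_measurable[OF f] Cb_smooth_continuous(1)[OF F]])
qed

text \<open>Up to a constant factor, the sum of \<open>dominating k h\<close> over all points of a sequence dominates
  \<open>cyl_density k F f h N\<close> for every \<open>N\<close>.\<close>

definition dominating :: "nat \<Rightarrow> (nat \<Rightarrow> nat \<Rightarrow> 'x \<Rightarrow> real) \<Rightarrow> 'x \<Rightarrow> real" where
  "dominating k h x = (\<Sum>i<k. \<Sum>j<k. \<bar>h i j x\<bar>)"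

lemma ring_bounded_abs: "ring_bounded g \<Longrightarrow> ring_bounded (\<lambda>x. \<bar>g x\<bar>)"
  by (simp add: ring_bounded_def)

lemma ring_bounded_sum:
  assumes "finite I" "\<And>i. i \<in> I \<Longrightarrow> ring_bounded (g i)"
  shows "ring_bounded (\<lambda>x. \<Sum>i\<in>I. g i x)"
  using assms
proof (induction I rule: finite_induct)
  case empty
  show ?case unfolding ring_bounded_def by (rule bexI[OF _ empty_lring]) (auto intro: exI[of _ 0])
next
  case (insert i I)
  obtain E C E' C' where E: "E \<in> lring X" "0 \<le> C" "\<And>x. \<bar>g i x\<bar> \<le> C * indicator E x"
    and E': "E' \<in> lring X" "0 \<le> C'" "\<And>x. \<bar>\<Sum>i\<in>I. g i x\<bar> \<le> C' * indicator E' x"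
  proof -
    have "ring_bounded (g i)" "ring_bounded (\<lambda>x. \<Sum>i\<in>I. g i x)" using insert by auto
    then show ?thesis using that unfolding ring_bounded_def by blast
  qed
  have "\<bar>g i x + (\<Sum>i\<in>I. g i x)\<bar> \<le> (C + C') * indicator (E \<union> E') x" for x
  proof -
    have "\<bar>g i x + (\<Sum>i\<in>I. g i x)\<bar> \<le> C * indicator E x + C' * indicator E' x"
      using E(3)[of x] E'(3)[of x] by linarith
    also have "\<dots> \<le> C * indicator (E \<union> E') x + C' * indicator (E \<union> E') x"
      using E(2) E'(2) by (intro add_mono mult_left_mono) (auto simp: indicator_def)
    finally show ?thesis by (simp add: distrib_right)
  qed
  then show ?case
    using insert(1,2) lring_Un[OF E(1) E'(1)] E(2) E'(2)
    by (auto simp: ring_bounded_def intro!: bexI[of _ "E \<union> E'"] exI[of _ "C + C'"])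
qed

lemma dominating_props:
  assumes h: "sqf_version f h Z"
  shows "dominating k h \<in> borel_measurable borel" "ring_bounded (dominating k h)"
    "0 \<le> dominating k h x"
proof -
  have [measurable]: "h i j \<in> borel_measurable borel" and hr: "ring_bounded (h i j)" for i j
    using h by (simp_all add: sqf_version_def)
  show "dominating k h \<in> borel_measurable borel"
    unfolding dominating_def[abs_def] by measurable
  show "ring_bounded (dominating k h)"
    unfolding dominating_def[abs_def] using hr by (intro ring_bounded_sum ring_bounded_abs) auto
  show "0 \<le> dominating k h x"
    unfolding dominating_def by (intro sum_nonneg) auto
qed

lemma psum_mono:
  assumes "lcf x" "ring_bounded g" "ring_bounded h" "\<And>y. g y \<le> h y"
  shows "psum N g x \<le> psum N h x"
  unfolding psum_def using assms(4) by (intro suminf_le psum_summable assms(1,2,3)) auto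

lemma cyl_density_bound:
  assumes u: "cyl_data u k F f" and h: "sqf_version f h Z"
  obtains C where "0 \<le> C" "\<And>N x. lcf x \<Longrightarrow> \<bar>cyl_density k F f h N x\<bar> \<le> C * psum \<infinity> (dominating k h) x"
proof -
  have F: "F \<in> Cb_smooth k" using u by (simp add: cyl_data_def)
  obtain C where C: "0 \<le> C" "\<And>i y. i < k \<Longrightarrow> \<bar>partial_deriv i F y\<bar> \<le> C"
    using Cb_smooth_bounded[OF F] by metis
  have hr: "ring_bounded (h i j)" for i j using h by (simp add: sqf_version_def)
  have "\<bar>cyl_density k F f h N x\<bar> \<le> (real k * real k * (C * C)) * psum \<infinity> (dominating k h) x"
    if x: "lcf x" for N x
  proof -
    have one: "\<bar>partial_deriv i F (\<lambda>i. psum N (f i) x) * partial_deriv j F (\<lambda>i. psum N (f i) x) * psum N (h i j) x\<bar>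
        \<le> (C * C) * psum \<infinity> (dominating k h) x" if "i < k" "j < k" for i j
    proof -
      have "\<bar>psum N (h i j) x\<bar> \<le> psum \<infinity> (\<lambda>y. \<bar>h i j y\<bar>) x"
        by (rule psum_abs_le[OF x hr])
      also have "\<dots> \<le> psum \<infinity> (dominating k h) x"
      proof (rule psum_mono[OF x ring_bounded_abs[OF hr] dominating_props(2)[OF h]])
        fix y
        have "\<bar>h i j y\<bar> \<le> (\<Sum>j<k. \<bar>h i j y\<bar>)" using that by (intro member_le_sum) auto
        also have "\<dots> \<le> dominating k h y"
          unfolding dominating_def using that
          by (intro member_le_sum[of i "{..<k}" "\<lambda>i. \<Sum>j<k. \<bar>h i j y\<bar>"]) (auto intro: sum_nonneg)
        finally show "\<bar>h i j y\<bar> \<le> dominating k h y" .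
      qed
      finally have "\<bar>psum N (h i j) x\<bar> \<le> psum \<infinity> (dominating k h) x" .
      then show ?thesis
        unfolding abs_mult using that C by (intro mult_mono) auto
    qed
    have "\<bar>cyl_density k F f h N x\<bar> \<le> (\<Sum>i<k. \<Sum>j<k. (C * C) * psum \<infinity> (dominating k h) x)"
      unfolding cyl_density_def
      by (rule order_trans[OF sum_abs], rule sum_mono, rule order_trans[OF sum_abs], rule sum_mono, rule one) auto
    also have "\<dots> = (real k * real k * (C * C)) * psum \<infinity> (dominating k h) x"
      by simp
    finally show ?thesis .
  qed
  then show thesis using C(1) by (intro that[of "real k * real k * (C * C)"]) auto
qed

text \<open>The finite intensity of \<open>\<mu>\<close> makes the bound integrable, with an integral which does not depend on
  the labeling map.\<close>

lemma dominating_integrable: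
  assumes h: "sqf_version f h Z" and l: "labeling X \<mu> l"
  shows "integrable (labelled_law \<mu> l) (\<lambda>\<xi>. psum \<infinity> (dominating k h) (entries \<xi>))"
    and "(\<integral>\<xi>. psum \<infinity> (dominating k h) (entries \<xi>) \<partial>labelled_law \<mu> l) =
      (\<integral>\<gamma>. \<integral>x. dominating k h x \<partial>\<gamma> \<partial>\<mu>)"
proof -
  note d = dominating_props[OF h, of k]
  have dm: "dominating k h \<in> borel_measurable (meas X)" by (rule borel_meas[OF d(1)])
  have ae: "AE \<gamma> in \<mu>. psum \<infinity> (dominating k h) (entries (l \<gamma>)) = (\<integral>x. dominating k h x \<partial>\<gamma>)"
    using AE_labeling_infinite[OF l] AE_space
  proof eventually_elim
    case (elim \<gamma>)
    obtain x where x: "l \<gamma> = (\<infinity>, x)" "lcf x"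
      using elim(1) by (cases "l \<gamma>") (auto simp: X_lcf_inf_iff)
    have "\<gamma> = lab X (\<infinity>, x)" using lab_labeling[OF l, of \<gamma>] elim(2) x(1) by (simp add: space_mu)
    then show ?case using integral_lab[OF dm d(2) x(2)] x(1) by (simp add: entries_eq)
  qed
  note * = integral_labelled_law[OF l psum_measurable[OF d(1)] integral_conf_measurable[OF dm] ae]
  show "integrable (labelled_law \<mu> l) (\<lambda>\<xi>. psum \<infinity> (dominating k h) (entries \<xi>))"
    using *(2) integral_conf_integrable[OF dm d(2)] by simp
  show "(\<integral>\<xi>. psum \<infinity> (dominating k h) (entries \<xi>) \<partial>labelled_law \<mu> l) =
      (\<integral>\<gamma>. \<integral>x. dominating k h x \<partial>\<gamma> \<partial>\<mu>)"
    by (rule *(1))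
qed


section \<open>Cylinder functions of labelled points are pre-Sobolev\<close>

lemma cyl_seq_good:
  assumes u: "cyl_data u k F f" and \<xi>: "good Z \<xi>"
  shows "cyl_seq N u \<xi> = F (\<lambda>i. psum N (f i) (entries \<xi>))" "entries \<xi> = snd \<xi>"
proof -
  have \<xi>': "fst \<xi> = \<infinity>" "\<xi> = (\<infinity>, snd \<xi>)" and x: "lcf (snd \<xi>)"
    using \<xi> by (auto simp: good_def X_lcf_inf_iff prod_eq_iff)
  show *: "entries \<xi> = snd \<xi>" by (rule entries_eq[OF \<xi>'(1)])
  show "cyl_seq N u \<xi> = F (\<lambda>i. psum N (f i) (entries \<xi>))"
    unfolding * by (subst \<xi>'(2)) (rule cyl_seq_eq[OF u x])
qed

lemma good_lcf: "good Z \<xi> \<Longrightarrow> lcf (entries \<xi>)"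
  by (auto simp: good_def X_lcf_inf_iff entries_eq)

lemma cyl_version:
  assumes "u \<in> cyl X"
  obtains k F f h Z where "cyl_data u k F f" "sqf_version f h Z"
proof -
  obtain k F f where u: "cyl_data u k F f" using assms cyl_iff by blast
  then have "f i \<in> core X" for i by (simp add: cyl_data_def)
  then obtain h Z where "sqf_version f h Z" using sqf_version_exists by blast
  with u show thesis by (rule that)
qed

lemma cyl_bounded:
  assumes "u \<in> cyl X"
  obtains B where "0 \<le> B" "\<And>N \<xi>. \<xi> \<in> X_lcf_inf X \<Longrightarrow> \<bar>cyl_seq N u \<xi>\<bar> \<le> B"
    "\<And>\<gamma>. \<gamma> \<in> conf X \<Longrightarrow> \<bar>u \<gamma>\<bar> \<le> B"
proof -
  obtain k F f where u: "cyl_data u k F f" using assms cyl_iff by blast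
  then have F: "F \<in> Cb_smooth k" by (simp add: cyl_data_def)
  obtain B where B: "0 \<le> B" "\<And>y. \<bar>F y\<bar> \<le> B" using Cb_smooth_bounded[OF F] by metis
  have "\<bar>cyl_seq N u \<xi>\<bar> \<le> B" if "\<xi> \<in> X_lcf_inf X" for N \<xi>
    using cyl_seq_good(1)[OF u, of "{}" \<xi> N] that B(2) by (simp add: good_def)
  moreover have "\<bar>u \<gamma>\<bar> \<le> B" if "\<gamma> \<in> conf X" for \<gamma>
    using u that B(2) by (simp add: cyl_data_def)
  ultimately show thesis using that B(1) by blast
qed

lemma AE_X_lcf_inf:
  assumes "labeling X \<mu> l"
  shows "AE \<xi> in labelled_law \<mu> l. \<xi> \<in> X_lcf_inf X"
  using AE_labelled_law[OF assms, of "{}"] by simp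

lemma cyl_seq_measurable_law:
  assumes u: "u \<in> cyl X" and l: "labeling X \<mu> l"
  shows "cyl_seq N u \<in> borel_measurable (labelled_law \<mu> l)"
proof -
  obtain k F f where u: "cyl_data u k F f" using u cyl_iff by blast
  show ?thesis
  proof (rule measurable_labelled_law_AE[OF cyl_seq_measurable[OF u]])
    show "AE \<xi> in labelled_law \<mu> l. cyl_seq N u \<xi> = F (\<lambda>i. psum N (f i) (entries \<xi>))"
      using AE_X_lcf_inf[OF l]
      by eventually_elim (rule cyl_seq_good(1)[OF u, of "{}"], simp add: good_def)
  qed
qed

lemma cyl_seq_product_integrable:
  assumes u: "u \<in> cyl X" and v: "v \<in> cyl X" and l: "labeling X \<mu> l"
  shows "integrable (labelled_law \<mu> l) (\<lambda>\<xi>. cyl_seq N u \<xi> * cyl_seq N v \<xi>)"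
proof -
  interpret prob_space "labelled_law \<mu> l" by (rule prob_labelled_law[OF l])
  obtain A where A: "0 \<le> A" "\<And>N \<xi>. \<xi> \<in> X_lcf_inf X \<Longrightarrow> \<bar>cyl_seq N u \<xi>\<bar> \<le> A"
    using cyl_bounded[OF u] by metis
  obtain B where B: "0 \<le> B" "\<And>N \<xi>. \<xi> \<in> X_lcf_inf X \<Longrightarrow> \<bar>cyl_seq N v \<xi>\<bar> \<le> B"
    using cyl_bounded[OF v] by metis
  show ?thesis
  proof (rule integrable_const_bound)
    show "AE \<xi> in labelled_law \<mu> l. norm (cyl_seq N u \<xi> * cyl_seq N v \<xi>) \<le> A * B"
      using AE_X_lcf_inf[OF l]
      by eventually_elim (unfold real_norm_def abs_mult, intro mult_mono A B, auto)
  qed (intro borel_measurable_times cyl_seq_measurable_law u v l)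
qed

lemma seq_sqf_AE:
  assumes u: "cyl_data u k F f" and h: "sqf_version f h Z" and l: "labeling X \<mu> l"
  shows "AE \<xi> in labelled_law \<mu> l. seq_sqf X N (cyl_seq N u) \<xi> = cyl_density k F f h N (entries \<xi>) \<and>
    seq_sqf X \<infinity> (cyl_seq N u) \<xi> = cyl_density k F f h N (entries \<xi>) \<and>
    0 \<le> cyl_density k F f h N (entries \<xi>)"
  using AE_good(1)[OF l h]
proof eventually_elim
  case (elim \<xi>)
  show ?case
    using seq_sqf_cyl_seq(3,4)[OF u h elim, of N] cyl_density_nonneg[OF u h elim, of N]
      cyl_seq_good(2)[OF u elim] by simp
qed

lemma cyl_density_integrable:
  assumes u: "cyl_data u k F f" and h: "sqf_version f h Z" and l: "labeling X \<mu> l"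
  shows "integrable (labelled_law \<mu> l) (\<lambda>\<xi>. cyl_density k F f h N (entries \<xi>))"
proof -
  obtain C where C: "0 \<le> C" "\<And>N x. lcf x \<Longrightarrow> \<bar>cyl_density k F f h N x\<bar> \<le> C * psum \<infinity> (dominating k h) x"
    using cyl_density_bound[OF u h] by blast
  show ?thesis
  proof (rule Bochner_Integration.integrable_bound)
    show "integrable (labelled_law \<mu> l) (\<lambda>\<xi>. C * psum \<infinity> (dominating k h) (entries \<xi>))"
      by (intro integrable_mult_right dominating_integrable(1)[OF h l])
    show "AE \<xi> in labelled_law \<mu> l. norm (cyl_density k F f h N (entries \<xi>)) \<le>
        norm (C * psum \<infinity> (dominating k h) (entries \<xi>))"
      using AE_good(1)[OF l h]
    proof eventually_elim
      case (elim \<xi>)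
      from C(2)[OF good_lcf[OF elim], of N] show ?case by simp
    qed
  qed (intro measurable_labelled_law cyl_density_measurable[OF u h])
qed

lemma seq_sqf_integrable:
  assumes u: "u \<in> cyl X" and l: "labeling X \<mu> l"
  shows "integrable (labelled_law \<mu> l) (seq_sqf X N (cyl_seq N u))"
proof -
  obtain k F f h Z where u: "cyl_data u k F f" and h: "sqf_version f h Z"
    using cyl_version[OF u] .
  have ae: "AE \<xi> in labelled_law \<mu> l. seq_sqf X N (cyl_seq N u) \<xi> = cyl_density k F f h N (entries \<xi>)"
    using seq_sqf_AE[OF u h l, of N] by eventually_elim simp
  have "seq_sqf X N (cyl_seq N u) \<in> borel_measurable (labelled_law \<mu> l)"
    by (rule measurable_labelled_law_AE[OF cyl_density_measurable[OF u h] ae])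
  then show ?thesis
    using integrable_cong_AE[OF _ _ ae] cyl_density_integrable[OF u h l]
      measurable_labelled_law[OF cyl_density_measurable[OF u h]] by blast
qed

text \<open>The bound on the \<open>L\<^sup>2\<close> norms is uniform in the labeling map, by \<open>dominating_integrable\<close>.\<close>

lemma cyl_seq_pre_sobolev:
  assumes u: "u \<in> cyl X"
  shows "cyl_seq N u \<in> pre_sobolev X \<mu>"
proof -
  obtain B where B: "0 \<le> B" "\<And>N \<xi>. \<xi> \<in> X_lcf_inf X \<Longrightarrow> \<bar>cyl_seq N u \<xi>\<bar> \<le> B"
    using cyl_bounded[OF u] by metis
  obtain k F f h Z where uc: "cyl_data u k F f" and h: "sqf_version f h Z"
    using cyl_version[OF u] .
  obtain C where C: "0 \<le> C" "\<And>N x. lcf x \<Longrightarrow> \<bar>cyl_density k F f h N x\<bar> \<le> C * psum \<infinity> (dominating k h) x"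
    using cyl_density_bound[OF uc h] by blast
  let ?W = "\<lambda>\<xi>. \<bar>cyl_seq N u \<xi>\<bar> + sqrt (seq_sqf X \<infinity> (cyl_seq N u) \<xi>)"
  let ?D = "\<lambda>\<xi>. psum \<infinity> (dominating k h) (entries \<xi>)"
  define I where "I = (\<integral>\<gamma>. \<integral>x. dominating k h x \<partial>\<gamma> \<partial>\<mu>)"
  have main: "(AE \<xi> in labelled_law \<mu> l. seq_sqf_exists X (cyl_seq N u) \<xi>) \<and>
      ?W \<in> L2_fun (labelled_law \<mu> l) \<and> L2_norm (labelled_law \<mu> l) ?W \<le> sqrt (2 * B\<^sup>2 + 2 * C * I)"
    if l: "labeling X \<mu> l" for l
  proof -
    interpret prob_space "labelled_law \<mu> l" by (rule prob_labelled_law[OF l])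
    have ex: "AE \<xi> in labelled_law \<mu> l. seq_sqf_exists X (cyl_seq N u) \<xi>"
      using AE_good(1)[OF l h]
    proof eventually_elim
      case (elim \<xi>)
      have \<xi>': "\<xi> = (\<infinity>, snd \<xi>)" and x: "lcf (snd \<xi>)"
        using elim by (auto simp: good_def X_lcf_inf_iff prod_eq_iff)
      have "coord_section (cyl_seq N u) \<xi> p \<in> core_const" for p
        by (subst \<xi>', rule cyl_seq_section(1)[OF uc x])
      then show ?case
        using core_const_sqf_dom seq_sqf_cyl_seq(1)[OF uc h elim] elim
        by (simp add: seq_sqf_exists_def good_def)
    qed
    have ae: "AE \<xi> in labelled_law \<mu> l. ?W \<xi> =
        \<bar>F (\<lambda>i. psum N (f i) (entries \<xi>))\<bar> + sqrt (cyl_density k F f h N (entries \<xi>))"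
      using AE_good(1)[OF l h] seq_sqf_AE[OF uc h l, of N]
      by eventually_elim (simp add: cyl_seq_good(1)[OF uc])
    note m = cyl_seq_measurable[OF uc, of N] cyl_density_measurable[OF uc h, of N]
    have "(\<lambda>\<xi>. \<bar>F (\<lambda>i. psum N (f i) (entries \<xi>))\<bar> + sqrt (cyl_density k F f h N (entries \<xi>)))
        \<in> borel_measurable cseq_borel"
      using m by (intro borel_measurable_add borel_measurable_abs
          measurable_compose[OF _ borel_measurable_sqrt])
    from measurable_labelled_law_AE[OF this ae]
    have W: "?W \<in> borel_measurable (labelled_law \<mu> l)" .
    have bound: "AE \<xi> in labelled_law \<mu> l. (?W \<xi>)\<^sup>2 \<le> 2 * B\<^sup>2 + 2 * C * ?D \<xi>"
      using AE_good(1)[OF l h] seq_sqf_AE[OF uc h l, of N]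
    proof eventually_elim
      case (elim \<xi>)
      have "\<bar>cyl_seq N u \<xi>\<bar>\<^sup>2 \<le> B\<^sup>2"
        using B elim(1) by (intro power_mono) (auto simp: good_def)
      moreover have "(sqrt (seq_sqf X \<infinity> (cyl_seq N u) \<xi>))\<^sup>2 \<le> C * ?D \<xi>"
        using elim(2) C(2)[OF good_lcf[OF elim(1)], of N] by simp
      moreover have "(?W \<xi>)\<^sup>2 \<le> 2 * \<bar>cyl_seq N u \<xi>\<bar>\<^sup>2 + 2 * (sqrt (seq_sqf X \<infinity> (cyl_seq N u) \<xi>))\<^sup>2"
        using sum_squares_bound[of "\<bar>cyl_seq N u \<xi>\<bar>" "sqrt (seq_sqf X \<infinity> (cyl_seq N u) \<xi>)"]
        unfolding power2_sum by linarith
      ultimately show ?case by linarith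
    qed
    have D: "integrable (labelled_law \<mu> l) (\<lambda>\<xi>. 2 * B\<^sup>2 + 2 * C * ?D \<xi>)"
      using dominating_integrable(1)[OF h l, of k] by simp
    have W2: "integrable (labelled_law \<mu> l) (\<lambda>\<xi>. (?W \<xi>)\<^sup>2)"
    proof (rule Bochner_Integration.integrable_bound[OF D])
      show "AE \<xi> in labelled_law \<mu> l. norm ((?W \<xi>)\<^sup>2) \<le> norm (2 * B\<^sup>2 + 2 * C * ?D \<xi>)"
        using bound
      proof eventually_elim
        case (elim \<xi>)
        have "norm ((?W \<xi>)\<^sup>2) = (?W \<xi>)\<^sup>2" by simp
        also note elim
        also have "2 * B\<^sup>2 + 2 * C * ?D \<xi> \<le> norm (2 * B\<^sup>2 + 2 * C * ?D \<xi>)"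
          unfolding real_norm_def by (rule abs_ge_self)
        finally show ?case .
      qed
    qed (intro borel_measurable_power W)
    have "(\<integral>\<xi>. (?W \<xi>)\<^sup>2 \<partial>labelled_law \<mu> l) \<le> (\<integral>\<xi>. 2 * B\<^sup>2 + 2 * C * ?D \<xi> \<partial>labelled_law \<mu> l)"
      by (rule integral_mono_AE[OF W2 D bound])
    also have "\<dots> = 2 * B\<^sup>2 + 2 * C * I"
      using dominating_integrable[OF h l, of k] by (simp add: I_def prob_space)
    finally have "L2_norm (labelled_law \<mu> l) ?W \<le> sqrt (2 * B\<^sup>2 + 2 * C * I)"
      unfolding L2_norm_def by (rule real_sqrt_le_mono)
    with W W2 show ?thesis using ex by (simp add: L2_fun_def)
  qed
  have "bounded (cyl_seq N u ` X_lcf_inf X)"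
    using B(2) by (intro boundedI[of _ B]) (erule imageE, simp only: real_norm_def)
  then show ?thesis
    unfolding pre_sobolev_def using main cyl_seq_measurable_law[OF u] by blast
qed

section \<open>The forms on cylinder functions\<close>

lemma coord_section_lincomb:
  "coord_section (cyl_seq N (\<lambda>\<gamma>. a * u \<gamma> + b * v \<gamma>)) \<xi> p =
    (\<lambda>z. a * coord_section (cyl_seq N u) \<xi> p z + b * coord_section (cyl_seq N v) \<xi> p z)"
  by (rule ext) (simp only: coord_section_def cyl_seq_lincomb[symmetric])

text \<open>The contribution of the \<open>p\<close>-th point to the polarized energy density of two cylinder functions
  evaluated on the first \<open>N\<close> points.\<close>

definition density2_term ::
  "enat \<Rightarrow> ('x measure \<Rightarrow> real) \<Rightarrow> ('x measure \<Rightarrow> real) \<Rightarrow> 'x cseq \<Rightarrow> nat \<Rightarrow> real" where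
  "density2_term N u v \<xi> p = (if enat p < N then density2 (coord_section (cyl_seq N u) \<xi> p)
    (coord_section (cyl_seq N v) \<xi> p) (snd \<xi> p) else 0)"

lemma AE_cyl_seq_summable:
  assumes u: "u \<in> cyl X" and l: "labeling X \<mu> l"
  shows "AE \<xi> in labelled_law \<mu> l. (\<forall>p. coord_section (cyl_seq N u) \<xi> p \<in> core_const) \<and>
    summable (\<lambda>p. if enat p < N then density (coord_section (cyl_seq N u) \<xi> p) (snd \<xi> p) else 0)"
proof -
  obtain k F f h Z where uc: "cyl_data u k F f" and h: "sqf_version f h Z"
    using cyl_version[OF u] .
  show ?thesis
    using AE_good(1)[OF l h]
  proof eventually_elim
    case (elim \<xi>)
    have \<xi>': "\<xi> = (\<infinity>, snd \<xi>)" and x: "lcf (snd \<xi>)"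
      using elim by (auto simp: good_def X_lcf_inf_iff prod_eq_iff)
    have "coord_section (cyl_seq N u) \<xi> p \<in> core_const" for p
      by (subst \<xi>', rule cyl_seq_section(1)[OF uc x])
    then show ?case
      using seq_sqf_cyl_seq(2)[OF uc h elim, of N] unfolding seq_sqf_term_density by simp
  qed
qed

lemma seq_sqf_bilinear_AE:
  assumes u: "u \<in> cyl X" and v: "v \<in> cyl X" and l: "labeling X \<mu> l"
  shows "AE \<xi> in labelled_law \<mu> l. density2_term N u v \<xi> sums
    seq_sqf_bilinear X N (cyl_seq N u) (cyl_seq N v) \<xi>"
  using AE_cyl_seq_summable[OF cyl_add[OF u v] l, of N] AE_cyl_seq_summable[OF cyl_diff[OF u v] l, of N]
proof eventually_elim
  case (elim \<xi>)
  let ?d = "\<lambda>u p. if enat p < N then density (coord_section (cyl_seq N u) \<xi> p) (snd \<xi> p) else 0"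
  have eq: "seq_sqf X N (cyl_seq N u) \<xi> = (\<Sum>p. ?d u p)" for u
    unfolding seq_sqf_def seq_sqf_term_density ..
  have "(\<lambda>p. (?d (\<lambda>\<gamma>. u \<gamma> + v \<gamma>) p - ?d (\<lambda>\<gamma>. u \<gamma> - v \<gamma>) p) / 4) sums
      ((seq_sqf X N (cyl_seq N (\<lambda>\<gamma>. u \<gamma> + v \<gamma>)) \<xi> - seq_sqf X N (cyl_seq N (\<lambda>\<gamma>. u \<gamma> - v \<gamma>)) \<xi>) / 4)"
    unfolding eq using elim by (intro sums_divide sums_diff summable_sums) simp_all
  moreover have "(\<lambda>p. (?d (\<lambda>\<gamma>. u \<gamma> + v \<gamma>) p - ?d (\<lambda>\<gamma>. u \<gamma> - v \<gamma>) p) / 4) = density2_term N u v \<xi>"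
    using coord_section_lincomb[of N 1 u 1 v \<xi>] coord_section_lincomb[of N 1 u "-1" v \<xi>]
    by (auto simp: density2_term_def density2_def)
  ultimately show ?case
    by (simp add: seq_sqf_bilinear_def cyl_seq_add cyl_seq_diff)
qed

lemma seq_sqf_bilinear_integrable:
  assumes u: "u \<in> cyl X" and v: "v \<in> cyl X" and l: "labeling X \<mu> l"
  shows "integrable (labelled_law \<mu> l) (seq_sqf_bilinear X N (cyl_seq N u) (cyl_seq N v))"
  unfolding seq_sqf_bilinear_def[abs_def] cyl_seq_add cyl_seq_diff
  by (intro Bochner_Integration.integrable_diff integrable_divide seq_sqf_integrable cyl_add cyl_diff u v l)

lemma seq_form_linear:
  assumes u: "u \<in> cyl X" and v: "v \<in> cyl X" and w: "w \<in> cyl X" and l: "labeling X \<mu> l"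
  shows "seq_form X \<mu> l N (cyl_seq N (\<lambda>\<gamma>. a * u \<gamma> + b * v \<gamma>)) (cyl_seq N w) =
    a * seq_form X \<mu> l N (cyl_seq N u) (cyl_seq N w) + b * seq_form X \<mu> l N (cyl_seq N v) (cyl_seq N w)"
proof -
  note uv = cyl_lincomb[OF u v, of a b]
  note i = seq_sqf_bilinear_integrable
  let ?B = "\<lambda>u w. seq_sqf_bilinear X N (cyl_seq N u) (cyl_seq N w)"
  have "AE \<xi> in labelled_law \<mu> l. ?B (\<lambda>\<gamma>. a * u \<gamma> + b * v \<gamma>) w \<xi> = a * ?B u w \<xi> + b * ?B v w \<xi>"
    using seq_sqf_bilinear_AE[OF uv w l, of N] seq_sqf_bilinear_AE[OF u w l, of N]
      seq_sqf_bilinear_AE[OF v w l, of N] AE_cyl_seq_summable[OF u l, of N]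
      AE_cyl_seq_summable[OF v l, of N] AE_cyl_seq_summable[OF w l, of N]
  proof eventually_elim
    case (elim \<xi>)
    have "density2_term N (\<lambda>\<gamma>. a * u \<gamma> + b * v \<gamma>) w \<xi> =
        (\<lambda>p. a * density2_term N u w \<xi> p + b * density2_term N v w \<xi> p)"
    proof
      fix p
      have "density2 (coord_section (cyl_seq N (\<lambda>\<gamma>. a * u \<gamma> + b * v \<gamma>)) \<xi> p) (coord_section (cyl_seq N w) \<xi> p) y =
          a * density2 (coord_section (cyl_seq N u) \<xi> p) (coord_section (cyl_seq N w) \<xi> p) y +
          b * density2 (coord_section (cyl_seq N v) \<xi> p) (coord_section (cyl_seq N w) \<xi> p) y" for y
        unfolding coord_section_lincomb using elim(4-6) by (intro density2_linear) blast+
      then show "density2_term N (\<lambda>\<gamma>. a * u \<gamma> + b * v \<gamma>) w \<xi> p =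
          a * density2_term N u w \<xi> p + b * density2_term N v w \<xi> p"
        by (simp add: density2_term_def)
    qed
    moreover have "(\<lambda>p. a * density2_term N u w \<xi> p + b * density2_term N v w \<xi> p) sums
        (a * ?B u w \<xi> + b * ?B v w \<xi>)"
      using elim(2,3) by (intro sums_add sums_mult)
    ultimately show ?case using elim(1) by (auto intro: sums_unique2)
  qed
  then have "(\<integral>\<xi>. ?B (\<lambda>\<gamma>. a * u \<gamma> + b * v \<gamma>) w \<xi> \<partial>labelled_law \<mu> l) =
      (\<integral>\<xi>. a * ?B u w \<xi> + b * ?B v w \<xi> \<partial>labelled_law \<mu> l)"
    using i[OF uv w l, of N] i[OF u w l, of N] i[OF v w l, of N]
    by (intro integral_cong_AE) auto
  also have "\<dots> = a * (\<integral>\<xi>. ?B u w \<xi> \<partial>labelled_law \<mu> l) + b * (\<integral>\<xi>. ?B v w \<xi> \<partial>labelled_law \<mu> l)"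
    using i[OF u w l, of N] i[OF v w l, of N] by simp
  finally show ?thesis by (simp add: seq_form_def)
qed

lemma seq_form_sym:
  assumes u: "u \<in> cyl X" and v: "v \<in> cyl X" and l: "labeling X \<mu> l"
  shows "seq_form X \<mu> l N (cyl_seq N u) (cyl_seq N v) = seq_form X \<mu> l N (cyl_seq N v) (cyl_seq N u)"
proof -
  have "AE \<xi> in labelled_law \<mu> l. seq_sqf_bilinear X N (cyl_seq N u) (cyl_seq N v) \<xi> =
      seq_sqf_bilinear X N (cyl_seq N v) (cyl_seq N u) \<xi>"
    using seq_sqf_bilinear_AE[OF u v l, of N] seq_sqf_bilinear_AE[OF v u l, of N]
      AE_cyl_seq_summable[OF u l, of N] AE_cyl_seq_summable[OF v l, of N]
  proof eventually_elim
    case (elim \<xi>)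
    have "density2_term N u v \<xi> = density2_term N v u \<xi>"
    proof
      fix p
      have "density2 (coord_section (cyl_seq N u) \<xi> p) (coord_section (cyl_seq N v) \<xi> p) y =
          density2 (coord_section (cyl_seq N v) \<xi> p) (coord_section (cyl_seq N u) \<xi> p) y" for y
        using elim(3,4) by (intro density2_sym) blast+
      then show "density2_term N u v \<xi> p = density2_term N v u \<xi> p"
        by (simp add: density2_term_def)
    qed
    then show ?case using elim(1,2) sums_unique2 by metis
  qed
  then show ?thesis
    unfolding seq_form_def using seq_sqf_bilinear_integrable[OF u v l, of N]
      seq_sqf_bilinear_integrable[OF v u l, of N]
    by (intro integral_cong_AE) auto
qed

lemma seq_form_same:
  assumes u: "cyl_data u k F f" and h: "sqf_version f h Z" and l: "labeling X \<mu> l"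
  shows "seq_form X \<mu> l N (cyl_seq N u) (cyl_seq N u) =
    (\<integral>\<xi>. cyl_density k F f h N (entries \<xi>) \<partial>labelled_law \<mu> l)"
proof -
  have uc: "u \<in> cyl X" using u cyl_iff by blast
  have "AE \<xi> in labelled_law \<mu> l. seq_sqf_bilinear X N (cyl_seq N u) (cyl_seq N u) \<xi> =
      cyl_density k F f h N (entries \<xi>)"
    using seq_sqf_bilinear_AE[OF uc uc l, of N] AE_cyl_seq_summable[OF uc l, of N] seq_sqf_AE[OF u h l, of N]
  proof eventually_elim
    case (elim \<xi>)
    have "density2_term N u u \<xi> =
        (\<lambda>p. if enat p < N then density (coord_section (cyl_seq N u) \<xi> p) (snd \<xi> p) else 0)"
    proof
      fix p
      have "density2 (coord_section (cyl_seq N u) \<xi> p) (coord_section (cyl_seq N u) \<xi> p) y =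
          density (coord_section (cyl_seq N u) \<xi> p) y" for y
        using elim(2) by (intro density2_same) blast
      then show "density2_term N u u \<xi> p =
          (if enat p < N then density (coord_section (cyl_seq N u) \<xi> p) (snd \<xi> p) else 0)"
        by (simp add: density2_term_def)
    qed
    moreover have "(\<lambda>p. if enat p < N then density (coord_section (cyl_seq N u) \<xi> p) (snd \<xi> p) else 0)
        sums seq_sqf X N (cyl_seq N u) \<xi>"
      using elim(2) unfolding seq_sqf_def seq_sqf_term_density by (intro summable_sums) simp
    ultimately show ?case using elim(1,3) sums_unique2 by metis
  qed
  then show ?thesis
    unfolding seq_form_def
    using seq_sqf_bilinear_integrable[OF uc uc l, of N] cyl_density_integrable[OF u h l, of N]
    by (intro integral_cong_AE) auto
qed

lemma seq_form1_linear:
  assumes u: "u \<in> cyl X" and v: "v \<in> cyl X" and w: "w \<in> cyl X" and l: "labeling X \<mu> l"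
  shows "seq_form1 X \<mu> l N (cyl_seq N (\<lambda>\<gamma>. a * u \<gamma> + b * v \<gamma>)) (cyl_seq N w) =
    a * seq_form1 X \<mu> l N (cyl_seq N u) (cyl_seq N w) + b * seq_form1 X \<mu> l N (cyl_seq N v) (cyl_seq N w)"
proof -
  have "(\<integral>\<xi>. cyl_seq N (\<lambda>\<gamma>. a * u \<gamma> + b * v \<gamma>) \<xi> * cyl_seq N w \<xi> \<partial>labelled_law \<mu> l) =
      (\<integral>\<xi>. a * (cyl_seq N u \<xi> * cyl_seq N w \<xi>) + b * (cyl_seq N v \<xi> * cyl_seq N w \<xi>) \<partial>labelled_law \<mu> l)"
    by (simp add: cyl_seq_lincomb[symmetric] algebra_simps)
  also have "\<dots> = a * (\<integral>\<xi>. cyl_seq N u \<xi> * cyl_seq N w \<xi> \<partial>labelled_law \<mu> l) +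
      b * (\<integral>\<xi>. cyl_seq N v \<xi> * cyl_seq N w \<xi> \<partial>labelled_law \<mu> l)"
    using cyl_seq_product_integrable[OF u w l, of N] cyl_seq_product_integrable[OF v w l, of N] by simp
  finally show ?thesis
    using seq_form_linear[OF assms] by (simp add: seq_form1_def algebra_simps)
qed

text \<open>
  Convergence of the norms. Along a locally finite sequence the truncated quantities are eventually
  constant, since only finitely many points lie in the supports of the \<open>f i\<close> and \<open>h i j\<close>, and
  \<open>dominating\<close> provides an integrable bound.
\<close>

lemma seq_form1_tendsto:
  assumes u: "u \<in> cyl X" and l: "labeling X \<mu> l"
  shows "(\<lambda>n. seq_form1 X \<mu> l (enat n) (cyl_seq (enat n) u) (cyl_seq (enat n) u)) \<longlonglongrightarrow>
    seq_form1 X \<mu> l \<infinity> (cyl_seq \<infinity> u) (cyl_seq \<infinity> u)"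
proof -
  interpret prob_space "labelled_law \<mu> l" by (rule prob_labelled_law[OF l])
  obtain B where B: "0 \<le> B" "\<And>N \<xi>. \<xi> \<in> X_lcf_inf X \<Longrightarrow> \<bar>cyl_seq N u \<xi>\<bar> \<le> B"
    using cyl_bounded[OF u] by metis
  obtain k F f h Z where uc: "cyl_data u k F f" and h: "sqf_version f h Z"
    using cyl_version[OF u] .
  obtain C where C: "0 \<le> C" "\<And>N x. lcf x \<Longrightarrow> \<bar>cyl_density k F f h N x\<bar> \<le> C * psum \<infinity> (dominating k h) x"
    using cyl_density_bound[OF uc h] by blast
  have F: "F \<in> Cb_smooth k" and f: "\<And>i. ring_bounded (f i)"
    using uc core_ring_bounded by (auto simp: cyl_data_def)
  have hr: "ring_bounded (h i j)" for i j using h by (simp add: sqf_version_def)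
  have ev: "\<forall>\<^sub>F n in sequentially. (\<forall>i<k. psum (enat n) (f i) x = psum \<infinity> (f i) x) \<and>
      (\<forall>i<k. \<forall>j<k. psum (enat n) (h i j) x = psum \<infinity> (h i j) x)" if x: "lcf x" for x
  proof -
    have "\<forall>\<^sub>F n in sequentially. \<forall>i\<in>{..<k}. psum (enat n) (f i) x = psum \<infinity> (f i) x"
      by (intro eventually_ball_finite ballI psum_eventually_const x f) simp
    moreover have "\<forall>\<^sub>F n in sequentially. \<forall>i\<in>{..<k}. \<forall>j\<in>{..<k}. psum (enat n) (h i j) x = psum \<infinity> (h i j) x"
      by (intro eventually_ball_finite ballI psum_eventually_const x hr) simp_all
    ultimately show ?thesis by eventually_elim auto
  qed
  have "(\<lambda>n. \<integral>\<xi>. cyl_density k F f h (enat n) (entries \<xi>) \<partial>labelled_law \<mu> l) \<longlonglongrightarrow>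
      (\<integral>\<xi>. cyl_density k F f h \<infinity> (entries \<xi>) \<partial>labelled_law \<mu> l)"
  proof (rule integral_dominated_convergence)
    show "integrable (labelled_law \<mu> l) (\<lambda>\<xi>. C * psum \<infinity> (dominating k h) (entries \<xi>))"
      by (intro integrable_mult_right dominating_integrable(1)[OF h l])
    show "AE \<xi> in labelled_law \<mu> l. (\<lambda>n. cyl_density k F f h (enat n) (entries \<xi>)) \<longlonglongrightarrow>
        cyl_density k F f h \<infinity> (entries \<xi>)"
      using AE_good(1)[OF l h]
    proof eventually_elim
      case (elim \<xi>)
      have "\<forall>\<^sub>F n in sequentially. cyl_density k F f h (enat n) (entries \<xi>) = cyl_density k F f h \<infinity> (entries \<xi>)"
        using ev[OF good_lcf[OF elim]]
      proof eventually_elim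
        case (elim n)
        have "partial_deriv i F (\<lambda>i. psum (enat n) (f i) (entries \<xi>)) =
            partial_deriv i F (\<lambda>i. psum \<infinity> (f i) (entries \<xi>))" for i
          using elim by (intro depends_onD[OF depends_on_partial_deriv[OF Cb_smoothD(1)[OF F]]]) auto
        then show ?case unfolding cyl_density_def using elim by (intro sum.cong) auto
      qed
      then show ?case by (rule tendsto_eventually)
    qed
    show "AE \<xi> in labelled_law \<mu> l. norm (cyl_density k F f h (enat n) (entries \<xi>)) \<le>
        C * psum \<infinity> (dominating k h) (entries \<xi>)" for n
      using AE_good(1)[OF l h]
    proof eventually_elim
      case (elim \<xi>)
      from C(2)[OF good_lcf[OF elim], of "enat n"] show ?case by simp
    qed
  qed (intro measurable_labelled_law cyl_density_measurable[OF uc h])+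
  moreover have "(\<lambda>n. \<integral>\<xi>. cyl_seq (enat n) u \<xi> * cyl_seq (enat n) u \<xi> \<partial>labelled_law \<mu> l) \<longlonglongrightarrow>
      (\<integral>\<xi>. cyl_seq \<infinity> u \<xi> * cyl_seq \<infinity> u \<xi> \<partial>labelled_law \<mu> l)"
  proof (rule integral_dominated_convergence)
    show "integrable (labelled_law \<mu> l) (\<lambda>\<xi>. B * B)" by simp
    show "AE \<xi> in labelled_law \<mu> l. (\<lambda>n. cyl_seq (enat n) u \<xi> * cyl_seq (enat n) u \<xi>) \<longlonglongrightarrow>
        cyl_seq \<infinity> u \<xi> * cyl_seq \<infinity> u \<xi>"
      using AE_good(1)[OF l h]
    proof eventually_elim
      case (elim \<xi>)
      have "\<forall>\<^sub>F n in sequentially. cyl_seq (enat n) u \<xi> * cyl_seq (enat n) u \<xi> = cyl_seq \<infinity> u \<xi> * cyl_seq \<infinity> u \<xi>"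
        using ev[OF good_lcf[OF elim]]
      proof eventually_elim
        case (elim n)
        have "F (\<lambda>i. psum (enat n) (f i) (entries \<xi>)) = F (\<lambda>i. psum \<infinity> (f i) (entries \<xi>))"
          using elim by (intro depends_onD[OF Cb_smoothD(1)[OF F]]) auto
        then show ?case using cyl_seq_good(1)[OF uc \<open>good Z \<xi>\<close>] by simp
      qed
      then show ?case by (rule tendsto_eventually)
    qed
    show "AE \<xi> in labelled_law \<mu> l. norm (cyl_seq (enat n) u \<xi> * cyl_seq (enat n) u \<xi>) \<le> B * B" for n
      using AE_X_lcf_inf[OF l]
      by eventually_elim (unfold real_norm_def abs_mult, intro mult_mono B, auto)
  qed (intro borel_measurable_times cyl_seq_measurable_law u l)+
  ultimately show ?thesis
    unfolding seq_form1_def seq_form_same[OF uc h l] by (rule tendsto_add)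
qed

text \<open>On cylinder functions, the form on configurations is the form on infinite sequences.\<close>

lemma conf_pre_form_eq:
  assumes u: "u \<in> cyl X" and l: "labeling X \<mu> l"
  shows "conf_pre_form X \<mu> u u = seq_form X \<mu> l \<infinity> (cyl_seq \<infinity> u) (cyl_seq \<infinity> u)"
proof (rule conf_sqf_eq[OF u])
  fix k F f assume uc: "cyl_data u k F f" and sqf:
    "\<And>\<gamma>. conf_sqf X u u \<gamma> = (\<Sum>i<k. \<Sum>j<k. partial_deriv i F (\<lambda>i. \<integral>x. f i x \<partial>\<gamma>) *
      partial_deriv j F (\<lambda>j. \<integral>x. f j x \<partial>\<gamma>) * (\<integral>x. lsqf (f i) (f j) x \<partial>\<gamma>))"
  have F: "F \<in> Cb_smooth k" and f: "\<And>i. f i \<in> core X" using uc by (auto simp: cyl_data_def)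
  obtain h Z where h: "sqf_version f h Z" using sqf_version_exists[of f, OF f] .
  have hm: "h i j \<in> borel_measurable (meas X)" "ring_bounded (h i j)" for i j
    using h unfolding sqf_version_def by (blast intro: borel_meas)+
  have hZ: "lsqf (f i) (f j) x = h i j x" if "x \<notin> Z" for i j x
    using h that unfolding sqf_version_def by blast
  have S: "(\<lambda>\<gamma>. partial_deriv i F (\<lambda>i. \<integral>x. f i x \<partial>\<gamma>)) \<in> borel_measurable \<mu>" if "i < k" for i
    by (rule smooth_measurable[where S = "\<lambda>\<gamma> i. \<integral>x. f i x \<partial>\<gamma>",
          OF integral_conf_measurable[OF core_measurable[OF f]] Cb_smooth_continuous(2)[OF F that]])
  have m: "conf_sqf X u u \<in> borel_measurable \<mu>"
    unfolding sqf[abs_def]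
  proof (intro borel_measurable_sum borel_measurable_times)
    fix i j assume "i \<in> {..<k}" "j \<in> {..<k}"
    then show "(\<lambda>\<gamma>. partial_deriv i F (\<lambda>i. \<integral>x. f i x \<partial>\<gamma>)) \<in> borel_measurable \<mu>"
      "(\<lambda>\<gamma>. partial_deriv j F (\<lambda>i. \<integral>x. f i x \<partial>\<gamma>)) \<in> borel_measurable \<mu>"
      using S by simp_all
    show "(\<lambda>\<gamma>. \<integral>x. lsqf (f i) (f j) x \<partial>\<gamma>) \<in> borel_measurable \<mu>"
      by (rule integral_conf_measurable[OF lsqf_measurable[OF f f]])
  qed
  have "AE \<gamma> in \<mu>. cyl_density k F f h \<infinity> (entries (l \<gamma>)) = conf_sqf X u u \<gamma>"
    using AE_good(2)[OF l h] AE_space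
  proof eventually_elim
    case (elim \<gamma>)
    obtain x where x: "l \<gamma> = (\<infinity>, x)" "lcf x" "\<And>p. x p \<notin> Z"
      using elim(1) by (cases "l \<gamma>") (auto simp: good_def X_lcf_inf_iff)
    have \<gamma>: "\<gamma> = lab X (\<infinity>, x)"
      using lab_labeling[OF l, of \<gamma>] elim(2) x(1) by (simp add: space_mu)
    have "(\<integral>y. f i y \<partial>\<gamma>) = psum \<infinity> (f i) x" for i
      unfolding \<gamma> by (rule integral_lab[OF core_measurable[OF f] core_ring_bounded[OF f] x(2)])
    moreover have "(\<integral>y. lsqf (f i) (f j) y \<partial>\<gamma>) = psum \<infinity> (h i j) x" for i j
    proof -
      have "(\<integral>y. lsqf (f i) (f j) y \<partial>lab X (\<infinity>, x)) = (\<integral>y. h i j y \<partial>lab X (\<infinity>, x))"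
        using hZ x(3) by (intro integral_lab_cong lsqf_measurable f hm) simp
      also have "\<dots> = psum \<infinity> (h i j) x" by (rule integral_lab[OF hm x(2)])
      finally show ?thesis using \<gamma> by simp
    qed
    moreover have "entries (l \<gamma>) = x" using x(1) entries_eq[of "l \<gamma>"] by simp
    ultimately show ?case unfolding sqf cyl_density_def by (simp only:)
  qed
  from integral_labelled_law(1)[OF l cyl_density_measurable[OF uc h] m this]
  show ?thesis unfolding seq_form_same[OF uc h l] conf_pre_form_def by (rule sym)
qed

lemma cyl_measurable:
  assumes u: "u \<in> cyl X"
  shows "u \<in> borel_measurable \<mu>"
proof -
  obtain k F f where uc: "cyl_data u k F f" using u cyl_iff by blast
  have F: "F \<in> Cb_smooth k" and f: "\<And>i. f i \<in> core X" using uc by (auto simp: cyl_data_def)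
  have "(\<lambda>\<gamma>. F (\<lambda>i. \<integral>x. f i x \<partial>\<gamma>)) \<in> borel_measurable \<mu>"
    by (rule smooth_measurable[where S = "\<lambda>\<gamma> i. \<integral>x. f i x \<partial>\<gamma>",
          OF integral_conf_measurable[OF core_measurable[OF f]] Cb_smooth_continuous(1)[OF F]])
  moreover have "u \<gamma> = F (\<lambda>i. \<integral>x. f i x \<partial>\<gamma>)" if "\<gamma> \<in> space \<mu>" for \<gamma>
    using uc that by (simp add: cyl_data_def space_mu)
  ultimately show ?thesis by (simp cong: measurable_cong)
qed

lemma cyl_L2:
  assumes u: "u \<in> cyl X"
  shows "u \<in> L2_fun \<mu>"
proof -
  interpret prob_space \<mu> by (rule prob)
  obtain B where B: "0 \<le> B" "\<And>\<gamma>. \<gamma> \<in> conf X \<Longrightarrow> \<bar>u \<gamma>\<bar> \<le> B"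
    using cyl_bounded[OF u] by metis
  have [measurable]: "u \<in> borel_measurable \<mu>" by (rule cyl_measurable[OF u])
  have "integrable \<mu> (\<lambda>\<gamma>. (u \<gamma>)\<^sup>2)"
  proof (rule integrable_const_bound)
    show "AE \<gamma> in \<mu>. norm ((u \<gamma>)\<^sup>2) \<le> B\<^sup>2"
      using AE_space
    proof eventually_elim
      case (elim \<gamma>)
      then have "\<bar>u \<gamma>\<bar>\<^sup>2 \<le> B\<^sup>2" using B by (intro power_mono) (auto simp: space_mu)
      then show ?case by simp
    qed
  qed simp
  then show ?thesis by (simp add: L2_fun_def)
qed

lemma cyl_seq_L2_eq:
  assumes u: "u \<in> cyl X" and l: "labeling X \<mu> l"
  shows "(\<integral>\<xi>. cyl_seq \<infinity> u \<xi> * cyl_seq \<infinity> u \<xi> \<partial>labelled_law \<mu> l) = (\<integral>\<gamma>. (u \<gamma>)\<^sup>2 \<partial>\<mu>)"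
proof -
  obtain k F f where uc: "cyl_data u k F f" using u cyl_iff by blast
  let ?V = "\<lambda>\<xi>. F (\<lambda>i. psum \<infinity> (f i) (entries \<xi>))"
  have ae: "AE \<xi> in labelled_law \<mu> l. cyl_seq \<infinity> u \<xi> * cyl_seq \<infinity> u \<xi> = (?V \<xi>)\<^sup>2"
    using AE_X_lcf_inf[OF l]
    by eventually_elim (simp add: cyl_seq_good(1)[OF uc, of "{}"] good_def power2_eq_square)
  have V: "(\<lambda>\<xi>. (?V \<xi>)\<^sup>2) \<in> borel_measurable cseq_borel"
    using cyl_seq_measurable[OF uc] by (intro borel_measurable_power)
  have "AE \<gamma> in \<mu>. (?V (l \<gamma>))\<^sup>2 = (u \<gamma>)\<^sup>2"
    using AE_labeling_infinite[OF l] AE_space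
  proof eventually_elim
    case (elim \<gamma>)
    have "cyl_seq \<infinity> u (l \<gamma>) = u \<gamma>"
      using lab_labeling[OF l, of \<gamma>] elim(2) by (simp add: cyl_seq_infinity space_mu)
    then show ?case using cyl_seq_good(1)[OF uc, of "{}" "l \<gamma>" \<infinity>] elim(1) by (simp add: good_def)
  qed
  then have "(\<integral>\<xi>. (?V \<xi>)\<^sup>2 \<partial>labelled_law \<mu> l) = (\<integral>\<gamma>. (u \<gamma>)\<^sup>2 \<partial>\<mu>)"
    by (rule integral_labelled_law(1)[OF l V borel_measurable_power[OF cyl_measurable[OF u]]])
  moreover have "(\<integral>\<xi>. cyl_seq \<infinity> u \<xi> * cyl_seq \<infinity> u \<xi> \<partial>labelled_law \<mu> l) = (\<integral>\<xi>. (?V \<xi>)\<^sup>2 \<partial>labelled_law \<mu> l)"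
    using ae by (intro integral_cong_AE borel_measurable_times cyl_seq_measurable_law u l
        measurable_labelled_law V)
  ultimately show ?thesis by simp
qed

end

section \<open>Convergence of the Hilbert spaces\<close>

lemma limit_in_closure:
  fixes f :: "nat \<Rightarrow> 'a::metric_space"
  assumes "\<And>n. f n \<in> S" "f \<longlonglongrightarrow> x"
  shows "x \<in> closure S"
  unfolding closure_sequential using assms by (intro exI[of _ f]) simp

lemma subspace_closure_real_normed:
  fixes S :: "'a::real_normed_vector set"
  assumes S: "subspace S"
  shows "subspace (closure S)"
proof (rule subspaceI)
  show "0 \<in> closure S" using subspace_0[OF S] closure_subset by blast
next
  fix x y assume "x \<in> closure S" "y \<in> closure S"
  then obtain f g where fg: "\<forall>n. f n \<in> S" "f \<longlonglongrightarrow> x" "\<forall>n. g n \<in> S" "g \<longlonglongrightarrow> y"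
    unfolding closure_sequential by blast
  show "x + y \<in> closure S"
    by (rule limit_in_closure[OF _ tendsto_add[OF fg(2,4)]]) (use fg subspace_add[OF S] in auto)
next
  fix c x assume "x \<in> closure S"
  then obtain f where f: "\<forall>n. f n \<in> S" "f \<longlonglongrightarrow> x"
    unfolding closure_sequential by blast
  show "c *\<^sub>R x \<in> closure S"
    by (rule limit_in_closure[OF _ tendsto_scaleR[OF tendsto_const f(2)]])
      (use f subspace_scale[OF S] in auto)
qed

text \<open>The Hilbert completions of the pre-Sobolev functions, for a fixed labeling map.\<close>

locale labelled_completion = configuration_space X \<mu>
  for X :: "('x::t2_space) local_space" and \<mu> :: "'x measure measure" +
  fixes l :: "'x measure \<Rightarrow> 'x cseq"
    and K :: "enat \<Rightarrow> ('k::{real_inner, complete_space}) set"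
    and \<iota> :: "enat \<Rightarrow> ('x cseq \<Rightarrow> real) \<Rightarrow> 'k"
  assumes l: "labeling X \<mu> l"
    and completion: "\<And>N. hilbert_completion (pre_sobolev X \<mu>) (seq_form1 X \<mu> l N) (\<iota> N) (K N)"
begin

text \<open>The image in \<open>K N\<close> of a cylinder function evaluated on the first \<open>N\<close> labelled points.\<close>

definition embed :: "enat \<Rightarrow> ('x measure \<Rightarrow> real) \<Rightarrow> 'k" where
  "embed N u = \<iota> N (cyl_seq N u)"

text \<open>The quadratic form of the configuration space on cylinder functions.\<close>

abbreviation Q :: "('x measure \<Rightarrow> real) \<Rightarrow> real" where
  "Q u \<equiv> conf_pre_form X \<mu> u u"

lemma K_eq: "K N = closure (span (\<iota> N ` pre_sobolev X \<mu>))"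
  using completion by (simp add: hilbert_completion_def)

lemma K_subspace: "subspace (K N)" and K_closed: "closed (K N)"
  unfolding K_eq by (simp_all add: subspace_closure_real_normed)

lemma embed_in_K: "u \<in> cyl X \<Longrightarrow> embed N u \<in> K N"
  unfolding K_eq embed_def
  by (intro subsetD[OF closure_subset] span_base imageI cyl_seq_pre_sobolev)

lemma embed_inner:
  "u \<in> cyl X \<Longrightarrow> v \<in> cyl X \<Longrightarrow> embed N u \<bullet> embed N v = seq_form1 X \<mu> l N (cyl_seq N u) (cyl_seq N v)"
  using completion cyl_seq_pre_sobolev by (simp add: hilbert_completion_def embed_def)

lemma embed_linear:
  assumes u: "u \<in> cyl X" and v: "v \<in> cyl X"
  shows "embed N (\<lambda>\<gamma>. a * u \<gamma> + b * v \<gamma>) = a *\<^sub>R embed N u + b *\<^sub>R embed N v"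
proof -
  let ?w = "\<lambda>\<gamma>. a * u \<gamma> + b * v \<gamma>"
  let ?d = "embed N ?w - (a *\<^sub>R embed N u + b *\<^sub>R embed N v)"
  have w: "?w \<in> cyl X" by (rule cyl_lincomb[OF u v])
  have "embed N ?w \<bullet> embed N z = (a *\<^sub>R embed N u + b *\<^sub>R embed N v) \<bullet> embed N z" if z: "z \<in> cyl X" for z
    using seq_form1_linear[OF u v z l] embed_inner u v w z by (simp add: inner_add_left)
  then have "?d \<bullet> embed N z = 0" if "z \<in> cyl X" for z
    using that by (simp add: inner_diff_left)
  then have "?d \<bullet> ?d = 0"
    using u v w by (simp add: inner_diff_right inner_add_right)
  then show ?thesis by simp
qed

lemma embed_diff:
  "u \<in> cyl X \<Longrightarrow> v \<in> cyl X \<Longrightarrow> embed N (\<lambda>\<gamma>. u \<gamma> - v \<gamma>) = embed N u - embed N v"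
  using embed_linear[of u v N 1 "-1"] by simp

lemma norm_embed_infinity:
  assumes u: "u \<in> cyl X"
  shows "(norm (embed \<infinity> u))\<^sup>2 = Q u + (\<integral>\<gamma>. (u \<gamma>)\<^sup>2 \<partial>\<mu>)"
  unfolding power2_norm_eq_inner embed_inner[OF u u]
  by (simp add: seq_form1_def conf_pre_form_eq[OF u l] cyl_seq_L2_eq[OF u l])

lemma norm_embed_tendsto:
  assumes u: "u \<in> cyl X"
  shows "(\<lambda>n. norm (embed (enat n) u)) \<longlonglongrightarrow> norm (embed \<infinity> u)"
  unfolding norm_eq_sqrt_inner embed_inner[OF u u]
  by (intro tendsto_real_sqrt seq_form1_tendsto u l)

lemma Q_nonneg:
  assumes u: "u \<in> cyl X"
  shows "0 \<le> Q u"
proof -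
  obtain k F f h Z where uc: "cyl_data u k F f" and h: "sqf_version f h Z"
    using cyl_version[OF u] .
  have "0 \<le> (\<integral>\<xi>. cyl_density k F f h \<infinity> (entries \<xi>) \<partial>labelled_law \<mu> l)"
    using seq_sqf_AE[OF uc h l, of \<infinity>] by (intro integral_nonneg_AE) (auto elim: eventually_mono)
  then show ?thesis
    using conf_pre_form_eq[OF u l] seq_form_same[OF uc h l, of \<infinity>] by simp
qed

lemma Q_diff_le:
  assumes u: "u \<in> cyl X" and v: "v \<in> cyl X"
  shows "Q (\<lambda>\<gamma>. u \<gamma> - v \<gamma>) \<le> 2 * Q u + 2 * Q v"
proof -
  let ?B = "\<lambda>u v. seq_form X \<mu> l \<infinity> (cyl_seq \<infinity> u) (cyl_seq \<infinity> v)"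
  have expand: "Q (\<lambda>\<gamma>. 1 * u \<gamma> + c * v \<gamma>) = Q u + 2 * c * ?B u v + c\<^sup>2 * Q v" for c
  proof -
    have w: "(\<lambda>\<gamma>. 1 * u \<gamma> + c * v \<gamma>) \<in> cyl X" by (rule cyl_lincomb[OF u v])
    show ?thesis
      unfolding conf_pre_form_eq[OF w l] conf_pre_form_eq[OF u l] conf_pre_form_eq[OF v l]
      using seq_form_linear[OF u v w l, of \<infinity> 1 c] seq_form_linear[OF u v u l, of \<infinity> 1 c]
        seq_form_linear[OF u v v l, of \<infinity> 1 c] seq_form_sym[OF u w l, of \<infinity>]
        seq_form_sym[OF v w l, of \<infinity>] seq_form_sym[OF u v l, of \<infinity>]
      by (simp add: algebra_simps power2_eq_square)
  qed
  show ?thesis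
    using expand[of 1] expand[of "-1"] Q_nonneg[OF cyl_add[OF u v]] by simp
qed

lemma Q_zero: "Q (\<lambda>\<gamma>. 0) = 0"
  using Q_diff_le[OF cyl_zero cyl_zero] Q_nonneg[OF cyl_zero]
    seq_form_linear[OF cyl_zero cyl_zero cyl_zero l, of \<infinity> 0 0] conf_pre_form_eq[OF cyl_zero l]
  by simp

lemma form_closable: "closable \<mu> (conf_pre_form X \<mu>) (cyl X)"
  using closability by (simp add: closability_assumption_def)

text \<open>Closability, applied to constant sequences, makes \<open>embed \<infinity>\<close> well defined on \<open>\<mu>\<close>-classes; it is
  injective on them since the norm of \<open>K \<infinity>\<close> contains the \<open>L\<^sup>2\<close> norm.\<close>

lemma embed_eq_of_AE:
  assumes u: "u \<in> cyl X" and v: "v \<in> cyl X" and eq: "AE \<gamma> in \<mu>. u \<gamma> = v \<gamma>"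
  shows "embed \<infinity> u = embed \<infinity> v"
proof -
  let ?w = "\<lambda>\<gamma>. u \<gamma> - v \<gamma>"
  have w: "?w \<in> cyl X" by (rule cyl_diff[OF u v])
  have "(\<integral>\<gamma>. (?w \<gamma>)\<^sup>2 \<partial>\<mu>) = (\<integral>\<gamma>. 0 \<partial>\<mu>)"
  proof (rule integral_cong_AE)
    show "(\<lambda>\<gamma>. (?w \<gamma>)\<^sup>2) \<in> borel_measurable \<mu>"
      by (intro borel_measurable_power cyl_measurable w)
    show "AE \<gamma> in \<mu>. (?w \<gamma>)\<^sup>2 = 0" using eq by eventually_elim simp
  qed simp
  then have L2: "(\<integral>\<gamma>. (?w \<gamma>)\<^sup>2 \<partial>\<mu>) = 0" by simp
  have "form_approx \<mu> (conf_pre_form X \<mu>) (cyl X) (\<lambda>_. ?w) (\<lambda>\<gamma>. 0)"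
    using w L2 by (simp add: form_approx_def form_cauchy_def Q_zero L2_norm_def)
  then have "(\<lambda>n::nat. Q ?w) \<longlonglongrightarrow> 0"
    using form_closable by (simp add: closable_def)
  then have "Q ?w = 0" using LIMSEQ_const_iff by blast
  then have "norm (embed \<infinity> ?w) = 0"
    using norm_embed_infinity[OF w] L2 by simp
  then show ?thesis using embed_diff[OF u v] by simp
qed

lemma AE_eq_of_embed:
  assumes u: "u \<in> cyl X" and v: "v \<in> cyl X" and eq: "embed \<infinity> u = embed \<infinity> v"
  shows "AE \<gamma> in \<mu>. u \<gamma> = v \<gamma>"
proof -
  let ?w = "\<lambda>\<gamma>. u \<gamma> - v \<gamma>"
  have w: "?w \<in> cyl X" by (rule cyl_diff[OF u v])
  have "Q ?w + (\<integral>\<gamma>. (?w \<gamma>)\<^sup>2 \<partial>\<mu>) = 0"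
    using norm_embed_infinity[OF w] embed_diff[OF u v, of \<infinity>] eq by simp
  moreover have "0 \<le> (\<integral>\<gamma>. (?w \<gamma>)\<^sup>2 \<partial>\<mu>)" by simp
  ultimately have "(\<integral>\<gamma>. (?w \<gamma>)\<^sup>2 \<partial>\<mu>) = 0" using Q_nonneg[OF w] by linarith
  moreover have "integrable \<mu> (\<lambda>\<gamma>. (?w \<gamma>)\<^sup>2)" using cyl_L2[OF w] by (simp add: L2_fun_def)
  ultimately have "AE \<gamma> in \<mu>. (?w \<gamma>)\<^sup>2 = 0"
    by (subst (asm) integral_nonneg_eq_0_iff_AE) auto
  then show ?thesis by eventually_elim simp
qed

lemma form_approx_embed_Cauchy:
  assumes f: "f \<in> L2_fun \<mu>" and v: "form_approx \<mu> (conf_pre_form X \<mu>) (cyl X) v f"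
  shows "Cauchy (\<lambda>n. embed \<infinity> (v n))"
proof (rule metric_CauchyI)
  fix e :: real assume e: "0 < e"
  have vc: "v n \<in> cyl X" for n using v by (simp add: form_approx_def)
  have fc: "form_cauchy (conf_pre_form X \<mu>) v" and e2: "e\<^sup>2 / 2 > 0"
    using v e by (simp_all add: form_approx_def)
  obtain N where N: "\<And>i j. i \<ge> N \<Longrightarrow> j \<ge> N \<Longrightarrow> Q (\<lambda>\<gamma>. v i \<gamma> - v j \<gamma>) < e\<^sup>2 / 2"
    using fc[unfolded form_cauchy_def, rule_format, OF e2] by blast
  have "(\<lambda>n. \<integral>\<gamma>. (v n \<gamma> - f \<gamma>)\<^sup>2 \<partial>\<mu>) \<longlonglongrightarrow> 0"
    using v by (simp add: form_approx_def L2_norm_tendsto_0_iff)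
  from LIMSEQ_D[OF this, of "e\<^sup>2 / 8"] e obtain N' where
    N': "\<And>n. n \<ge> N' \<Longrightarrow> (\<integral>\<gamma>. (v n \<gamma> - f \<gamma>)\<^sup>2 \<partial>\<mu>) < e\<^sup>2 / 8" by auto
  have "dist (embed \<infinity> (v i)) (embed \<infinity> (v j)) < e" if "i \<ge> max N N'" "j \<ge> max N N'" for i j
  proof -
    have d: "(\<lambda>\<gamma>. v i \<gamma> - v j \<gamma>) \<in> cyl X" by (rule cyl_diff[OF vc vc])
    have "(\<integral>\<gamma>. ((v i \<gamma> - f \<gamma>) - (v j \<gamma> - f \<gamma>))\<^sup>2 \<partial>\<mu>) \<le>
        2 * (\<integral>\<gamma>. (v i \<gamma> - f \<gamma>)\<^sup>2 \<partial>\<mu>) + 2 * (\<integral>\<gamma>. (v j \<gamma> - f \<gamma>)\<^sup>2 \<partial>\<mu>)"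
      by (intro L2_integral_diff_le L2_fun_diff cyl_L2 vc f)
    then have "(\<integral>\<gamma>. (v i \<gamma> - v j \<gamma>)\<^sup>2 \<partial>\<mu>) \<le> e\<^sup>2 / 2"
      using N'[of i] N'[of j] that by simp
    then have "(norm (embed \<infinity> (v i) - embed \<infinity> (v j)))\<^sup>2 < e\<^sup>2"
      using N[of i j] that norm_embed_infinity[OF d] embed_diff[OF vc vc] by simp
    then show ?thesis using e by (simp add: dist_norm power_less_imp_less_base)
  qed
  then show "\<exists>M. \<forall>m\<ge>M. \<forall>n\<ge>M. dist (embed \<infinity> (v m)) (embed \<infinity> (v n)) < e" by blast
qed

lemma form_approx_embed_unique:
  assumes f: "f \<in> L2_fun \<mu>" and v: "form_approx \<mu> (conf_pre_form X \<mu>) (cyl X) v f"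
    and v': "form_approx \<mu> (conf_pre_form X \<mu>) (cyl X) v' f"
  shows "(\<lambda>n. embed \<infinity> (v n) - embed \<infinity> (v' n)) \<longlonglongrightarrow> 0"
proof -
  have vc: "v n \<in> cyl X" "v' n \<in> cyl X" for n using v v' by (simp_all add: form_approx_def)
  let ?w = "\<lambda>n \<gamma>. v n \<gamma> - v' n \<gamma>"
  have w: "?w n \<in> cyl X" for n by (rule cyl_diff[OF vc])
  have L2: "(\<lambda>n. L2_norm \<mu> (?w n)) \<longlonglongrightarrow> 0"
  proof -
    have "(\<lambda>n. L2_norm \<mu> (\<lambda>\<gamma>. (v n \<gamma> - f \<gamma>) - (v' n \<gamma> - f \<gamma>))) \<longlonglongrightarrow> 0"
    proof (rule L2_norm_diff_tendsto_0)
      show "(\<lambda>\<gamma>. v n \<gamma> - f \<gamma>) \<in> L2_fun \<mu>" "(\<lambda>\<gamma>. v' n \<gamma> - f \<gamma>) \<in> L2_fun \<mu>" for n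
        by (rule L2_fun_diff[OF cyl_L2[OF vc(1)] f], rule L2_fun_diff[OF cyl_L2[OF vc(2)] f])
    qed (use v v' in \<open>simp_all add: form_approx_def\<close>)
    then show ?thesis by simp
  qed
  have "form_cauchy (conf_pre_form X \<mu>) ?w"
    unfolding form_cauchy_def
  proof (intro allI impI)
    fix e :: real assume "e > 0"
    then have e: "e / 4 > 0" by simp
    have fc: "form_cauchy (conf_pre_form X \<mu>) v" "form_cauchy (conf_pre_form X \<mu>) v'"
      using v v' by (simp_all add: form_approx_def)
    obtain N where N: "\<And>i j. i \<ge> N \<Longrightarrow> j \<ge> N \<Longrightarrow> Q (\<lambda>\<gamma>. v i \<gamma> - v j \<gamma>) < e / 4"
      using fc(1)[unfolded form_cauchy_def, rule_format, OF e] by blast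
    obtain N' where N': "\<And>i j. i \<ge> N' \<Longrightarrow> j \<ge> N' \<Longrightarrow> Q (\<lambda>\<gamma>. v' i \<gamma> - v' j \<gamma>) < e / 4"
      using fc(2)[unfolded form_cauchy_def, rule_format, OF e] by blast
    have "Q (\<lambda>\<gamma>. ?w i \<gamma> - ?w j \<gamma>) < e" if "i \<ge> max N N'" "j \<ge> max N N'" for i j
    proof -
      have "(\<lambda>\<gamma>. ?w i \<gamma> - ?w j \<gamma>) = (\<lambda>\<gamma>. (v i \<gamma> - v j \<gamma>) - (v' i \<gamma> - v' j \<gamma>))" by auto
      then have "Q (\<lambda>\<gamma>. ?w i \<gamma> - ?w j \<gamma>) \<le>
          2 * Q (\<lambda>\<gamma>. v i \<gamma> - v j \<gamma>) + 2 * Q (\<lambda>\<gamma>. v' i \<gamma> - v' j \<gamma>)"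
        using Q_diff_le[OF cyl_diff[OF vc(1)[of i] vc(1)[of j]] cyl_diff[OF vc(2)[of i] vc(2)[of j]]] by simp
      also have "\<dots> < 2 * (e / 4) + 2 * (e / 4)"
        using N[of i j] N'[of i j] that by (intro add_strict_mono) auto
      finally show ?thesis by simp
    qed
    then show "\<exists>n. \<forall>i\<ge>n. \<forall>j\<ge>n. Q (\<lambda>\<gamma>. ?w i \<gamma> - ?w j \<gamma>) < e" by blast
  qed
  then have "form_approx \<mu> (conf_pre_form X \<mu>) (cyl X) ?w (\<lambda>\<gamma>. 0)"
    using w L2 by (simp add: form_approx_def)
  then have "(\<lambda>n. Q (?w n)) \<longlonglongrightarrow> 0"
    using form_closable unfolding closable_def by blast
  then have "(\<lambda>n. Q (?w n) + (\<integral>\<gamma>. (?w n \<gamma>)\<^sup>2 \<partial>\<mu>)) \<longlonglongrightarrow> 0"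
    using L2 by (intro tendsto_add_zero) (simp_all add: L2_norm_tendsto_0_iff)
  then have "(\<lambda>n. (norm (embed \<infinity> (v n) - embed \<infinity> (v' n)))\<^sup>2) \<longlonglongrightarrow> 0"
    using norm_embed_infinity[OF w] embed_diff[OF vc] by simp
  from tendsto_real_sqrt[OF this] show ?thesis
    by (simp add: tendsto_norm_zero_iff)
qed

lemma lab_star_eqI:
  assumes f: "f \<in> L2_fun \<mu>" and v: "form_approx \<mu> (conf_pre_form X \<mu>) (cyl X) v f"
    and k: "(\<lambda>n. embed \<infinity> (v n)) \<longlonglongrightarrow> k"
  shows "lab_star X \<mu> (\<iota> \<infinity>) f = k"
  unfolding lab_star_def
proof (rule the_equality)
  show "\<exists>v. form_approx \<mu> (conf_pre_form X \<mu>) (cyl X) v f \<and> (\<lambda>n. \<iota> \<infinity> (v n \<circ> lab X)) \<longlonglongrightarrow> k"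
    using v k by (auto simp: embed_def cyl_seq_infinity)
  fix k' assume "\<exists>v. form_approx \<mu> (conf_pre_form X \<mu>) (cyl X) v f \<and> (\<lambda>n. \<iota> \<infinity> (v n \<circ> lab X)) \<longlonglongrightarrow> k'"
  then obtain v' where v': "form_approx \<mu> (conf_pre_form X \<mu>) (cyl X) v' f"
    and k': "(\<lambda>n. embed \<infinity> (v' n)) \<longlonglongrightarrow> k'"
    by (auto simp: embed_def cyl_seq_infinity)
  have "(\<lambda>n. embed \<infinity> (v n) - embed \<infinity> (v' n)) \<longlonglongrightarrow> k - k'" using k k' by (rule tendsto_diff)
  then have "k - k' = 0" using form_approx_embed_unique[OF f v v'] LIMSEQ_unique by blast
  then show "k' = k" by simp
qed

lemma form_approx_cyl: "u \<in> cyl X \<Longrightarrow> form_approx \<mu> (conf_pre_form X \<mu>) (cyl X) (\<lambda>_. u) u"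
  by (simp add: form_approx_def form_cauchy_def Q_zero L2_norm_def)

lemma cyl_subset_conf_dom: "cyl X \<subseteq> conf_dom X \<mu>"
  using form_approx_cyl cyl_L2 by (auto simp: conf_dom_def closure_dom_def)

lemma lab_star_cyl: "u \<in> cyl X \<Longrightarrow> lab_star X \<mu> (\<iota> \<infinity>) u = embed \<infinity> u"
  by (rule lab_star_eqI[OF cyl_L2 form_approx_cyl]) auto

lemma embed_subspace: "subspace (embed \<infinity> ` cyl X)"
proof (rule subspaceI)
  have "0 = embed \<infinity> (\<lambda>\<gamma>. 0)"
    using embed_linear[OF cyl_zero cyl_zero, of \<infinity> 0 0] by simp
  then show "0 \<in> embed \<infinity> ` cyl X" using cyl_zero by (rule image_eqI)
next
  fix x y assume "x \<in> embed \<infinity> ` cyl X" "y \<in> embed \<infinity> ` cyl X"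
  then obtain u v where "u \<in> cyl X" "v \<in> cyl X" "x = embed \<infinity> u" "y = embed \<infinity> v" by blast
  then have "x + y = embed \<infinity> (\<lambda>\<gamma>. 1 * u \<gamma> + 1 * v \<gamma>)" "(\<lambda>\<gamma>. 1 * u \<gamma> + 1 * v \<gamma>) \<in> cyl X"
    using embed_linear[of u v \<infinity> 1 1] cyl_lincomb[of u v 1 1] by simp_all
  then show "x + y \<in> embed \<infinity> ` cyl X" by (rule image_eqI)
next
  fix c x assume "x \<in> embed \<infinity> ` cyl X"
  then obtain u where "u \<in> cyl X" "x = embed \<infinity> u" by blast
  then have "c *\<^sub>R x = embed \<infinity> (\<lambda>\<gamma>. c * u \<gamma> + 0 * u \<gamma>)" "(\<lambda>\<gamma>. c * u \<gamma> + 0 * u \<gamma>) \<in> cyl X"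
    using embed_linear[of u u \<infinity> c 0] cyl_lincomb[of u u c 0] by simp_all
  then show "c *\<^sub>R x \<in> embed \<infinity> ` cyl X" by (rule image_eqI)
qed

text \<open>Completeness of \<open>L\<^sup>2(\<mu>)\<close> makes the image of the domain of the closure closed.\<close>

lemma lab_star_conf_dom: "lab_star X \<mu> (\<iota> \<infinity>) ` conf_dom X \<mu> = closure (embed \<infinity> ` cyl X)"
proof (intro subset_antisym subsetI)
  fix k assume "k \<in> lab_star X \<mu> (\<iota> \<infinity>) ` conf_dom X \<mu>"
  then obtain f v where f: "f \<in> L2_fun \<mu>" and v: "form_approx \<mu> (conf_pre_form X \<mu>) (cyl X) v f"
    and k: "k = lab_star X \<mu> (\<iota> \<infinity>) f"
    by (auto simp: conf_dom_def closure_dom_def)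
  obtain k' where k': "(\<lambda>n. embed \<infinity> (v n)) \<longlonglongrightarrow> k'"
    using form_approx_embed_Cauchy[OF f v] by (auto simp: Cauchy_convergent_iff convergent_def)
  then have "k = k'" using lab_star_eqI[OF f v] k by simp
  moreover have "embed \<infinity> (v n) \<in> embed \<infinity> ` cyl X" for n using v by (simp add: form_approx_def)
  ultimately show "k \<in> closure (embed \<infinity> ` cyl X)"
    using limit_in_closure[of "\<lambda>n. embed \<infinity> (v n)", OF _ k'] by simp
next
  fix k assume "k \<in> closure (embed \<infinity> ` cyl X)"
  then obtain g where g: "\<And>n. g n \<in> embed \<infinity> ` cyl X" "g \<longlonglongrightarrow> k"
    unfolding closure_sequential by blast
  define v where "v n = (SOME u. u \<in> cyl X \<and> g n = embed \<infinity> u)" for n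
  have v: "v n \<in> cyl X" "g n = embed \<infinity> (v n)" for n
  proof -
    have "\<exists>u. u \<in> cyl X \<and> g n = embed \<infinity> u" using g(1)[of n] by (elim imageE) blast
    from someI_ex[OF this] show "v n \<in> cyl X" "g n = embed \<infinity> (v n)"
      unfolding v_def[symmetric] by simp_all
  qed
  have "g = (\<lambda>n. embed \<infinity> (v n))" using v(2) by (rule ext)
  with g(2) have lim: "(\<lambda>n. embed \<infinity> (v n)) \<longlonglongrightarrow> k" by (simp only:)
  have cauchy: "\<exists>N. \<forall>i\<ge>N. \<forall>j\<ge>N. Q (\<lambda>\<gamma>. v i \<gamma> - v j \<gamma>) + (\<integral>\<gamma>. (v i \<gamma> - v j \<gamma>)\<^sup>2 \<partial>\<mu>) < e"
    if e: "e > 0" for e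
  proof -
    have "Cauchy (\<lambda>n. embed \<infinity> (v n))" using lim by (rule LIMSEQ_imp_Cauchy)
    then obtain N where N: "\<And>i j. i \<ge> N \<Longrightarrow> j \<ge> N \<Longrightarrow> norm (embed \<infinity> (v i) - embed \<infinity> (v j)) < sqrt e"
      using metric_CauchyD[of "\<lambda>n. embed \<infinity> (v n)" "sqrt e"] e by (auto simp: dist_norm)
    have "Q (\<lambda>\<gamma>. v i \<gamma> - v j \<gamma>) + (\<integral>\<gamma>. (v i \<gamma> - v j \<gamma>)\<^sup>2 \<partial>\<mu>) < e" if "i \<ge> N" "j \<ge> N" for i j
    proof -
      have "(norm (embed \<infinity> (v i) - embed \<infinity> (v j)))\<^sup>2 < (sqrt e)\<^sup>2"
        using N[OF that] by (intro power_strict_mono) auto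
      then show ?thesis
        using e norm_embed_infinity[OF cyl_diff[OF v(1)[of i] v(1)[of j]]]
          embed_diff[OF v(1)[of i] v(1)[of j], of \<infinity>] by simp
    qed
    then show ?thesis by blast
  qed
  have L2_cauchy: "\<exists>N. \<forall>i\<ge>N. \<forall>j\<ge>N. (\<integral>\<gamma>. (v i \<gamma> - v j \<gamma>)\<^sup>2 \<partial>\<mu>) < e" if "e > 0" for e
  proof -
    obtain N where N: "\<forall>i\<ge>N. \<forall>j\<ge>N. Q (\<lambda>\<gamma>. v i \<gamma> - v j \<gamma>) + (\<integral>\<gamma>. (v i \<gamma> - v j \<gamma>)\<^sup>2 \<partial>\<mu>) < e"
      using cauchy[OF \<open>e > 0\<close>] by blast
    have "(\<integral>\<gamma>. (v i \<gamma> - v j \<gamma>)\<^sup>2 \<partial>\<mu>) < e" if "i \<ge> N" "j \<ge> N" for i j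
      using N[rule_format, OF that] Q_nonneg[OF cyl_diff[OF v(1)[of i] v(1)[of j]]] by linarith
    then show ?thesis by blast
  qed
  have "form_cauchy (conf_pre_form X \<mu>) v"
    unfolding form_cauchy_def
  proof (intro allI impI)
    fix e :: real assume "e > 0"
    obtain N where N: "\<forall>i\<ge>N. \<forall>j\<ge>N. Q (\<lambda>\<gamma>. v i \<gamma> - v j \<gamma>) + (\<integral>\<gamma>. (v i \<gamma> - v j \<gamma>)\<^sup>2 \<partial>\<mu>) < e"
      using cauchy[OF \<open>e > 0\<close>] by blast
    have "Q (\<lambda>\<gamma>. v i \<gamma> - v j \<gamma>) < e" if "i \<ge> N" "j \<ge> N" for i j
    proof -
      have "0 \<le> (\<integral>\<gamma>. (v i \<gamma> - v j \<gamma>)\<^sup>2 \<partial>\<mu>)" by simp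
      with N[rule_format, OF that] show ?thesis by linarith
    qed
    then show "\<exists>n. \<forall>i\<ge>n. \<forall>j\<ge>n. Q (\<lambda>\<gamma>. v i \<gamma> - v j \<gamma>) < e" by blast
  qed
  moreover obtain f where f: "f \<in> L2_fun \<mu>" "(\<lambda>n. L2_norm \<mu> (\<lambda>\<gamma>. v n \<gamma> - f \<gamma>)) \<longlonglongrightarrow> 0"
    by (rule L2_complete[OF prob_space.finite_measure[OF prob] cyl_L2[OF v(1)] L2_cauchy])
  ultimately have "form_approx \<mu> (conf_pre_form X \<mu>) (cyl X) v f"
    using v(1) by (simp add: form_approx_def)
  then have "f \<in> conf_dom X \<mu>" "lab_star X \<mu> (\<iota> \<infinity>) f = k"
    using f(1) lab_star_eqI[OF f(1) _ lim] by (auto simp: conf_dom_def closure_dom_def)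
  then show "k \<in> lab_star X \<mu> (\<iota> \<infinity>) ` conf_dom X \<mu>" by blast
qed

lemma lab_star_image_cyl: "lab_star X \<mu> (\<iota> \<infinity>) ` cyl X = embed \<infinity> ` cyl X"
  by (rule image_cong[OF refl lab_star_cyl])

lemma lab_star_conf_dom_subset: "lab_star X \<mu> (\<iota> \<infinity>) ` conf_dom X \<mu> \<subseteq> K \<infinity>"
  unfolding lab_star_conf_dom using embed_in_K by (intro closure_minimal K_closed) blast

lemma trunc_map_eq: "trunc_map X r \<iota> n u = embed (enat n) (r u)"
  by (simp add: trunc_map_def embed_def cyl_seq_enat)

lemma kuwae_shioya_labelled:
  assumes r: "cyl_choice X \<mu> r"
  shows "kuwae_shioya sequentially (\<lambda>n. K (enat n))
      (lab_star X \<mu> (\<iota> \<infinity>) ` conf_dom X \<mu>)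
      (\<lambda>n. trunc_map X r \<iota> n \<circ> inv_into (cyl X) (lab_star X \<mu> (\<iota> \<infinity>)))
      (lab_star X \<mu> (\<iota> \<infinity>) ` cyl X)"
proof -
  let ?L = "lab_star X \<mu> (\<iota> \<infinity>)"
  let ?inv = "inv_into (cyl X) ?L"
  \<comment> \<open>\<open>?inv\<close> inverts the isometry up to \<open>\<mu>\<close>-classes only; \<open>r\<close> is constant on these and linear.\<close>
  have r_cyl: "r u \<in> cyl X" and r_AE: "AE \<gamma> in \<mu>. r u \<gamma> = u \<gamma>" if "u \<in> cyl X" for u
    using r that unfolding cyl_choice_def by blast+
  have r_cong: "r u = r v" if "u \<in> cyl X" "v \<in> cyl X" "AE \<gamma> in \<mu>. u \<gamma> = v \<gamma>" for u v
    using r that unfolding cyl_choice_def by blast+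
  have r_lin: "r (\<lambda>\<gamma>. a * u \<gamma> + b * v \<gamma>) = (\<lambda>\<gamma>. a * r u \<gamma> + b * r v \<gamma>)"
    if "u \<in> cyl X" "v \<in> cyl X" for u v a b
    using r that unfolding cyl_choice_def by blast+
  have inv: "?inv c \<in> cyl X" "embed \<infinity> (?inv c) = c" if "c \<in> ?L ` cyl X" for c
    using inv_into_into[OF that] f_inv_into_f[OF that] lab_star_cyl by simp_all
  have C: "subspace (?L ` cyl X)" unfolding lab_star_image_cyl by (rule embed_subspace)
  have lin: "embed (enat n) (r (?inv (a *\<^sub>R c + b *\<^sub>R d))) =
      a *\<^sub>R embed (enat n) (r (?inv c)) + b *\<^sub>R embed (enat n) (r (?inv d))"
    if c: "c \<in> ?L ` cyl X" and d: "d \<in> ?L ` cyl X" for n a b c d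
  proof -
    let ?w = "\<lambda>\<gamma>. a * ?inv c \<gamma> + b * ?inv d \<gamma>"
    have cd: "a *\<^sub>R c + b *\<^sub>R d \<in> ?L ` cyl X"
      using C c d by (intro subspace_add subspace_scale)
    have w: "?w \<in> cyl X" by (rule cyl_lincomb[OF inv(1)[OF c] inv(1)[OF d]])
    have "embed \<infinity> ?w = embed \<infinity> (?inv (a *\<^sub>R c + b *\<^sub>R d))"
      unfolding embed_linear[OF inv(1)[OF c] inv(1)[OF d]] inv(2)[OF c] inv(2)[OF d] inv(2)[OF cd] ..
    from AE_eq_of_embed[OF w inv(1)[OF cd] this]
    have "r (?inv (a *\<^sub>R c + b *\<^sub>R d)) = r ?w"
      using r_cong[OF w inv(1)[OF cd]] by simp
    also have "\<dots> = (\<lambda>\<gamma>. a * r (?inv c) \<gamma> + b * r (?inv d) \<gamma>)"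
      by (rule r_lin[OF inv(1)[OF c] inv(1)[OF d]])
    finally show ?thesis
      using embed_linear[OF r_cyl[OF inv(1)[OF c]] r_cyl[OF inv(1)[OF d]]] by simp
  qed
  have limsup: "Limsup sequentially (\<lambda>n. ereal (norm (embed (enat n) (r (?inv c))))) = ereal (norm c)"
    if c: "c \<in> ?L ` cyl X" for c
  proof -
    have "embed \<infinity> (r (?inv c)) = c"
      using embed_eq_of_AE[OF r_cyl[OF inv(1)[OF c]] inv(1)[OF c] r_AE[OF inv(1)[OF c]]] inv(2)[OF c]
      by simp
    then have "(\<lambda>n. norm (embed (enat n) (r (?inv c)))) \<longlonglongrightarrow> norm c"
      using norm_embed_tendsto[OF r_cyl[OF inv(1)[OF c]]] by simp
    then have "(\<lambda>n. ereal (norm (embed (enat n) (r (?inv c))))) \<longlonglongrightarrow> ereal (norm c)"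
      by (simp only: tendsto_ereal)
    then show ?thesis by (rule lim_imp_Limsup[OF trivial_limit_sequentially])
  qed
  show ?thesis
    unfolding kuwae_shioya_def o_def trunc_map_eq
  proof (intro conjI allI ballI)
    show "subspace (K (enat n))" "closed (K (enat n))" for n
      by (rule K_subspace K_closed)+
    show "subspace (?L ` conf_dom X \<mu>)"
      unfolding lab_star_conf_dom by (rule subspace_closure_real_normed[OF embed_subspace])
    show "closed (?L ` conf_dom X \<mu>)" unfolding lab_star_conf_dom by simp
    show "subspace (?L ` cyl X)" by (rule C)
    show "?L ` cyl X \<subseteq> ?L ` conf_dom X \<mu>" by (rule image_mono[OF cyl_subset_conf_dom])
    show "?L ` conf_dom X \<mu> \<subseteq> closure (?L ` cyl X)"
      unfolding lab_star_conf_dom lab_star_image_cyl ..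
    show "(\<lambda>c. embed (enat n) (r (?inv c))) ` ?L ` cyl X \<subseteq> K (enat n)" for n
      using embed_in_K r_cyl inv(1) by blast
    show "embed (enat n) (r (?inv (a *\<^sub>R c + b *\<^sub>R d))) =
        a *\<^sub>R embed (enat n) (r (?inv c)) + b *\<^sub>R embed (enat n) (r (?inv d))"
      if "c \<in> ?L ` cyl X" "d \<in> ?L ` cyl X" for n c d a b
      using that by (rule lin)
    show "Limsup sequentially (\<lambda>n. ereal (norm (embed (enat n) (r (?inv c))))) = ereal (norm c)"
      if "c \<in> ?L ` cyl X" for c
      using that by (rule limsup)
  qed
qed

end

theorem corollary3p62:
  fixes X :: "('x::t2_space) local_space"
    and \<mu> :: "'x measure measure"
    and l :: "'x measure \<Rightarrow> 'x cseq"
    and K :: "enat \<Rightarrow> ('k::{real_inner, complete_space}) set"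
    and \<iota> :: "enat \<Rightarrow> ('x cseq \<Rightarrow> real) \<Rightarrow> 'k"
    and r :: "('x measure \<Rightarrow> real) \<Rightarrow> 'x measure \<Rightarrow> real"
  assumes "topological_local_diffusion_space X"
    and "strong_lifting X"
    and "prob_space \<mu>" and "space \<mu> = conf X" and "sets \<mu> = sets (conf_algebra X)"
    and "AE \<gamma> in \<mu>. emeasure \<gamma> UNIV = \<infinity>"
    and "marginally_ac X \<mu>"
    and "closability_assumption X \<mu>"
    and "labeling X \<mu> l"
    and "\<And>N. hilbert_completion (pre_sobolev X \<mu>) (seq_form1 X \<mu> l N) (\<iota> N) (K N)"
    and "cyl_choice X \<mu> r"
  shows "lab_star X \<mu> (\<iota> \<infinity>) ` conf_dom X \<mu> \<subseteq> K \<infinity> \<and>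
    kuwae_shioya sequentially (\<lambda>n. K (enat n))
      (lab_star X \<mu> (\<iota> \<infinity>) ` conf_dom X \<mu>)
      (\<lambda>n. trunc_map X r \<iota> n \<circ> inv_into (cyl X) (lab_star X \<mu> (\<iota> \<infinity>)))
      (lab_star X \<mu> (\<iota> \<infinity>) ` cyl X)"
proof -
  interpret labelled_completion X \<mu> l K \<iota>
    by (intro labelled_completion.intro configuration_space.intro diffusion_space.intro
        configuration_space_axioms.intro labelled_completion_axioms.intro) (fact assms)+
  show ?thesis
    using lab_star_conf_dom_subset kuwae_shioya_labelled[OF assms(11)] by blast
qed

end
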